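(* Let $\mathcal{P}_5=\{S^m,\mathbb{R} \mid m\in\mathbb{N}\}$. Then $\mathcal{N}^{cell}(\mathcal{P}_5)$ is the class of virtually polycyclic groups.
   Context: Cellular actions: a group $G$ acts cellularly on a CW-complex $X$ if it acts by homeomorphisms permuting the open cells, and the stabilizer of any cell fixes that cell pointwise. The class $\mathcal{N}^{cell}(\mathcal{P})$: for a class $\mathcal{P}$ of finite dimensional CW-complexes, $\mathcal{N}^{cell}(\mathcal{P})$ is the smallest class of groups containing the trivial group with the property that if a group $G$ acts cellularly on some $X\in\mathcal{P}$ such that all isotropy groups are in $\mathcal{N}^{cell}(\mathcal{P})$, then $G$ is in $\mathcal{N}^{cell}(\mathcal{P})$. $\mathbb{N}$ is the set of positive integers, and the spaces listed in $\mathcal{P}_5$ (spheres and the real line) are allowed to carry any CW-structure. *)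

theory Defs
  imports "HOL-Analysis.Analysis" "HOL-Algebra.Group_Action" "HOL-Algebra.Elementary_Groups"
begin

section \<open>CW-complexes\<close>

definition closed_disc :: "nat \<Rightarrow> (nat \<Rightarrow> real) topology" where
  "closed_disc n = subtopology (Euclidean_space n) {x. (\<Sum>i<n. (x i)\<^sup>2) \<le> 1}"

definition open_disc :: "nat \<Rightarrow> (nat \<Rightarrow> real) topology" where
  "open_disc n = subtopology (Euclidean_space n) {x. (\<Sum>i<n. (x i)\<^sup>2) < 1}"

definition disc_boundary :: "nat \<Rightarrow> (nat \<Rightarrow> real) set" where
  "disc_boundary n = {x \<in> topspace (closed_disc n). (\<Sum>i<n. (x i)\<^sup>2) = 1}"

text \<open>A space together with, for every \<open>n\<close>, the set of its open \<open>n\<close>-cells.\<close>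

type_synonym 'x cell_decomposition = "'x topology \<times> (nat \<Rightarrow> 'x set set)"

definition characteristic_map ::
  "'x topology \<Rightarrow> (nat \<Rightarrow> 'x set set) \<Rightarrow> nat \<Rightarrow> 'x set \<Rightarrow> ((nat \<Rightarrow> real) \<Rightarrow> 'x) \<Rightarrow> bool" where
  "characteristic_map X E n e \<Phi> \<longleftrightarrow>
     continuous_map (closed_disc n) X \<Phi> \<and>
     homeomorphic_map (open_disc n) (subtopology X e) \<Phi> \<and>
     (\<exists>F. finite F \<and> F \<subseteq> (\<Union>k<n. E k) \<and> \<Phi> ` disc_boundary n \<subseteq> \<Union>F)"

text \<open>Whitehead's definition: closure finiteness is part of \<^const>\<open>characteristic_map\<close>, and the
  last conjunct is the weak topology. Characteristic maps are required to exist but are not part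
  of the structure.\<close>

definition CW_complex :: "'x cell_decomposition \<Rightarrow> bool" where
  "CW_complex = (\<lambda>(X, E).
     Hausdorff_space X \<and>
     (\<Union>n. \<Union>(E n)) = topspace X \<and>
     (\<forall>m n e f. e \<in> E m \<and> f \<in> E n \<and> (m, e) \<noteq> (n, f) \<longrightarrow> e \<inter> f = {}) \<and>
     (\<forall>n. \<forall>e\<in>E n. \<exists>\<Phi>. characteristic_map X E n e \<Phi>) \<and>
     (\<forall>A \<subseteq> topspace X.
        (\<forall>n. \<forall>e\<in>E n. closedin X (A \<inter> X closure_of e)) \<longrightarrow> closedin X A))"


section \<open>Cellular actions and the class of groups generated by them\<close>

definition cellular_action ::
  "('a, 'b) monoid_scheme \<Rightarrow> 'x cell_decomposition \<Rightarrow> ('a \<Rightarrow> 'x \<Rightarrow> 'x) \<Rightarrow> bool" where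
  "cellular_action G = (\<lambda>(X, E) \<phi>.
     group_action G (topspace X) \<phi> \<and>
     (\<forall>g\<in>carrier G. homeomorphic_map X X (\<phi> g)) \<and>
     (\<forall>g\<in>carrier G. \<forall>e\<in>(\<Union>n. E n). \<phi> g ` e \<in> (\<Union>n. E n)) \<and>
     (\<forall>e\<in>(\<Union>n. E n). \<forall>g\<in>carrier G. \<phi> g ` e = e \<longrightarrow> (\<forall>x\<in>e. \<phi> g x = x)))"

text \<open>The isotropy groups are subgroups of the acting group, so a derivation of membership for a
  group never leaves the element type of that group. Hence the part, on a fixed element type, of
  the smallest class of all groups is the inductive set on that type.\<close>

inductive_set N_cell :: "'x cell_decomposition set \<Rightarrow> ('a, 'b) monoid_scheme set"
  for P :: "'x cell_decomposition set" where
  trivial: "trivial_group G \<Longrightarrow> G \<in> N_cell P"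
| action: "\<lbrakk>C \<in> P; cellular_action G C \<phi>;
            \<forall>x\<in>topspace (fst C). G\<lparr>carrier := stabilizer G \<phi> x\<rparr> \<in> N_cell P\<rbrakk>
           \<Longrightarrow> G \<in> N_cell P"

text \<open>All CW-structures on spaces homeomorphic to a sphere \<open>S\<^sup>m\<close>, \<open>m \<ge> 1\<close>, or to the real line.
  The type \<^typ>\<open>nat \<Rightarrow> real\<close>, on which \<^const>\<open>nsphere\<close> lives, contains a copy of each of
  these spaces, so every such CW-complex occurs up to isomorphism. All of them are finite
  dimensional, by invariance of domain.\<close>

definition P5 :: "(nat \<Rightarrow> real) cell_decomposition set" where
  "P5 = {(X, E). CW_complex (X, E) \<and>
           ((\<exists>m\<ge>1. X homeomorphic_space nsphere m) \<or> X homeomorphic_space euclideanreal)}"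


section \<open>Virtually polycyclic groups\<close>

definition polycyclic_group :: "('a, 'b) monoid_scheme \<Rightarrow> bool" where
  "polycyclic_group G \<longleftrightarrow> group G \<and>
     (\<exists>n (H :: nat \<Rightarrow> 'a set). H 0 = {\<one>\<^bsub>G\<^esub>} \<and> H n = carrier G \<and>
        (\<forall>i\<le>n. subgroup (H i) G) \<and>
        (\<forall>i<n. H i \<lhd> G\<lparr>carrier := H (Suc i)\<rparr> \<and>
               cyclic_group (G\<lparr>carrier := H (Suc i)\<rparr> Mod H i)))"

definition virtually_polycyclic_group :: "('a, 'b) monoid_scheme \<Rightarrow> bool" where
  "virtually_polycyclic_group G \<longleftrightarrow> group G \<and>
     (\<exists>H. subgroup H G \<and> finite (rcosets\<^bsub>G\<^esub> H) \<and> polycyclic_group (G\<lparr>carrier := H\<rparr>))"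

end

theory Submission
  imports Defs
begin

text \<open>
  An action with virtually polycyclic isotropy groups forces the acting group to be virtually
  polycyclic, because both kinds of spaces leave little room. A CW-structure on a sphere has only
  finitely many cells, and the isotropy group of a point is the stabiliser of its cell, so it has
  finite index (\<open>finite_complex_isotropy_finite_index\<close>). A CW-structure on the line consists of
  points and open intervals, and its vertices form a nonempty closed discrete set. An element that
  preserves the orientation and fixes a point acts trivially: a fixed point that is a vertex drags
  along the two adjacent intervals, so the fixed point set is open
  (\<open>orientation_preserving_fixed_point\<close>). The orientation-preserving elements therefore act on
  the orbit of a vertex through a quotient by the kernel \<open>K\<close>, and as this orbit is closed and
  discrete, the quotient is cyclic. Since \<open>K\<close> lies in every isotropy group, it is virtually
  polycyclic, and what remains is algebra: virtually polycyclic groups are closed under subgroups,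
  finite extensions and extensions by cyclic groups. The last point
  (\<open>virtually_polycyclic_in_cyclic_extension\<close>) holds because a finitely generated group has only
  finitely many subgroups of a given index, so that a power of the new generator normalises a
  given polycyclic subgroup of finite index.

  Conversely, let \<open>H\<close> be polycyclic. By induction along a polycyclic series, every subgroup of
  \<open>H\<close> lies in the class (\<open>N_cell_subgroups_of_polycyclic\<close>). An extension by an infinite cyclic
  group acts by translations on the line subdivided at the integers, with the smaller group as
  isotropy group. Finite extensions are handled all at once (\<open>N_cell_finite_index\<close>): if
  \<open>L \<inter> H\<close> has finite index \<open>n \<ge> 2\<close> in \<open>L\<close>, then \<open>L\<close> permutes the \<open>n\<close> cosets transitively, hence acts
  linearly on two copies of the real functions on the cosets modulo constants, and so on the unit
  sphere \<open>S\<^sup>2\<^sup>n\<^sup>-\<^sup>3\<close> of this space. Subdivided by the order type of the coordinates, as in a Coxeter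
  complex, the sphere is a CW-complex on which permutations act cellularly: a permutation that
  preserves the order type of a function fixes this function. A point of the sphere is a pair of
  functions that are not both constant, so its isotropy group is not transitive and meets fewer
  cosets of \<open>H\<close>; induction on the index applies. Two copies are taken since for \<open>n = 2\<close> a single
  one has only \<open>S\<^sup>0\<close> as its sphere.
\<close>

section \<open>Polycyclic subgroups of a fixed group\<close>

text \<open>That \<open>A\<close> is normal in \<open>B\<close> with cyclic quotient, in terms of elements of the ambient group.\<close>
definition cyclic_over :: "('a, 'b) monoid_scheme \<Rightarrow> 'a set \<Rightarrow> 'a set \<Rightarrow> bool" where
  "cyclic_over G A B \<longleftrightarrow> A \<subseteq> B \<and>
     (\<forall>b\<in>B. \<forall>a\<in>A. b \<otimes>\<^bsub>G\<^esub> a \<otimes>\<^bsub>G\<^esub> inv\<^bsub>G\<^esub> b \<in> A) \<and>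
     (\<exists>t\<in>B. \<forall>b\<in>B. \<exists>k::int. b \<in> A #>\<^bsub>G\<^esub> (t [^]\<^bsub>G\<^esub> k))"

text \<open>Polycyclicity of a subgroup as a predicate inside one ambient group, so that rule induction along
  a polycyclic series does not change the group.\<close>
inductive polycyclic_in :: "('a, 'b) monoid_scheme \<Rightarrow> 'a set \<Rightarrow> bool" for G where
  one: "polycyclic_in G {\<one>\<^bsub>G\<^esub>}"
| step: "\<lbrakk>polycyclic_in G A; subgroup B G; cyclic_over G A B\<rbrakk> \<Longrightarrow> polycyclic_in G B"

text \<open>For subgroups, the cosets of \<open>H\<close> that meet \<open>L\<close> correspond to the cosets of \<open>L \<inter> H\<close> in \<open>L\<close>; so
  this is finiteness of the index of \<open>L \<inter> H\<close> in \<open>L\<close>, whether or not \<open>H\<close> is contained in \<open>L\<close>.\<close>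
definition finite_index :: "('a, 'b) monoid_scheme \<Rightarrow> 'a set \<Rightarrow> 'a set \<Rightarrow> bool" where
  "finite_index G L H \<longleftrightarrow> finite ((\<lambda>x. H #>\<^bsub>G\<^esub> x) ` L)"

definition virtually_polycyclic_in :: "('a, 'b) monoid_scheme \<Rightarrow> 'a set \<Rightarrow> bool" where
  "virtually_polycyclic_in G L \<longleftrightarrow> subgroup L G \<and> (\<exists>H\<subseteq>L. polycyclic_in G H \<and> finite_index G L H)"

lemma int_subgroup_principal:
  fixes Z :: "int set"
  assumes "0 \<in> Z" "\<And>x y. x \<in> Z \<Longrightarrow> y \<in> Z \<Longrightarrow> x - y \<in> Z"
  obtains d where "d \<in> Z" "\<And>z. z \<in> Z \<Longrightarrow> d dvd z"
proof (cases "Z = {0}")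
  case True
  then show ?thesis using that[of 0] by auto
next
  case False
  have neg: "- x \<in> Z" if "x \<in> Z" for x using assms(2)[OF assms(1) that] by simp
  have add: "x + y \<in> Z" if "x \<in> Z" "y \<in> Z" for x y using assms(2)[OF that(1) neg[OF that(2)]]
    by simp
  obtain x where x: "x \<in> Z" "x \<noteq> 0" using False assms(1) by blast
  define P where "P n \<longleftrightarrow> n > 0 \<and> int n \<in> Z" for n
  have "P (nat \<bar>x\<bar>)" using x neg[of x] by (auto simp: P_def abs_if)
  define d where "d = (LEAST n. P n)"
  have d: "P d" unfolding d_def using \<open>P (nat \<bar>x\<bar>)\<close> by (rule LeastI)
  have least: "P n \<Longrightarrow> d \<le> n" for n unfolding d_def by (rule Least_le)
  have mul: "int n * int d \<in> Z" for n
    by (induction n) (use d assms(1) add in \<open>auto simp: P_def algebra_simps\<close>)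
  have mul': "q * int d \<in> Z" for q
    using mul[of "nat q"] neg[OF mul[of "nat (-q)"]] by (cases "q \<ge> 0") auto
  have "int d dvd z" if "z \<in> Z" for z
  proof -
    have "z mod int d = z - (z div int d) * int d" by (simp add: minus_div_mult_eq_mod)
    then have "z mod int d \<in> Z" using assms(2)[OF that mul'] by simp
    moreover have "0 \<le> z mod int d" "z mod int d < int d" using d by (auto simp: P_def)
    ultimately have "\<not> z mod int d > 0"
      using least[of "nat (z mod int d)"] unfolding P_def by force
    then have "z mod int d = 0" using \<open>0 \<le> z mod int d\<close> by linarith
    then show ?thesis by presburger
  qed
  then show ?thesis using that[of "int d"] d by (auto simp: P_def)
qed

context group
begin

lemma mult_inv_cancel [simp]:
  assumes "a \<in> carrier G" "b \<in> carrier G"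
  shows "a \<otimes> (inv a \<otimes> b) = b" "inv a \<otimes> (a \<otimes> b) = b"
  using assms by (simp_all flip: m_assoc)

lemma polycyclic_in_subgroup: "polycyclic_in G H \<Longrightarrow> subgroup H G"
  by (induction rule: polycyclic_in.induct) (rule triv_subgroup, assumption)

lemma cyclic_over_iff:
  assumes A: "subgroup A G" and B: "subgroup B G"
  shows "cyclic_over G A B \<longleftrightarrow>
    A \<lhd> G\<lparr>carrier := B\<rparr> \<and> cyclic_group (G\<lparr>carrier := B\<rparr> Mod A)"
proof -
  let ?B = "G\<lparr>carrier := B\<rparr>"
  interpret B: group ?B using B by (rule subgroup_imp_group)
  have Bc: "b \<in> carrier G" if "b \<in> B" for b by (rule subgroup.mem_carrier[OF B that])
  have normal: "A \<lhd> ?B \<longleftrightarrow> A \<subseteq> B \<and> (\<forall>b\<in>B. \<forall>a\<in>A. b \<otimes> a \<otimes> inv b \<in> A)"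
  proof -
    have "subgroup A ?B \<longleftrightarrow> A \<subseteq> B"
      using subgroup_incl[OF A B] subgroup.subset[of A ?B] by auto
    then show ?thesis
      using B by (simp add: B.normal_inv_iff)
  qed
  have cyc: "cyclic_group (?B Mod A) \<longleftrightarrow> (\<exists>t\<in>B. \<forall>b\<in>B. \<exists>k::int. b \<in> A #> (t [^] k))"
    if N: "A \<lhd> ?B"
  proof -
    interpret N: normal A ?B by (rule N)
    interpret Q: group "?B Mod A" by (rule N.factorgroup_is_group)
    have carr: "carrier (?B Mod A) = (\<lambda>b. A #> b) ` B"
      by (auto simp: FactGroup_def RCOSETS_def)
    have pow: "(A #> t) [^]\<^bsub>?B Mod A\<^esub> k = A #> (t [^] k)" if "t \<in> B" for t and k::int
      using N.FactGroup_int_pow[of t k] that int_pow_consistent[OF B that] by simp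
    have tk: "t [^] k \<in> B" if "t \<in> B" for t and k::int
      using B that by (simp add: subgroup_int_pow_closed)
    have mem: "A #> b = A #> c \<longleftrightarrow> b \<in> A #> c" if "b \<in> B" "c \<in> B" for b c
      using that repr_independence[of b A c] rcos_self[of b A] A Bc by auto
    have "cyclic_group (?B Mod A) \<longleftrightarrow>
        (\<exists>t\<in>B. (\<lambda>b. A #> b) ` B = range (\<lambda>k::int. (A #> t) [^]\<^bsub>?B Mod A\<^esub> k))"
      unfolding Q.cyclic_group carr by blast
    also have "\<dots> \<longleftrightarrow> (\<exists>t\<in>B. (\<lambda>b. A #> b) ` B = range (\<lambda>k::int. A #> (t [^] k)))"
      by (rule bex_cong[OF refl]) (simp only: pow)
    also have "\<dots> \<longleftrightarrow> (\<exists>t\<in>B. \<forall>b\<in>B. \<exists>k::int. A #> b = A #> (t [^] k))"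
    proof -
      have "(\<lambda>b. A #> b) ` B = range (\<lambda>k::int. A #> (t [^] k)) \<longleftrightarrow>
          (\<forall>b\<in>B. \<exists>k::int. A #> b = A #> (t [^] k))" if "t \<in> B" for t
      proof -
        have "range (\<lambda>k::int. A #> (t [^] k)) \<subseteq> (\<lambda>b. A #> b) ` B"
          by (intro image_subsetI imageI tk[OF that])
        then have "(\<lambda>b. A #> b) ` B = range (\<lambda>k::int. A #> (t [^] k)) \<longleftrightarrow>
            (\<lambda>b. A #> b) ` B \<subseteq> range (\<lambda>k::int. A #> (t [^] k))" by (metis subset_antisym order_refl)
        then show ?thesis by (simp only: image_subset_iff) (simp add: image_iff)
      qed
      then show ?thesis by (rule bex_cong[OF refl])
    qed
    also have "\<dots> \<longleftrightarrow> (\<exists>t\<in>B. \<forall>b\<in>B. \<exists>k::int. b \<in> A #> (t [^] k))"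
      by (intro bex_cong[OF refl] ball_cong[OF refl] arg_cong[where f = Ex] ext mem tk)
    finally show ?thesis .
  qed
  show ?thesis
    using normal cyc unfolding cyclic_over_def by blast
qed

lemma polycyclic_group_iff:
  assumes H: "subgroup H G"
  shows "polycyclic_group (G\<lparr>carrier := H\<rparr>) \<longleftrightarrow> polycyclic_in G H"
proof
  assume "polycyclic_group (G\<lparr>carrier := H\<rparr>)"
  then obtain n A where A: "A 0 = {\<one>}" "A n = H"
    "\<And>i. i \<le> n \<Longrightarrow> subgroup (A i) (G\<lparr>carrier := H\<rparr>)"
    "\<And>i. i < n \<Longrightarrow> A i \<lhd> G\<lparr>carrier := A (Suc i)\<rparr>"
    "\<And>i. i < n \<Longrightarrow> cyclic_group (G\<lparr>carrier := A (Suc i)\<rparr> Mod A i)"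
    unfolding polycyclic_group_def by auto
  have sub: "subgroup (A i) G" if "i \<le> n" for i
    by (rule incl_subgroup[OF H A(3)[OF that]])
  have "i \<le> n \<Longrightarrow> polycyclic_in G (A i)" for i
  proof (induction i)
    case 0
    then show ?case using A(1) polycyclic_in.one by metis
  next
    case (Suc i)
    then show ?case
      using A(4,5)[of i] sub[of i] sub[of "Suc i"] cyclic_over_iff polycyclic_in.step by fastforce
  qed
  then show "polycyclic_in G H" using A(2) by blast
next
  assume "polycyclic_in G H"
  then have "\<exists>n A. A 0 = {\<one>} \<and> A n = H \<and> (\<forall>i\<le>n. subgroup (A i) G \<and> A i \<subseteq> H) \<and>
     (\<forall>i<n. cyclic_over G (A i) (A (Suc i)))"
  proof (induction rule: polycyclic_in.induct)
    case one
    show ?case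
      by (rule exI[of _ 0], rule exI[of _ "\<lambda>_. {\<one>}"]) (auto simp: triv_subgroup)
  next
    case (step C B)
    then obtain n A where A: "A 0 = {\<one>}" "A n = C" "\<forall>i\<le>n. subgroup (A i) G \<and> A i \<subseteq> C"
      "\<forall>i<n. cyclic_over G (A i) (A (Suc i))" by blast
    have "C \<subseteq> B" using step.hyps(3) by (simp add: cyclic_over_def)
    then show ?case
      using A step.hyps
      by (intro exI[of _ "Suc n"] exI[of _ "A(Suc n := B)"]) (auto simp: le_Suc_eq less_Suc_eq)
  qed
  then obtain n A where A: "A 0 = {\<one>}" "A n = H" "\<And>i. i \<le> n \<Longrightarrow> subgroup (A i) G \<and> A i \<subseteq> H"
     "\<And>i. i < n \<Longrightarrow> cyclic_over G (A i) (A (Suc i))" by blast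
  have "A i \<lhd> G\<lparr>carrier := A (Suc i)\<rparr> \<and> cyclic_group (G\<lparr>carrier := A (Suc i)\<rparr> Mod A i)"
    if "i < n" for i
    using that A(3)[of i] A(3)[of "Suc i"] A(4)[of i] cyclic_over_iff by auto
  moreover have "subgroup (A i) (G\<lparr>carrier := H\<rparr>)" if "i \<le> n" for i
    using A(3)[OF that] by (intro subgroup_incl[OF _ H]) simp_all
  ultimately show "polycyclic_group (G\<lparr>carrier := H\<rparr>)"
    unfolding polycyclic_group_def using A(1,2) subgroup_imp_group[OF H]
    by (intro conjI exI[of _ n] exI[of _ A]) auto
qed

section \<open>Subgroups of finite index\<close>

lemma finite_indexI:
  assumes "subgroup H G" "finite C" "C \<subseteq> carrier G" "L \<subseteq> (\<Union>c\<in>C. H #> c)"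
  shows "finite_index G L H"
proof -
  have "(\<lambda>x. H #> x) ` L \<subseteq> (\<lambda>x. H #> x) ` C"
  proof (rule image_subsetI)
    fix x assume "x \<in> L"
    then obtain c where c: "c \<in> C" "x \<in> H #> c" using assms(4) by auto
    then have "H #> c = H #> x" using repr_independence assms(1,3) by (metis subsetD)
    then show "H #> x \<in> (\<lambda>x. H #> x) ` C" using c(1) by (metis imageI)
  qed
  then show ?thesis
    unfolding finite_index_def using finite_surj[OF assms(2)] by simp
qed

lemma finite_indexD:
  assumes "finite_index G L H" "subgroup H G" "L \<subseteq> carrier G"
  obtains C where "finite C" "C \<subseteq> L" "L \<subseteq> (\<Union>c\<in>C. H #> c)"
proof -
  obtain C where C: "C \<subseteq> L" "finite C" "(\<lambda>x. H #> x) ` L = (\<lambda>x. H #> x) ` C"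
    using assms(1) unfolding finite_index_def by (metis finite_subset_image subset_refl)
  have "x \<in> (\<Union>c\<in>C. H #> c)" if "x \<in> L" for x
  proof -
    have "H #> x \<in> (\<lambda>x. H #> x) ` C" unfolding C(3)[symmetric] using that by (rule imageI)
    then obtain c where "c \<in> C" "H #> x = H #> c" by (rule imageE)
    moreover have "x \<in> H #> x" using rcos_self[OF _ assms(2), of x] assms(3) that by auto
    ultimately show ?thesis by auto
  qed
  then show ?thesis using that[OF C(2,1)] by (simp add: subsetI)
qed

lemma finite_index_trans:
  assumes finM: "finite_index G M L" and finL: "finite_index G L H"
    and "subgroup H G" "subgroup L G" "M \<subseteq> carrier G"
  shows "finite_index G M H"
proof -
  have Lc: "L \<subseteq> carrier G" by (rule subgroup.subset[OF assms(4)])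
  obtain C where C: "finite C" "C \<subseteq> M" "M \<subseteq> (\<Union>c\<in>C. L #> c)"
    by (rule finite_indexD[OF finM assms(4,5)])
  obtain D where D: "finite D" "D \<subseteq> L" "L \<subseteq> (\<Union>c\<in>D. H #> c)"
    by (rule finite_indexD[OF finL assms(3) Lc])
  have Hc: "h \<in> carrier G" if "h \<in> H" for h by (rule subgroup.mem_carrier[OF assms(3) that])
  show ?thesis
  proof (rule finite_indexI)
    show "finite ((\<lambda>(d,c). d \<otimes> c) ` (D \<times> C))" using C D by blast
    show "(\<lambda>(d,c). d \<otimes> c) ` (D \<times> C) \<subseteq> carrier G"
      using C(2) D(2) assms(5) Lc by (auto intro!: m_closed)
    show "M \<subseteq> (\<Union>c\<in>(\<lambda>(d,c). d \<otimes> c) ` (D \<times> C). H #> c)"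
    proof
      fix x assume "x \<in> M"
      then obtain c l where c: "c \<in> C" "l \<in> L" "x = l \<otimes> c"
        using C(3) by (auto simp: r_coset_def)
      then obtain d h where d: "d \<in> D" "h \<in> H" "l = h \<otimes> d"
        using D(3) by (fastforce simp: r_coset_def)
      have "d \<in> carrier G" "c \<in> carrier G" using c d C D assms Lc by auto
      then have "x = h \<otimes> (d \<otimes> c)" using c d Hc by (simp add: m_assoc)
      then have "x \<in> H #> (d \<otimes> c)" using d by (auto simp: r_coset_def)
      then show "x \<in> (\<Union>c\<in>(\<lambda>(d,c). d \<otimes> c) ` (D \<times> C). H #> c)" using c d by force
    qed
  qed (fact assms)
qed

lemma finite_index_Int:
  assumes "finite_index G L H" "subgroup H G" "subgroup M G" "M \<subseteq> L"
  shows "finite_index G M (H \<inter> M)"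
proof -
  have Mc: "x \<in> carrier G" if "x \<in> M" for x by (rule subgroup.mem_carrier[OF assms(3) that])
  have Hc: "x \<in> carrier G" if "x \<in> H" for x by (rule subgroup.mem_carrier[OF assms(2) that])
  have "(H \<inter> M) #> x = (H #> x) \<inter> M" if "x \<in> M" for x
  proof -
    have "h \<in> M" if "h \<in> H" "h \<otimes> x \<in> M" for h
    proof -
      have "h = (h \<otimes> x) \<otimes> inv x" using that \<open>x \<in> M\<close> Mc Hc by (simp add: m_assoc)
      then show ?thesis using that \<open>x \<in> M\<close> assms(3)
        by (metis subgroup.m_closed subgroup.m_inv_closed)
    qed
    then show ?thesis
      using that subgroup.m_closed[OF assms(3)] unfolding r_coset_def by blast
  qed
  then have "(\<lambda>x. (H \<inter> M) #> x) ` M \<subseteq> (\<lambda>C. C \<inter> M) ` ((\<lambda>x. H #> x) ` L)"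
    unfolding image_image using assms(4) by (intro image_subsetI) (metis imageI subsetD)
  then show ?thesis
    using finite_surj[OF assms(1)[unfolded finite_index_def]] unfolding finite_index_def by simp
qed

section \<open>Subgroups of polycyclic groups\<close>

lemma r_coset_pow_diff:
  assumes A: "subgroup A G" and B: "subgroup B G"
    and nrm: "\<forall>b\<in>B. \<forall>a\<in>A. b \<otimes> a \<otimes> inv b \<in> A"
    and t: "t \<in> B" and x: "x \<in> A #> (t [^] (i::int))" and y: "y \<in> A #> (t [^] (j::int))"
  shows "x \<otimes> inv y \<in> A #> (t [^] (i - j))"
proof -
  have tc: "t \<in> carrier G" by (rule subgroup.mem_carrier[OF B t])
  obtain a where a: "a \<in> A" "x = a \<otimes> t [^] i" using x by (auto simp: r_coset_def)
  obtain b where b: "b \<in> A" "y = b \<otimes> t [^] j" using y by (auto simp: r_coset_def)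
  have ab: "a \<in> carrier G" "b \<in> carrier G" using a(1) b(1)
    by (auto intro: subgroup.mem_carrier[OF A])
  let ?s = "t [^] (i - j)"
  have s: "?s = t [^] i \<otimes> inv (t [^] j)" by (rule int_pow_diff[OF tc])
  have conj: "?s \<otimes> inv b \<otimes> inv ?s \<in> A"
    by (rule nrm[rule_format, OF subgroup_int_pow_closed[OF B t] subgroup.m_inv_closed[OF A b(1)]])
  have "x \<otimes> inv y = a \<otimes> (t [^] i \<otimes> inv (t [^] j)) \<otimes> inv b"
    using a b ab tc by (simp add: inv_mult_group m_assoc)
  also have "\<dots> = (a \<otimes> (?s \<otimes> inv b \<otimes> inv ?s)) \<otimes> ?s"
    unfolding s[symmetric] using ab tc by (simp add: m_assoc)
  finally show ?thesis using subgroup.m_closed[OF A a(1) conj] by (auto simp: r_coset_def)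
qed

text \<open>The exponents \<open>k\<close> for which the coset of \<open>t\<^sup>k\<close> meets \<open>L\<close> form a subgroup of the integers. It has a
  generator \<open>d\<close>, and any element of \<open>L\<close> in the coset of \<open>t\<^sup>d\<close> generates the quotient for \<open>L\<close>.\<close>
lemma cyclic_over_Int:
  assumes A: "subgroup A G" and B: "subgroup B G" and L: "subgroup L G" and AB: "cyclic_over G A B"
  shows "cyclic_over G (A \<inter> L) (B \<inter> L)"
proof -
  obtain t where t: "t \<in> B" "\<And>b. b \<in> B \<Longrightarrow> \<exists>k::int. b \<in> A #> (t [^] k)"
    using AB unfolding cyclic_over_def by blast
  have nrm: "b \<otimes> a \<otimes> inv b \<in> A" if "b \<in> B" "a \<in> A" for a b
    using AB that unfolding cyclic_over_def by blast
  have Lc: "x \<in> carrier G" if "x \<in> L" for x by (rule subgroup.mem_carrier[OF L that])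
  have Bc: "x \<in> carrier G" if "x \<in> B" for x by (rule subgroup.mem_carrier[OF B that])
  have AsubB: "A \<subseteq> B" using AB by (simp add: cyclic_over_def)
  have Ac: "x \<in> carrier G" if "x \<in> A" for x by (rule subgroup.mem_carrier[OF A that])
  have tc: "t \<in> carrier G" using t Bc by blast
  have "\<forall>b\<in>B. \<forall>a\<in>A. b \<otimes> a \<otimes> inv b \<in> A" using nrm by blast
  note diff = r_coset_pow_diff[OF A B this t(1)]
  define Z where "Z = {k::int. \<exists>x\<in>B \<inter> L. x \<in> A #> (t [^] k)}"
  obtain d where d: "d \<in> Z" "\<And>z. z \<in> Z \<Longrightarrow> d dvd z"
  proof (rule int_subgroup_principal[of Z])
    have "\<one> \<in> B \<inter> L" "\<one> \<in> A #> (t [^] (0::int))"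
      using A B L by (auto simp: subgroup.one_closed subgroup.subset)
    then show "0 \<in> Z" unfolding Z_def by (intro CollectI bexI[of _ \<one>])
    show "x - y \<in> Z" if "x \<in> Z" "y \<in> Z" for x y
      using that diff B L unfolding Z_def
      by clarsimp (metis IntI subgroup.m_closed subgroup.m_inv_closed)
  qed blast
  then obtain s where s: "s \<in> B \<inter> L" "s \<in> A #> (t [^] d)" unfolding Z_def by blast
  have sc: "s \<in> carrier G" using s Lc by blast
  have spow: "s [^] k \<in> B \<inter> L" for k::int
    using s subgroup_int_pow_closed[OF B] subgroup_int_pow_closed[OF L] by simp
  have spn: "s [^] n \<in> A #> (t [^] (d * int n))" for n::nat
  proof (induction n)
    case 0
    then show ?case using A by (auto simp: subgroup.one_closed subgroup.subset)
  next
    case (Suc n)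
    have sn: "s [^] n \<in> B" using spow[of "int n"] by (simp add: int_pow_int)
    have "inv s \<in> A #> (t [^] (0 - d))"
      using diff[of \<one> 0 s d] s B sc A by (simp add: subgroup.one_closed subgroup.subset)
    moreover have "inv s \<in> B" using s subgroup.m_inv_closed[OF B] by simp
    ultimately have "s [^] n \<otimes> inv (inv s) \<in> A #> (t [^] (d * int n - (0 - d)))"
      using diff Suc sn by blast
    then show ?case using sc by (simp add: algebra_simps)
  qed
  have spk: "s [^] k \<in> A #> (t [^] (d * k))" for k::int
  proof (cases "k \<ge> 0")
    case True
    then show ?thesis using spn[of "nat k"] by (simp add: int_pow_int flip: int_pow_int[of _ _
      "nat k"])
  next
    case False
    let ?n = "nat (-k)"
    have "s [^] ?n \<in> B" using spow[of "int ?n"] unfolding int_pow_int by blast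
    moreover have "\<one> \<in> B" "\<one> \<in> A #> (t [^] (0::int))"
      using A B by (auto simp: subgroup.one_closed subgroup.subset)
    ultimately have "\<one> \<otimes> inv (s [^] ?n) \<in> A #> (t [^] (0 - d * int ?n))"
      using diff spn by blast
    then have "inv (s [^] ?n) \<in> A #> (t [^] (0 - d * int ?n))"
      using sc by simp
    moreover have "s [^] k = inv (s [^] ?n)"
      using False by (simp only: int_pow_def2 not_le if_True)
    moreover have "0 - d * int ?n = d * k" using False by simp
    ultimately show ?thesis by metis
  qed
  have "\<exists>k::int. b \<in> (A \<inter> L) #> (s [^] k)" if b: "b \<in> B \<inter> L" for b
  proof -
    obtain k where k: "b \<in> A #> (t [^] (k::int))" using t b by blast
    then have "k \<in> Z" using b unfolding Z_def by blast
    then obtain q where q: "k = d * q" using d by blast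
    have "b \<otimes> inv (s [^] q) \<in> A #> (t [^] (d * q - d * q))"
      using diff[of b "d*q" "s [^] q" "d*q"] b k q spk spow by auto
    then have "b \<otimes> inv (s [^] q) \<in> A" using A by (simp add: subgroup.subset)
    moreover have "b \<otimes> inv (s [^] q) \<in> L"
      using b spow L by (meson IntD2 subgroup.m_closed subgroup.m_inv_closed)
    moreover have "b = b \<otimes> inv (s [^] q) \<otimes> s [^] q" using b Lc sc by (simp add: m_assoc)
    ultimately show ?thesis by (auto simp: r_coset_def)
  qed
  moreover have "b \<otimes> a \<otimes> inv b \<in> A \<inter> L" if "b \<in> B \<inter> L" "a \<in> A \<inter> L" for a b
    using that nrm L by (simp add: subgroup.m_closed subgroup.m_inv_closed)
  ultimately show ?thesis
    unfolding cyclic_over_def using AsubB s by blast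
qed

lemma polycyclic_in_Int:
  assumes "polycyclic_in G B" "subgroup L G"
  shows "polycyclic_in G (B \<inter> L)"
  using assms(1)
proof (induction rule: polycyclic_in.induct)
  case one
  then show ?case using assms(2) polycyclic_in.one by (simp add: subgroup.one_closed)
next
  case (step A B)
  then show ?case
    using polycyclic_in.step[OF step.IH] cyclic_over_Int polycyclic_in_subgroup assms(2) subgroups_Inter_pair
    by metis
qed

section \<open>Finitely many subgroups of a given index\<close>

lemma polycyclic_in_finitely_generated:
  assumes "polycyclic_in G H"
  shows "\<exists>S. finite S \<and> S \<subseteq> H \<and> H \<subseteq> generate G S"
  using assms
proof (induction rule: polycyclic_in.induct)
  case one
  then show ?case by (intro exI[of _ "{}"]) (simp add: generate.one)
next
  case (step A B)
  obtain S where S: "finite S" "S \<subseteq> A" "A \<subseteq> generate G S" using step.IH by blast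
  obtain t where t: "t \<in> B" "\<And>b. b \<in> B \<Longrightarrow> \<exists>k::int. b \<in> A #> (t [^] k)"
    using step.hyps(3) unfolding cyclic_over_def by blast
  have AB: "A \<subseteq> B" using step.hyps(3) unfolding cyclic_over_def by blast
  have Bc: "B \<subseteq> carrier G" by (rule subgroup.subset[OF step.hyps(2)])
  let ?S = "insert t S"
  have Sc: "?S \<subseteq> carrier G" using S(2) AB Bc t(1) by blast
  have "B \<subseteq> generate G ?S"
  proof
    fix b assume "b \<in> B"
    then obtain a k where ak: "a \<in> A" "b = a \<otimes> t [^] (k::int)" using t(2) unfolding r_coset_def
      by blast
    have "a \<in> generate G ?S" using ak(1) S(3) mono_generate[of S ?S] by blast
    moreover have "t [^] k \<in> generate G ?S"
      by (rule subgroup_int_pow_closed[OF generate_is_subgroup[OF Sc]]) (simp add: generate.incl)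
    ultimately show "b \<in> generate G ?S" unfolding ak(2) by (rule generate.eng)
  qed
  then show ?case using S(1,2) AB t(1) by (intro exI[of _ ?S]) auto
qed

lemma virtually_polycyclic_in_finitely_generated:
  assumes "virtually_polycyclic_in G K"
  shows "\<exists>S. finite S \<and> S \<subseteq> K \<and> K \<subseteq> generate G S"
proof -
  have K: "subgroup K G" using assms by (simp add: virtually_polycyclic_in_def)
  obtain H where H: "H \<subseteq> K" "polycyclic_in G H" "finite_index G K H" using assms
    by (auto simp: virtually_polycyclic_in_def)
  obtain C where C: "finite C" "C \<subseteq> K" "K \<subseteq> (\<Union>c\<in>C. H #> c)"
    by (rule finite_indexD[OF H(3) polycyclic_in_subgroup[OF H(2)] subgroup.subset[OF K]])
  obtain S where S: "finite S" "S \<subseteq> H" "H \<subseteq> generate G S"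
    using polycyclic_in_finitely_generated[OF H(2)] by blast
  have "K \<subseteq> generate G (S \<union> C)"
  proof
    fix x assume "x \<in> K"
    then obtain c h where "c \<in> C" "h \<in> H" "x = h \<otimes> c" using C(3) unfolding r_coset_def by blast
    moreover have "generate G S \<subseteq> generate G (S \<union> C)" by (rule mono_generate) simp
    ultimately show "x \<in> generate G (S \<union> C)"
      using S(3) by (auto intro!: generate.eng intro: generate.incl)
  qed
  then show ?thesis using S C H(1) by (intro exI[of _ "S \<union> C"]) auto
qed

lemma r_coset_path:
  assumes "subgroup H G" "a \<in> carrier G" "b \<in> carrier G" "c \<in> carrier G" "x \<in> carrier G"
    "y \<in> carrier G"
    and "a \<otimes> x \<in> H #> b" "b \<otimes> y \<in> H #> c"
  shows "a \<otimes> (x \<otimes> y) \<in> H #> c"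
proof -
  obtain h where h: "h \<in> H" "a \<otimes> x = h \<otimes> b" using assms(7) unfolding r_coset_def by blast
  obtain k where k: "k \<in> H" "b \<otimes> y = k \<otimes> c" using assms(8) unfolding r_coset_def by blast
  have hk: "h \<in> carrier G" "k \<in> carrier G" using h k subgroup.mem_carrier[OF assms(1)] by simp_all
  have "a \<otimes> (x \<otimes> y) = (a \<otimes> x) \<otimes> y" using assms by (simp add: m_assoc)
  also have "\<dots> = h \<otimes> (b \<otimes> y)" unfolding h(2) using assms hk by (simp add: m_assoc)
  also have "\<dots> = (h \<otimes> k) \<otimes> c" unfolding k(2) using assms hk by (simp add: m_assoc)
  finally show ?thesis
    using subgroup.m_closed[OF assms(1) h(1) k(1)] unfolding r_coset_def by blast
qed

lemma r_coset_mem_iff: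
  assumes "subgroup H G" "c \<in> carrier G" "x \<in> H #> c"
  shows "x \<in> H \<longleftrightarrow> c \<in> H"
proof -
  obtain h where h: "h \<in> H" "x = h \<otimes> c" using assms(3) unfolding r_coset_def by blast
  have hc: "h \<in> carrier G" using h(1) by (rule subgroup.mem_carrier[OF assms(1)])
  have c: "c = inv h \<otimes> x" using h(2) hc assms(2) by simp
  show ?thesis
  proof
    assume "x \<in> H"
    then show "c \<in> H" unfolding c
      using subgroup.m_closed[OF assms(1) subgroup.m_inv_closed[OF assms(1) h(1)]] by simp
  next
    assume "c \<in> H"
    then show "x \<in> H" unfolding h(2) using subgroup.m_closed[OF assms(1) h(1)] by simp
  qed
qed

text \<open>Labels may repeat, so this says that \<open>H\<close> has index at most \<open>n\<close> in \<open>K\<close>; the label \<open>0\<close> denotes \<open>H\<close>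
  itself.\<close>
definition coset_labelling :: "'a set \<Rightarrow> 'a set \<Rightarrow> nat \<Rightarrow> (nat \<Rightarrow> 'a) \<Rightarrow> bool" where
  "coset_labelling K H n c \<longleftrightarrow> 0 < n \<and> c 0 = \<one> \<and> (\<forall>j<n. c j \<in> K) \<and> K \<subseteq> (\<Union>j<n. H #> c j)"

text \<open>Reading a word in the generators as a path in the graph of cosets tells whether its value lies in
  \<open>H\<close>: it does exactly if the path that starts at \<open>H\<close> also ends there. So \<open>H\<close> is determined by
  a graph on \<open>n\<close> vertices with edges labelled by generators, together with the vertices that stand
  for \<open>H\<close>, and there are finitely many such data.\<close>
lemma finitely_many_subgroups_of_index:
  assumes K: "subgroup K G" and S: "finite S" "S \<subseteq> K" "K \<subseteq> generate G S"
  shows "finite {H. subgroup H G \<and> H \<subseteq> K \<and> (\<exists>c. coset_labelling K H n c)}" (is "finite ?F")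
proof -
  define T where "T = S \<union> (\<lambda>s. inv s) ` S"
  have T: "finite T" "T \<subseteq> K"
    using S subgroup.m_inv_closed[OF K] by (auto simp: T_def)
  have Kc: "x \<in> carrier G" if "x \<in> K" for x by (rule subgroup.mem_carrier[OF K that])
  have "\<forall>H\<in>?F. \<exists>c. coset_labelling K H n c" by blast
  then obtain c where c: "\<And>H. H \<in> ?F \<Longrightarrow> coset_labelling K H n (c H)" using bchoice[of ?F
    "\<lambda>H c. coset_labelling K H n c"] by blast
  \<comment> \<open>The transition graph of the generators on the labels, and the labels that denote \<open>H\<close> itself.\<close>
  define graph where "graph H = {(s, i, j) \<in> T \<times> {..<n} \<times> {..<n}. c H i \<otimes> s \<in> H #> c H j}" for H
  define acc where "acc H = {i \<in> {..<n}. c H i \<in> H}" for H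
  have claim: "\<forall>i<n. \<exists>j<n. c H i \<otimes> x \<in> H #> c H j \<and> c H' i \<otimes> x \<in> H' #> c H' j"
    if H: "H \<in> ?F" "H' \<in> ?F" and eq: "graph H = graph H'" and x: "x \<in> generate G S" for H H' x
  proof -
    have HH: "subgroup H G" "subgroup H' G" using H by simp_all
    have cK: "c H i \<in> K" "c H' i \<in> K" if "i < n" for i
      using c[OF H(1)] c[OF H(2)] that unfolding coset_labelling_def by auto
    have letter: "\<exists>j<n. c H i \<otimes> s \<in> H #> c H j \<and> c H' i \<otimes> s \<in> H' #> c H' j"
      if s: "s \<in> T" and i: "i < n" for s i
    proof -
      have "c H i \<otimes> s \<in> K" using cK[OF i] s T(2) subgroup.m_closed[OF K] by blast
      then obtain j where j: "j < n" "c H i \<otimes> s \<in> H #> c H j"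
        using c[OF H(1)] unfolding coset_labelling_def by blast
      then have "(s, i, j) \<in> graph H" using s i unfolding graph_def by simp
      then have "(s, i, j) \<in> graph H'" using eq by simp
      then show ?thesis using j unfolding graph_def by auto
    qed
    show ?thesis using x
    proof (induction rule: generate.induct)
      case one
      have "c H i \<otimes> \<one> \<in> H #> c H i" "c H' i \<otimes> \<one> \<in> H' #> c H' i" if "i < n" for i
        using rcos_self[OF _ HH(1)] rcos_self[OF _ HH(2)] cK[OF that] Kc by simp_all
      then show ?case by blast
    next
      case (incl s)
      then have "s \<in> T" by (simp add: T_def)
      then show ?case using letter by blast
    next
      case (inv s)
      then have "inv s \<in> T" by (simp add: T_def)
      then show ?case using letter by blast
    next
      case (eng x y)
      have Sc: "S \<subseteq> carrier G" using S(2) Kc by blast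
      have xy: "x \<in> carrier G" "y \<in> carrier G"
        using eng.hyps generate_in_carrier[OF Sc] by simp_all
      show ?case
      proof (intro allI impI)
        fix i assume i: "i < n"
        obtain j where j: "j < n" "c H i \<otimes> x \<in> H #> c H j" "c H' i \<otimes> x \<in> H' #> c H' j"
          using eng.IH(1) i by blast
        obtain k where k: "k < n" "c H j \<otimes> y \<in> H #> c H k" "c H' j \<otimes> y \<in> H' #> c H' k"
          using eng.IH(2) j(1) by blast
        show "\<exists>k<n. c H i \<otimes> (x \<otimes> y) \<in> H #> c H k \<and> c H' i \<otimes> (x \<otimes> y) \<in> H' #> c H' k"
          using k(1) r_coset_path[OF HH(1) _ _ _ xy j(2) k(2)] r_coset_path[OF HH(2) _ _ _ xy j(3) k(3)]
            cK[OF i] cK[OF j(1)] cK[OF k(1)] Kc by blast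
      qed
    qed
  qed
  have sub: "H \<subseteq> H'" if H: "H \<in> ?F" "H' \<in> ?F" and eq: "graph H = graph H'" "acc H = acc H'" for H H'
  proof
    fix x assume x: "x \<in> H"
    have HH: "subgroup H G" "subgroup H' G" using H by simp_all
    have lab: "coset_labelling K H n (c H)" "coset_labelling K H' n (c H')" using c H by blast+
    have "x \<in> K" using x H(1) by blast
    then have "x \<in> generate G S" "x \<in> carrier G" using S(3) Kc by blast+
    moreover have "0 < n" "c H 0 = \<one>" "c H' 0 = \<one>" using lab unfolding coset_labelling_def
      by simp_all
    ultimately obtain j where j: "j < n" "x \<in> H #> c H j" "x \<in> H' #> c H' j"
      using claim[OF H eq(1), of x] by (metis l_one)
    have cj: "c H j \<in> carrier G" "c H' j \<in> carrier G"
      using lab j(1) Kc unfolding coset_labelling_def by blast+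
    have "c H j \<in> H" using r_coset_mem_iff[OF HH(1) cj(1) j(2)] x by simp
    then have "j \<in> acc H" using j(1) by (simp add: acc_def)
    then have "j \<in> acc H'" using eq(2) by simp
    then have "c H' j \<in> H'" by (simp add: acc_def)
    then show "x \<in> H'" using r_coset_mem_iff[OF HH(2) cj(2) j(3)] by simp
  qed
  have "inj_on (\<lambda>H. (graph H, acc H)) ?F"
    by (intro inj_onI subset_antisym sub) (simp_all only: prod.inject)
  moreover have "(\<lambda>H. (graph H, acc H)) ` ?F \<subseteq> Pow (T \<times> {..<n} \<times> {..<n}) \<times> Pow {..<n}"
    unfolding graph_def acc_def by (intro image_subsetI SigmaI) auto
  then have "finite ((\<lambda>H. (graph H, acc H)) ` ?F)"
    by (rule finite_subset) (simp add: T)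
  ultimately show ?thesis by (rule finite_imageD[rotated])
qed

lemma subgroup_conjugate:
  assumes H: "subgroup H G" and g: "g \<in> carrier G"
  shows "subgroup ((\<lambda>h. g \<otimes> h \<otimes> inv g) ` H) G"
proof -
  have Hc: "h \<in> carrier G" if "h \<in> H" for h by (rule subgroup.mem_carrier[OF H that])
  show ?thesis
  proof (rule subgroupI)
    show "(\<lambda>h. g \<otimes> h \<otimes> inv g) ` H \<subseteq> carrier G" using g Hc by auto
    show "(\<lambda>h. g \<otimes> h \<otimes> inv g) ` H \<noteq> {}" using subgroup.one_closed[OF H] by auto
  next
    fix a assume "a \<in> (\<lambda>h. g \<otimes> h \<otimes> inv g) ` H"
    then obtain h where h: "h \<in> H" "a = g \<otimes> h \<otimes> inv g" by auto
    have "inv a = g \<otimes> inv h \<otimes> inv g" using h g Hc by (simp add: inv_mult_group m_assoc)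
    then show "inv a \<in> (\<lambda>h. g \<otimes> h \<otimes> inv g) ` H" using subgroup.m_inv_closed[OF H h(1)] by auto
  next
    fix a b assume "a \<in> (\<lambda>h. g \<otimes> h \<otimes> inv g) ` H" "b \<in> (\<lambda>h. g \<otimes> h \<otimes> inv g) ` H"
    then obtain h k where h: "h \<in> H" "a = g \<otimes> h \<otimes> inv g" "k \<in> H" "b = g \<otimes> k \<otimes> inv g" by auto
    have "a \<otimes> b = g \<otimes> (h \<otimes> k) \<otimes> inv g" using h g Hc by (simp add: m_assoc)
    then show "a \<otimes> b \<in> (\<lambda>h. g \<otimes> h \<otimes> inv g) ` H" using subgroup.m_closed[OF H h(1,3)] by auto
  qed
qed

text \<open>All conjugates of \<open>H\<close> under powers of \<open>t\<close> are subgroups of \<open>K\<close> of the same index. As there are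
  only finitely many of those, two of them coincide.\<close>
lemma normalizing_power:
  assumes vp: "virtually_polycyclic_in G K" and H: "subgroup H G" "H \<subseteq> K" "finite_index G K H"
    and t: "t \<in> carrier G" "\<And>a k. a \<in> K \<Longrightarrow> t [^] (k::int) \<otimes> a \<otimes> inv (t [^] k) \<in> K"
  obtains m where "m > (0::nat)" "(\<lambda>h. t [^] int m \<otimes> h \<otimes> inv (t [^] int m)) ` H = H"
proof -
  have K: "subgroup K G" using vp by (simp add: virtually_polycyclic_in_def)
  have Kc: "x \<in> carrier G" if "x \<in> K" for x by (rule subgroup.mem_carrier[OF K that])
  have Hc: "x \<in> carrier G" if "x \<in> H" for x by (rule subgroup.mem_carrier[OF H(1) that])
  obtain S where S: "finite S" "S \<subseteq> K" "K \<subseteq> generate G S"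
    using virtually_polycyclic_in_finitely_generated[OF vp] by blast
  obtain C where C: "finite C" "C \<subseteq> K" "K \<subseteq> (\<Union>c\<in>C. H #> c)"
    by (rule finite_indexD[OF H(3,1) subgroup.subset[OF K]])
  obtain l :: "'a list" where l: "set l = C" using finite_list[OF C(1)] by blast
  define n where "n = Suc (length l)"
  define c where "c j = (\<one> # l) ! j" for j
  have cK: "c j \<in> K" if "j < n" for j
    using nth_mem[of j "\<one> # l"] that C(2) l subgroup.one_closed[OF K] unfolding c_def n_def by auto
  have cov: "\<exists>j<n. x \<in> H #> c j" if xK: "x \<in> K" for x
  proof -
    obtain d where d: "d \<in> C" "x \<in> H #> d" using C(3) xK by blast
    then obtain i where "i < length l" "l ! i = d" using l by (metis in_set_conv_nth)
    then show ?thesis using d(2) by (intro exI[of _ "Suc i"]) (simp add: c_def n_def)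
  qed
  define conj where "conj k x = t [^] (k::int) \<otimes> x \<otimes> inv (t [^] k)" for k x
  have conjK: "conj k x \<in> K" if "x \<in> K" for k x unfolding conj_def by (rule t(2)[OF that])
  have tk: "t [^] k \<in> carrier G" for k :: int using t(1) by simp
  have conj_conj: "conj i (conj j x) = conj (i + j) x" if "x \<in> carrier G" for i j x
    using that tk t(1) unfolding conj_def by (simp add: int_pow_mult inv_mult_group m_assoc)
  have conj_0: "conj 0 x = x" if "x \<in> carrier G" for x using that unfolding conj_def by simp
  have conj_mult: "conj k (x \<otimes> y) = conj k x \<otimes> conj k y" if "x \<in> carrier G" "y \<in> carrier G"
    for k x y
    using that tk unfolding conj_def by (simp add: m_assoc)
  let ?F = "{H. subgroup H G \<and> H \<subseteq> K \<and> (\<exists>c. coset_labelling K H n c)}"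
  have inF: "conj k ` H \<in> ?F" for k
  proof -
    have "subgroup (conj k ` H) G" using subgroup_conjugate[OF H(1) tk] unfolding conj_def .
    moreover have "conj k ` H \<subseteq> K" using H(2) conjK by auto
    moreover have "coset_labelling K (conj k ` H) n (\<lambda>j. conj k (c j))"
      unfolding coset_labelling_def
    proof (intro conjI allI impI)
      show "0 < n" by (simp add: n_def)
      show "conj k (c 0) = \<one>" using tk by (simp add: c_def conj_def)
      show "conj k (c j) \<in> K" if "j < n" for j using conjK cK that by blast
      show "K \<subseteq> (\<Union>j<n. conj k ` H #> conj k (c j))"
      proof
        fix x assume x: "x \<in> K"
        obtain j where j: "j < n" "conj (-k) x \<in> H #> c j" using cov conjK[OF x] by blast
        then obtain h where h: "h \<in> H" "conj (-k) x = h \<otimes> c j" unfolding r_coset_def by blast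
        have "x = conj k (conj (-k) x)" using conj_conj[of x k "-k"] conj_0 Kc[OF x] by simp
        also have "\<dots> = conj k h \<otimes> conj k (c j)"
          unfolding h(2) using conj_mult Hc[OF h(1)] Kc[OF cK[OF j(1)]] by simp
        finally have "x \<in> conj k ` H #> conj k (c j)" using h(1) unfolding r_coset_def by blast
        then show "x \<in> (\<Union>j<n. conj k ` H #> conj k (c j))" using j(1) by blast
      qed
    qed
    ultimately show ?thesis by blast
  qed
  \<comment> \<open>Two conjugates coincide, and conjugating back gives a power that normalises \<open>H\<close>.\<close>
  have "finite ?F" by (rule finitely_many_subgroups_of_index[OF K S])
  moreover have "range (\<lambda>i::nat. conj (int i) ` H) \<subseteq> ?F" by (rule image_subsetI) (rule inF)
  ultimately have "finite (range (\<lambda>i::nat. conj (int i) ` H))" by (rule finite_subset[rotated])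
  then have "\<not> inj (\<lambda>i::nat. conj (int i) ` H)" using finite_imageD infinite_UNIV_nat by blast
  then obtain i j :: nat where ij: "i < j" "conj (int i) ` H = conj (int j) ` H"
    unfolding inj_def by (metis nat_neq_iff)
  have "conj (- int i) ` conj (int i) ` H = conj (- int i) ` conj (int j) ` H" using ij(2) by simp
  then have "conj (- int i + int i) ` H = conj (- int i + int j) ` H"
    unfolding image_image using conj_conj Hc by (simp cong: image_cong_simp)
  then have "conj (int (j - i)) ` H = H"
    using conj_0 Hc ij(1) by (simp add: of_nat_diff cong: image_cong_simp)
  then show ?thesis using that[of "j - i"] ij(1) unfolding conj_def by simp
qed

section \<open>Closure properties of virtually polycyclic groups\<close>

lemma virtually_polycyclic_in_subgroup:
  assumes "virtually_polycyclic_in G L" "subgroup M G" "M \<subseteq> L"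
  shows "virtually_polycyclic_in G M"
proof -
  obtain H where H: "H \<subseteq> L" "polycyclic_in G H" "finite_index G L H" using assms(1)
    by (auto simp: virtually_polycyclic_in_def)
  have "finite_index G M (H \<inter> M)"
    by (rule finite_index_Int[OF H(3) polycyclic_in_subgroup[OF H(2)] assms(2,3)])
  then show ?thesis
    using polycyclic_in_Int[OF H(2) assms(2)] assms(2) unfolding virtually_polycyclic_in_def
      by blast
qed

lemma virtually_polycyclic_in_finite_index:
  assumes "virtually_polycyclic_in G L" "subgroup M G" "L \<subseteq> M" "finite_index G M L"
  shows "virtually_polycyclic_in G M"
proof -
  obtain H where H: "subgroup L G" "H \<subseteq> L" "polycyclic_in G H" "finite_index G L H"
    using assms(1) by (auto simp: virtually_polycyclic_in_def)
  have "finite_index G M H"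
    by (rule finite_index_trans[OF assms(4) H(4) polycyclic_in_subgroup[OF H(3)] H(1) subgroup.subset[OF assms(2)]])
  then show ?thesis
    using H(2,3) assms(2,3) unfolding virtually_polycyclic_in_def by blast
qed

text \<open>Let \<open>t\<close> generate \<open>M\<close> modulo \<open>K\<close>, and let \<open>H\<close> be polycyclic of finite index in \<open>K\<close>. A power \<open>s = t\<^sup>m\<close>
  normalises \<open>H\<close>, so \<open>H\<close> and \<open>s\<close> generate a polycyclic group, whose index in \<open>M\<close> is at most \<open>m\<close> times
  that of \<open>H\<close> in \<open>K\<close>.\<close>
lemma virtually_polycyclic_in_cyclic_extension:
  assumes vp: "virtually_polycyclic_in G K" and M: "subgroup M G" and KM: "cyclic_over G K M"
  shows "virtually_polycyclic_in G M"
proof -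
  have K: "subgroup K G" using vp by (simp add: virtually_polycyclic_in_def)
  obtain H where H: "H \<subseteq> K" "polycyclic_in G H" "finite_index G K H" using vp
    by (auto simp: virtually_polycyclic_in_def)
  have Hs: "subgroup H G" by (rule polycyclic_in_subgroup[OF H(2)])
  have Kc: "x \<in> carrier G" if "x \<in> K" for x by (rule subgroup.mem_carrier[OF K that])
  have Mc: "x \<in> carrier G" if "x \<in> M" for x by (rule subgroup.mem_carrier[OF M that])
  have Hc: "x \<in> carrier G" if "x \<in> H" for x by (rule subgroup.mem_carrier[OF Hs that])
  obtain t where t: "t \<in> M" "\<And>b. b \<in> M \<Longrightarrow> \<exists>k::int. b \<in> K #> (t [^] k)"
    using KM unfolding cyclic_over_def by blast
  have "K \<subseteq> M" and nrm: "\<And>b a. b \<in> M \<Longrightarrow> a \<in> K \<Longrightarrow> b \<otimes> a \<otimes> inv b \<in> K"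
    using KM unfolding cyclic_over_def by blast+
  have tM: "t [^] k \<in> M" for k :: int by (rule subgroup_int_pow_closed[OF M t(1)])
  have tc: "t [^] k \<in> carrier G" "t \<in> carrier G" for k :: int using tM Mc t(1) by auto
  obtain m where m: "m > (0::nat)" "(\<lambda>h. t [^] int m \<otimes> h \<otimes> inv (t [^] int m)) ` H = H"
    by (rule normalizing_power[OF vp Hs H(1,3) tc(2) nrm[OF tM]])
  define s where "s = t [^] int m"
  have sc: "s \<in> carrier G" "s [^] k \<in> carrier G" for k :: int using tc by (auto simp: s_def)
  have conj1: "s \<otimes> h \<otimes> inv s \<in> H" if "h \<in> H" for h using m(2) that unfolding s_def by blast
  have conj2: "inv s \<otimes> h \<otimes> s \<in> H" if h: "h \<in> H" for h
  proof -
    obtain h' where h': "h' \<in> H" "h = s \<otimes> h' \<otimes> inv s" using m(2) h unfolding s_def by blast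
    have "inv s \<otimes> h \<otimes> s = h'" unfolding h'(2) using sc Hc[OF h'(1)] by (simp add: m_assoc)
    then show ?thesis using h'(1) by simp
  qed
  have conjn: "s [^] n \<otimes> h \<otimes> inv (s [^] n) \<in> H \<and> inv (s [^] n) \<otimes> h \<otimes> s [^] n \<in> H" if h: "h \<in> H"
    for h and n :: nat
    using h
  proof (induction n arbitrary: h)
    case 0
    then show ?case using Hc by simp
  next
    case (Suc n)
    have "s [^] Suc n \<otimes> h \<otimes> inv (s [^] Suc n) = s [^] n \<otimes> (s \<otimes> h \<otimes> inv s) \<otimes> inv (s [^] n)"
      using sc Hc[OF Suc.prems] by (simp add: m_assoc inv_mult_group)
    moreover have "inv (s [^] Suc n) \<otimes> h \<otimes> s [^] Suc n = inv s \<otimes> (inv (s [^] n) \<otimes> h \<otimes> s [^] n) \<otimes> s"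
      using sc Hc[OF Suc.prems] by (simp add: m_assoc inv_mult_group)
    ultimately show ?case using Suc.IH conj1 conj2 Suc.prems by metis
  qed
  have conj: "s [^] k \<otimes> h \<otimes> inv (s [^] k) \<in> H" if h: "h \<in> H" for h and k :: int
  proof (cases "k < 0")
    case True
    have "s [^] k = inv (s [^] nat (- k))" by (simp only: int_pow_def2 True if_True)
    then show ?thesis using conjn[OF h, of "nat (- k)"] sc by simp
  next
    case False
    have "s [^] k = s [^] nat k" by (simp only: int_pow_def2 False if_False)
    then show ?thesis using conjn[OF h, of "nat k"] by simp
  qed
  define B where "B = (\<Union>k::int. H #> (s [^] k))"
  have BI: "h \<otimes> s [^] k \<in> B" if "h \<in> H" for h and k :: int
    using that unfolding B_def r_coset_def by blast
  have BE: "\<exists>h\<in>H. \<exists>k::int. b = h \<otimes> s [^] k" if "b \<in> B" for b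
    using that unfolding B_def r_coset_def by blast
  have Bsub: "subgroup B G"
  proof (rule subgroupI)
    show "B \<subseteq> carrier G" using BE sc Hc by (metis m_closed subsetI)
    show "B \<noteq> {}" using BI[OF subgroup.one_closed[OF Hs]] by blast
  next
    fix b assume "b \<in> B"
    then obtain h and k :: int where b: "h \<in> H" "b = h \<otimes> s [^] k" using BE by blast
    have "inv b = (s [^] (-k) \<otimes> inv h \<otimes> inv (s [^] (-k))) \<otimes> s [^] (-k)"
      using b Hc sc by (simp add: inv_mult_group m_assoc int_pow_neg)
    then show "inv b \<in> B" using BI[OF conj[OF subgroup.m_inv_closed[OF Hs b(1)]]] by simp
  next
    fix b c assume "b \<in> B" "c \<in> B"
    then obtain h g and k l :: int where b: "h \<in> H" "b = h \<otimes> s [^] k" "g \<in> H" "c = g \<otimes> s [^] l"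
      using BE by metis
    have "b \<otimes> c = h \<otimes> (s [^] k \<otimes> g \<otimes> inv (s [^] k)) \<otimes> s [^] (k + l)"
      using b Hc sc by (simp add: m_assoc int_pow_mult)
    then show "b \<otimes> c \<in> B" using BI[OF subgroup.m_closed[OF Hs b(1) conj[OF b(3)]]] by simp
  qed
  have HB: "H \<subseteq> B"
  proof
    fix h assume "h \<in> H"
    then show "h \<in> B" using BI[of h 0] Hc by simp
  qed
  have sB: "s \<in> B" using BI[OF subgroup.one_closed[OF Hs], of 1] sc by simp
  have "b \<otimes> a \<otimes> inv b \<in> H" if ba: "b \<in> B" "a \<in> H" for a b
  proof -
    obtain h and k :: int where b: "h \<in> H" "b = h \<otimes> s [^] k" using BE ba by blast
    have "b \<otimes> a \<otimes> inv b = h \<otimes> (s [^] k \<otimes> a \<otimes> inv (s [^] k)) \<otimes> inv h"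
      using b Hc[OF b(1)] Hc[OF ba(2)] sc by (simp add: m_assoc inv_mult_group)
    then show ?thesis
      using subgroup.m_closed[OF Hs subgroup.m_closed[OF Hs b(1) conj[OF ba(2)]] subgroup.m_inv_closed[OF Hs b(1)]]
      by simp
  qed
  then have "cyclic_over G H B"
    unfolding cyclic_over_def using HB sB by (auto simp: B_def)
  then have polB: "polycyclic_in G B" by (rule polycyclic_in.step[OF H(2) Bsub])
  have sM: "s [^] k \<in> M" for k :: int
    using subgroup_int_pow_closed[OF M tM[of "int m"]] unfolding s_def .
  have BM: "B \<subseteq> M"
  proof
    fix b assume "b \<in> B"
    then obtain h and k :: int where b: "h \<in> H" "b = h \<otimes> s [^] k" using BE by blast
    have "h \<in> M" using b(1) H(1) \<open>K \<subseteq> M\<close> by blast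
    then show "b \<in> M" unfolding b(2) by (rule subgroup.m_closed[OF M _ sM])
  qed
  obtain C where C: "finite C" "C \<subseteq> K" "K \<subseteq> (\<Union>c\<in>C. H #> c)"
    by (rule finite_indexD[OF H(3) Hs subgroup.subset[OF K]])
  have "finite_index G M B"
  proof (rule finite_indexI[OF Bsub])
    let ?D = "(\<lambda>(c, r). c \<otimes> t [^] int r) ` (C \<times> {..<m})"
    show "finite ?D" using C(1) by simp
    show "?D \<subseteq> carrier G" using C(2) Kc tc by (auto simp: subset_iff)
    show "M \<subseteq> (\<Union>d\<in>?D. B #> d)"
    proof
      fix x assume x: "x \<in> M"
      obtain a and k :: int where a: "a \<in> K" "x = a \<otimes> t [^] k" using t(2)[OF x]
        unfolding r_coset_def by blast
      define q where "q = k div int m"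
      define r where "r = nat (k mod int m)"
      have r: "r < m" "int r = k mod int m" using m(1) by (auto simp: r_def nat_less_iff)
      have k: "k = int m * q + int r" unfolding q_def r(2) by simp
      have sq: "s [^] q = t [^] (int m * q)" unfolding s_def by (rule int_pow_pow[OF tc(2)])
      \<comment> \<open>Pulling \<open>s\<^sup>q\<close> to the left conjugates \<open>a\<close>; the conjugate still lies in \<open>K\<close>, hence in a coset of \<open>H\<close>.\<close>
      have "s [^] (- q) \<otimes> a \<otimes> inv (s [^] (- q)) \<in> K" by (rule nrm[OF sM a(1)])
      then obtain c h where c: "c \<in> C" "h \<in> H" "s [^] (- q) \<otimes> a \<otimes> inv (s [^] (- q)) = h \<otimes> c"
        using C(3) unfolding r_coset_def by blast
      have cc: "c \<in> carrier G" "h \<in> carrier G" "a \<in> carrier G" using c C(2) Kc Hc a by auto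
      have "x = a \<otimes> (s [^] q \<otimes> t [^] int r)"
        unfolding a(2) sq k using int_pow_mult[OF tc(2)] by simp
      also have "\<dots> = s [^] q \<otimes> (s [^] (- q) \<otimes> a \<otimes> inv (s [^] (- q))) \<otimes> t [^] int r"
        using cc sc tc by (simp add: m_assoc int_pow_neg)
      also have "\<dots> = (s [^] q \<otimes> h \<otimes> inv (s [^] q)) \<otimes> s [^] q \<otimes> (c \<otimes> t [^] int r)"
        unfolding c(3) using cc sc tc by (simp add: m_assoc)
      finally have "x \<in> B #> (c \<otimes> t [^] int r)"
        using BI[OF conj[OF c(2)]] unfolding r_coset_def by blast
      moreover have "c \<otimes> t [^] int r \<in> ?D" using c(1) r(1) by force
      ultimately show "x \<in> (\<Union>d\<in>?D. B #> d)" by blast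
    qed
  qed
  then show ?thesis using polB BM M unfolding virtually_polycyclic_in_def by blast
qed

lemma virtually_polycyclic_group_iff:
  assumes L: "subgroup L G"
  shows "virtually_polycyclic_group (G\<lparr>carrier := L\<rparr>) \<longleftrightarrow> virtually_polycyclic_in G L"
proof
  have rc: "rcosets\<^bsub>G\<lparr>carrier := L\<rparr>\<^esub> H = (\<lambda>x. H #> x) ` L" for H
    by (auto simp: RCOSETS_def)
  {
    assume "virtually_polycyclic_group (G\<lparr>carrier := L\<rparr>)"
    then obtain H where H: "subgroup H (G\<lparr>carrier := L\<rparr>)" "finite ((\<lambda>x. H #> x) ` L)"
      "polycyclic_group (G\<lparr>carrier := H\<rparr>)"
      unfolding virtually_polycyclic_group_def rc by auto
    have HG: "subgroup H G" by (rule incl_subgroup[OF L H(1)])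
    have "H \<subseteq> L" using subgroup.subset[OF H(1)] by simp
    then show "virtually_polycyclic_in G L" unfolding virtually_polycyclic_in_def finite_index_def
      using L H(2) polycyclic_group_iff[OF HG] H(3) by blast
  next
    assume "virtually_polycyclic_in G L"
    then obtain H where H: "H \<subseteq> L" "polycyclic_in G H" "finite_index G L H"
      unfolding virtually_polycyclic_in_def by blast
    have HG: "subgroup H G" by (rule polycyclic_in_subgroup[OF H(2)])
    have "subgroup H (G\<lparr>carrier := L\<rparr>)" by (rule subgroup_incl[OF HG L H(1)])
    then show "virtually_polycyclic_group (G\<lparr>carrier := L\<rparr>)"
      unfolding virtually_polycyclic_group_def rc
      using subgroup_imp_group[OF L] H(3) polycyclic_group_iff[OF HG] H(2)
      unfolding finite_index_def by (intro conjI exI[of _ H]) simp_all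
  }
qed

end

section \<open>Finiteness in CW-complexes\<close>

definition unit_disc :: "nat \<Rightarrow> (nat \<Rightarrow> real) set" where
  "unit_disc n = {x. (\<forall>i\<ge>n. x i = 0) \<and> (\<Sum>i<n. (x i)\<^sup>2) \<le> 1}"

lemma Euclidean_space_eq: "Euclidean_space n = top_of_set {x. \<forall>i\<ge>n. x i = 0}"
  by (simp add: Euclidean_space_def euclidean_product_topology)

lemma closed_disc_eq: "closed_disc n = top_of_set (unit_disc n)"
  unfolding closed_disc_def Euclidean_space_eq subtopology_subtopology unit_disc_def
  by (rule arg_cong[where f = top_of_set]) auto

lemma open_disc_eq: "open_disc n = top_of_set {x. (\<forall>i\<ge>n. x i = 0) \<and> (\<Sum>i<n. (x i)\<^sup>2) < 1}"
  unfolding open_disc_def Euclidean_space_eq subtopology_subtopology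
  by (rule arg_cong[where f = top_of_set]) auto

lemma topspace_closed_disc: "topspace (closed_disc n) = unit_disc n"
  by (simp add: closed_disc_eq)

lemma topspace_open_disc: "topspace (open_disc n) = {x. (\<forall>i\<ge>n. x i = 0) \<and> (\<Sum>i<n. (x i)\<^sup>2) < 1}"
  by (simp add: open_disc_eq)

lemma closed_disc_split: "topspace (closed_disc n) = topspace (open_disc n) \<union> disc_boundary n"
  unfolding disc_boundary_def topspace_closed_disc topspace_open_disc unit_disc_def by auto

lemma continuous_on_coordinate: "continuous_on S (\<lambda>x::nat \<Rightarrow> real. x i)"
  by (rule continuous_on_subset[OF continuous_on_product_coordinates]) simp

lemma closed_coordinates_zero: "closed {x :: nat \<Rightarrow> real. \<forall>i\<ge>n. x i = 0}"
proof -
  have "{x :: nat \<Rightarrow> real. \<forall>i\<ge>n. x i = 0} = (\<Inter>i\<in>{n..}. {x. x i = 0})" by auto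
  then show ?thesis
    by (auto intro!: closed_INT closed_Collect_eq continuous_on_coordinate continuous_on_const)
qed

lemma compact_unit_disc: "compact (unit_disc n)"
proof -
  have "closed {x :: nat \<Rightarrow> real. (\<Sum>i<n. (x i)\<^sup>2) \<le> 1}"
    by (intro closed_Collect_le continuous_intros continuous_on_coordinate)
  then have "closed (unit_disc n)"
    unfolding unit_disc_def using closed_coordinates_zero by (simp add: Collect_conj_eq closed_Int)
  moreover have "unit_disc n \<subseteq> (\<Pi>\<^sub>E i\<in>UNIV. {-1..1})"
  proof
    fix x assume x: "x \<in> unit_disc n"
    have "\<bar>x i\<bar> \<le> 1" for i
    proof (cases "i < n")
      case True
      then have "(x i)\<^sup>2 \<le> (\<Sum>i<n. (x i)\<^sup>2)" by (intro member_le_sum) auto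
      also have "\<dots> \<le> 1" using x by (simp add: unit_disc_def)
      finally show ?thesis by (simp add: abs_square_le_1)
    next
      case False
      then show ?thesis using x by (simp add: unit_disc_def)
    qed
    then show "x \<in> (\<Pi>\<^sub>E i\<in>UNIV. {-1..1})" by (auto simp: abs_le_iff minus_le_iff)
  qed
  moreover have "compact (\<Pi>\<^sub>E i\<in>(UNIV::nat set). {-1..1::real})"
    using compactin_PiE[of "\<lambda>_::nat. euclideanreal" UNIV "\<lambda>_. {-1..1}"]
    by (simp add: euclidean_product_topology)
  ultimately show ?thesis by (metis Int_absorb1 compact_Int_closed)
qed

lemma compact_space_closed_disc: "compact_space (closed_disc n)"
  by (simp add: closed_disc_eq compact_space_subtopology compact_unit_disc)

lemma compact_space_nsphere: "compact_space (nsphere n)"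
proof -
  have eq: "nsphere n = top_of_set {x. (\<forall>i\<ge>Suc n. x i = 0) \<and> (\<Sum>i<Suc n. (x i)\<^sup>2) = 1}"
    unfolding nsphere_def Euclidean_space_eq subtopology_subtopology lessThan_Suc_atMost
    by (rule arg_cong[where f = top_of_set]) auto
  have "closed {x :: nat \<Rightarrow> real. (\<Sum>i<Suc n. (x i)\<^sup>2) = 1}"
    by (intro closed_Collect_eq continuous_intros continuous_on_coordinate)
  then have "compact (unit_disc (Suc n) \<inter> {x. (\<Sum>i<Suc n. (x i)\<^sup>2) = 1})"
    by (rule compact_Int_closed[OF compact_unit_disc])
  moreover have "unit_disc (Suc n) \<inter> {x. (\<Sum>i<Suc n. (x i)\<^sup>2) = 1} = {x. (\<forall>i\<ge>Suc n. x i = 0)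
    \<and> (\<Sum>i<Suc n. (x i)\<^sup>2) = 1}"
    by (auto simp: unit_disc_def)
  ultimately show ?thesis unfolding eq by (simp add: compact_space_subtopology)
qed

lemma CW_complexD:
  assumes "CW_complex (X, E)"
  shows "Hausdorff_space X" "(\<Union>n. \<Union>(E n)) = topspace X"
    "\<And>m n e f. e \<in> E m \<Longrightarrow> f \<in> E n \<Longrightarrow> e \<inter> f \<noteq> {} \<Longrightarrow> m = n \<and> e = f"
    "\<And>n e. e \<in> E n \<Longrightarrow> \<exists>\<Phi>. characteristic_map X E n e \<Phi>"
    "\<And>A. A \<subseteq> topspace X \<Longrightarrow> (\<And>n e. e \<in> E n \<Longrightarrow> closedin X (A \<inter> X closure_of e)) \<Longrightarrow> closedin X A"
  using assms unfolding CW_complex_def by (simp, simp, (clarsimp, metis), simp, simp)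

lemma characteristic_mapD:
  assumes "characteristic_map X E n e \<Phi>" "e \<subseteq> topspace X"
  shows "continuous_map (closed_disc n) X \<Phi>" "\<Phi> ` topspace (open_disc n) = e"
    "homeomorphic_map (open_disc n) (subtopology X e) \<Phi>"
    "\<exists>F. finite F \<and> F \<subseteq> (\<Union>k<n. E k) \<and> \<Phi> ` disc_boundary n \<subseteq> \<Union>F"
  using assms homeomorphic_imp_surjective_map[of "open_disc n" "subtopology X e" \<Phi>]
  unfolding characteristic_map_def by (auto simp: Int_absorb1)

lemma zero_in_open_disc: "(\<lambda>_. 0) \<in> topspace (open_disc n)"
  by (simp add: topspace_open_disc)

lemma CW_cell_subset:
  assumes "CW_complex (X, E)" "e \<in> E n"
  shows "e \<subseteq> topspace X" 
  using CW_complexD(2)[OF assms(1)] assms(2) by blast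

lemma CW_cell_nonempty:
  assumes "CW_complex (X, E)" "e \<in> E n"
  shows "e \<noteq> {}"
proof -
  obtain \<Phi> where "characteristic_map X E n e \<Phi>" using CW_complexD(4)[OF assms] by blast
  then have "\<Phi> ` topspace (open_disc n) = e"
    by (rule characteristic_mapD(2)[OF _ CW_cell_subset[OF assms]])
  then show ?thesis using zero_in_open_disc by blast
qed

lemma CW_closure_finite:
  assumes CW: "CW_complex (X, E)" and e: "e \<in> E n"
  obtains F where "finite F" "F \<subseteq> (\<Union>k<n. E k)" "X closure_of e \<subseteq> e \<union> \<Union>F"
proof -
  obtain \<Phi> where \<Phi>: "characteristic_map X E n e \<Phi>" using CW_complexD(4)[OF assms] by blast
  note D = characteristic_mapD[OF \<Phi> CW_cell_subset[OF assms]]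
  have "compactin X (\<Phi> ` topspace (closed_disc n))"
    using image_compactin D(1) compact_space_closed_disc compact_space_def by blast
  then have "closedin X (\<Phi> ` topspace (closed_disc n))"
    by (rule compactin_imp_closedin[OF CW_complexD(1)[OF CW]])
  moreover have "e \<subseteq> \<Phi> ` topspace (closed_disc n)" using D(2) closed_disc_split by blast
  ultimately have "X closure_of e \<subseteq> \<Phi> ` topspace (closed_disc n)"
    by (rule closure_of_minimal[rotated])
  also have "\<dots> = e \<union> \<Phi> ` disc_boundary n" unfolding closed_disc_split image_Un D(2) ..
  finally show ?thesis using D(4) that by (metis Un_mono order_refl subset_trans)
qed

text \<open>The closure of a cell is covered by finitely many cells, so it meets \<open>A\<close> in a finite and thus
  closed set; the weak topology does the rest.\<close>
lemma CW_closed_of_finite_in_cells: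
  assumes CW: "CW_complex (X, E)" and A: "A \<subseteq> topspace X" "\<And>n e. e \<in> E n \<Longrightarrow> finite (A \<inter> e)"
  shows "closedin X A"
proof (rule CW_complexD(5)[OF CW A(1)])
  fix n e assume e: "e \<in> E n"
  obtain F where F: "finite F" "F \<subseteq> (\<Union>k<n. E k)" "X closure_of e \<subseteq> e \<union> \<Union>F"
    by (rule CW_closure_finite[OF CW e])
  have "A \<inter> X closure_of e \<subseteq> (A \<inter> e) \<union> (\<Union>f\<in>F. A \<inter> f)" using F(3) by blast
  moreover have "finite ((A \<inter> e) \<union> (\<Union>f\<in>F. A \<inter> f))"
    using F(1,2) A(2) e by (intro finite_UnI finite_UN_I) auto
  ultimately have "finite (A \<inter> X closure_of e)" by (rule finite_subset)
  then show "closedin X (A \<inter> X closure_of e)"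
    using A(1) Hausdorff_imp_t1_space[OF CW_complexD(1)[OF CW]]
      by (simp add: t1_space_closedin_finite le_infI1)
qed

text \<open>Choose a point in each cell. All subsets of the resulting set are closed, so it has no
  accumulation point, and in a compact space this makes it finite.\<close>
lemma compact_CW_finite:
  assumes CW: "CW_complex (X, E)" and comp: "compact_space X"
  shows "finite (\<Union>n. E n)"
proof -
  let ?E = "\<Union>n. E n"
  have "\<forall>e\<in>?E. \<exists>x. x \<in> e" using CW_cell_nonempty[OF CW] by blast
  then obtain p where p: "\<And>e. e \<in> ?E \<Longrightarrow> p e \<in> e" using bchoice[of ?E "\<lambda>e x. x \<in> e"] by blast
  define A where "A = p ` ?E"
  have pe: "f = e" if "e \<in> ?E" "f \<in> ?E" "p f \<in> e" for e f
    using CW_complexD(3)[OF CW] p[OF that(2)] that by blast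
  have inj: "inj_on p ?E" by (rule inj_onI) (metis p pe)
  have A: "A \<subseteq> topspace X" using p CW_cell_subset[OF CW] unfolding A_def by blast
  have closed: "closedin X B" if B: "B \<subseteq> A" for B
  proof (rule CW_closed_of_finite_in_cells[OF CW])
    show "B \<subseteq> topspace X" using B A by blast
    fix n e assume "e \<in> E n"
    then have "B \<inter> e \<subseteq> {p e}" using B pe unfolding A_def by blast
    then show "finite (B \<inter> e)" by (rule finite_subset) simp
  qed
  have "X derived_set_of A = {}"
  proof -
    have False if x: "x \<in> X derived_set_of A" for x
    proof -
      have op: "openin X (topspace X - (A - {x}))"
        by (intro openin_diff openin_topspace closed) simp
      have xX: "x \<in> topspace X" using x by (simp add: in_derived_set_of)
      have "\<forall>T. x \<in> T \<and> openin X T \<longrightarrow> (\<exists>y. y \<noteq> x \<and> y \<in> A \<and> y \<in> T)"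
        using x by (simp add: in_derived_set_of)
      from this[rule_format, OF conjI[OF _ op]] show False using xX by auto
    qed
    then show ?thesis by blast
  qed
  then have "finite A"
    using compactin_imp_Bolzano_Weierstrass[of X "topspace X" A] comp A
      by (auto simp: compact_space_def)
  then show ?thesis unfolding A_def using finite_imageD inj by blast
qed

text \<open>A cell of least dimension has no lower cells to which a boundary point of the disc could be
  mapped, so its disc has empty boundary.\<close>
lemma CW_vertex_exists:
  assumes CW: "CW_complex (X, E)" and ne: "topspace X \<noteq> {}"
  shows "E 0 \<noteq> {}"
proof -
  have "\<exists>n. E n \<noteq> {}" using CW_complexD(2)[OF CW] ne by blast
  then have E: "E (LEAST n. E n \<noteq> {}) \<noteq> {}" by (rule LeastI_ex)
  define n where "n = (LEAST n. E n \<noteq> {})"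
  have below: "E k = {}" if "k < n" for k using not_less_Least that unfolding n_def by blast
  have "n = 0"
  proof (rule ccontr)
    assume "n \<noteq> 0"
    obtain e where e: "e \<in> E n" using E n_def by blast
    obtain \<Phi> where \<Phi>: "characteristic_map X E n e \<Phi>" using CW_complexD(4)[OF CW e] by blast
    have "(\<lambda>i. if i = 0 then 1 else 0) \<in> disc_boundary n"
      using \<open>n \<noteq> 0\<close> by (auto simp: disc_boundary_def topspace_closed_disc unit_disc_def
        if_distrib[of "\<lambda>x. x\<^sup>2"] cong: if_cong)
    then have "\<exists>F. F \<subseteq> (\<Union>k<n. E k) \<and> \<Union>F \<noteq> {}"
      using characteristic_mapD(4)[OF \<Phi> CW_cell_subset[OF CW e]] by blast
    then show False using below by blast
  qed
  then show ?thesis using E n_def by simp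
qed

section \<open>Isotropy groups of finite complexes\<close>

lemma cellular_actionD:
  assumes "cellular_action G (X, E) \<phi>"
  shows "group_action G (topspace X) \<phi>" "\<And>g. g \<in> carrier G \<Longrightarrow> homeomorphic_map X X (\<phi> g)"
    "\<And>g e. g \<in> carrier G \<Longrightarrow> e \<in> (\<Union>n. E n) \<Longrightarrow> \<phi> g ` e \<in> (\<Union>n. E n)"
    "\<And>g e x. e \<in> (\<Union>n. E n) \<Longrightarrow> g \<in> carrier G \<Longrightarrow> \<phi> g ` e = e \<Longrightarrow> x \<in> e \<Longrightarrow> \<phi> g x = x"
  using assms unfolding cellular_action_def prod.case by blast+

lemma cellular_action_group: "cellular_action G (X, E) \<phi> \<Longrightarrow> group G"
  using cellular_actionD(1) group_action.group_hom group_hom.axioms(1) by blast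

text \<open>An element that maps the cell of \<open>x\<close> to itself fixes \<open>x\<close>. So the coset of \<open>g\<close> modulo the
  isotropy group depends only on the image of this cell under the inverse of \<open>g\<close>, for which there
  are finitely many possibilities.\<close>
lemma finite_complex_isotropy_finite_index:
  fixes G (structure)
  assumes CW: "CW_complex (X, E)" and act: "cellular_action G (X, E) \<phi>"
    and fin: "finite (\<Union>n. E n)" and x: "x \<in> topspace X"
  shows "finite_index G (carrier G) (stabilizer G \<phi> x)"
proof -
  interpret group G by (rule cellular_action_group[OF act])
  interpret A: group_action G "topspace X" \<phi> by (rule cellular_actionD(1)[OF act])
  obtain n e where e: "e \<in> E n" "x \<in> e" using CW_complexD(2)[OF CW] x by blast
  have eE: "e \<in> (\<Union>n. E n)" using e by blast
  have esub: "e \<subseteq> topspace X" by (rule CW_cell_subset[OF CW e(1)])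
  have sub: "subgroup (stabilizer G \<phi> x) G" by (rule A.stabilizer_subgroup[OF x])
  have comp: "\<phi> (g \<otimes> h) ` e = \<phi> g ` \<phi> h ` e" if "g \<in> carrier G" "h \<in> carrier G" for g h
    unfolding image_image using A.composition_rule that esub by (intro image_cong) auto
  have one: "\<phi> \<one> ` e = e" using A.id_eq_one[symmetric] esub by (auto simp: subset_iff image_iff)
  let ?f = "\<lambda>g. \<phi> (inv g) ` e"
  have "?f ` carrier G \<subseteq> (\<Union>n. E n)" using cellular_actionD(3)[OF act _ eE] by blast
  then have "finite (?f ` carrier G)" using fin by (rule finite_subset)
  then obtain C where C: "finite C" "C \<subseteq> carrier G" "?f ` carrier G = ?f ` C"
    using finite_subset_image[of "?f ` carrier G" ?f "carrier G"] by auto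
  show ?thesis
  proof (rule finite_indexI[OF sub C(1,2)])
    show "carrier G \<subseteq> (\<Union>c\<in>C. stabilizer G \<phi> x #> c)"
    proof
      fix g assume g: "g \<in> carrier G"
      then have "?f g \<in> ?f ` C" unfolding C(3)[symmetric] by (rule imageI)
      then obtain c where c: "c \<in> C" "?f g = ?f c" by (rule imageE)
      have cc: "c \<in> carrier G" using c(1) C(2) by blast
      have "\<phi> (g \<otimes> inv c) ` e = \<phi> g ` ?f g" using comp[of g "inv c"] g cc c(2) by simp
      also have "\<dots> = e" using comp[of g "inv g"] g one by simp
      finally have "\<phi> (g \<otimes> inv c) x = x" using cellular_actionD(4)[OF act eE _ _ e(2)] g cc by simp
      then have "g \<otimes> inv c \<in> stabilizer G \<phi> x" using g cc by (simp add: stabilizer_def)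
      then have "g \<in> stabilizer G \<phi> x #> c"
        using subgroup.rcos_module_rev[OF sub is_group cc g] by blast
      then show "g \<in> (\<Union>c\<in>C. stabilizer G \<phi> x #> c)" using c(1) by blast
    qed
  qed
qed

section \<open>Cellular actions on the line\<close>

text \<open>What a cellular action on a CW-structure of the line looks like on the real numbers, with \<open>V\<close> as
  the set of vertices. Closedness of all subsets of \<open>V\<close> says that \<open>V\<close> is closed and discrete.\<close>
locale line_action = group G for G (structure) +
  fixes \<psi> :: "'a \<Rightarrow> real \<Rightarrow> real" and cells :: "real set set" and V :: "real set"
  assumes act_mult: "\<And>g h r. g \<in> carrier G \<Longrightarrow> h \<in> carrier G \<Longrightarrow> \<psi> (g \<otimes> h) r = \<psi> g (\<psi> h r)"
    and act_one: "\<And>r. \<psi> \<one> r = r"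
    and cont: "\<And>g. g \<in> carrier G \<Longrightarrow> continuous_on UNIV (\<psi> g)"
    and cover: "\<Union>cells = UNIV"
    and disj: "\<And>e f. e \<in> cells \<Longrightarrow> f \<in> cells \<Longrightarrow> e \<inter> f \<noteq> {} \<Longrightarrow> e = f"
    and cell: "\<And>e. e \<in> cells \<Longrightarrow> open e \<or> (\<exists>v\<in>V. e = {v})"
    and vertex: "\<And>v. v \<in> V \<Longrightarrow> {v} \<in> cells"
    and V_nonempty: "V \<noteq> {}"
    and V_closed: "\<And>A. A \<subseteq> V \<Longrightarrow> closed A"
    and perm: "\<And>g e. g \<in> carrier G \<Longrightarrow> e \<in> cells \<Longrightarrow> \<psi> g ` e \<in> cells"
    and fixes_cell: "\<And>g e r. g \<in> carrier G \<Longrightarrow> e \<in> cells \<Longrightarrow> \<psi> g ` e = e \<Longrightarrow> r \<in> e \<Longrightarrow> \<psi> g r = r"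
begin

lemma act_inv: "g \<in> carrier G \<Longrightarrow> \<psi> (inv g) (\<psi> g r) = r" "g \<in> carrier G \<Longrightarrow> \<psi> g (\<psi> (inv g) r) = r"
  using act_mult[of "inv g" g r] act_mult[of g "inv g" r] act_one by simp_all

lemma inj_act: "g \<in> carrier G \<Longrightarrow> inj (\<psi> g)"
  by (rule inj_on_inverseI[where g = "\<psi> (inv g)"]) (rule act_inv)

lemma mono_or_antimono:
  assumes "g \<in> carrier G"
  shows "strict_mono (\<psi> g) \<or> (\<forall>x y. x < y \<longrightarrow> \<psi> g y < \<psi> g x)"
  using injective_eq_monotone_map[OF is_interval_univ cont[OF assms]] inj_act[OF assms]
  unfolding monotone_on_def by blast

text \<open>Away from the vertices the line is a disjoint union of open cells.\<close>
lemma connected_in_cell: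
  assumes I: "connected I" "I \<noteq> {}" "I \<inter> V = {}"
  obtains e where "e \<in> cells" "I \<subseteq> e"
proof -
  obtain x where x: "x \<in> I" using I(2) by blast
  obtain e where e: "e \<in> cells" "x \<in> e" using cover by blast
  have op: "open f" if "f \<in> cells" "f \<inter> I \<noteq> {}" for f using cell[OF that(1)] that(2) I(3) by blast
  let ?U = "\<Union>{f \<in> cells. f \<noteq> e \<and> open f}"
  have "I \<subseteq> e \<union> ?U"
  proof
    fix y assume y: "y \<in> I"
    obtain f where f: "f \<in> cells" "y \<in> f" using cover by blast
    then have "open f" using op y by blast
    then show "y \<in> e \<union> ?U" using f by blast
  qed
  moreover have "e \<inter> ?U = {}" using disj e(1) by blast
  moreover have "open e" using op[OF e(1)] e(2) x by blast
  moreover have "open ?U" by (rule open_Union) simp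
  ultimately have "?U \<inter> I = {}" using connectedD[OF I(1), of e ?U] x e(2) by blast
  then show ?thesis using \<open>I \<subseteq> e \<union> ?U\<close> that[OF e(1)] by blast
qed

lemma fixed_point_fixes_cell:
  assumes "g \<in> carrier G" "e \<in> cells" "x \<in> e" "\<psi> g x \<in> e" "y \<in> e"
  shows "\<psi> g y = y"
proof -
  have "\<psi> g ` e = e" using disj[OF perm[OF assms(1,2)] assms(2)] assms(3,4) by blast
  then show ?thesis by (rule fixes_cell[OF assms(1,2) _ assms(5)])
qed

text \<open>The fixed point set is closed; it is also open. A fixed point in an open cell fixes that cell. Next
  to a fixed vertex, each side contains a small interval that lies in a single cell. Since \<open>g\<close> is
  increasing and continuous, it maps a point of this interval into the same interval, so it maps the
  cell to itself and hence fixes it.\<close>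
lemma orientation_preserving_fixed_point:
  assumes g: "g \<in> carrier G" and mono: "strict_mono (\<psi> g)" and a: "\<psi> g a = a"
  shows "\<psi> g r = r"
proof -
  define F where "F = {r. \<psi> g r = r}"
  have "closed F" unfolding F_def
    by (rule closed_Collect_eq[OF cont[OF g] continuous_on_id])
  moreover have "open F"
  proof (subst open_dist, intro ballI)
    fix a assume aF: "a \<in> F"
    then have a: "\<psi> g a = a" by (simp add: F_def)
    obtain e where e: "e \<in> cells" "a \<in> e" using cover by blast
    have eF: "e \<subseteq> F" using fixed_point_fixes_cell[OF g e] e(2) a unfolding F_def by auto
    show "\<exists>\<epsilon>>0. \<forall>y. dist y a < \<epsilon> \<longrightarrow> y \<in> F"
    proof (cases "open e")
      case True
      then show ?thesis using eF e(2) unfolding open_dist by blast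
    next
      case False
      have "open (- (V - {a}))" by (intro open_Compl V_closed) blast
      moreover have "a \<in> - (V - {a})" by blast
      ultimately obtain \<epsilon> where \<epsilon>: "\<epsilon> > 0" "\<And>y. dist y a < \<epsilon> \<Longrightarrow> y \<in> - (V - {a})"
        unfolding open_dist by blast
      have "isCont (\<psi> g) a" using cont[OF g] by (simp add: continuous_on_eq_continuous_at)
      then obtain \<delta> where \<delta>: "\<delta> > 0" "\<And>x. dist x a < \<delta> \<Longrightarrow> dist (\<psi> g x) a < \<epsilon>"
        unfolding continuous_at_eps_delta using \<epsilon>(1) a by metis
      define d where "d = min \<delta> \<epsilon> / 2"
      have d: "d > 0" "d < \<delta>" "d < \<epsilon>" using \<delta>(1) \<epsilon>(1) by (auto simp: d_def)
      have side: "I \<subseteq> F" if I: "connected I" "I \<subseteq> ball a \<epsilon> - {a}" "x \<in> I" "\<psi> g x \<in> I" for I x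
      proof -
        have "I \<inter> V = {}" using I(2) \<epsilon>(2) by (force simp: dist_commute subset_iff)
        moreover have "I \<noteq> {}" using I(3) by blast
        ultimately obtain f where f: "f \<in> cells" "I \<subseteq> f" using connected_in_cell[OF I(1)] by blast
        then have "f \<subseteq> F" using fixed_point_fixes_cell[OF g f(1)] I(3,4) unfolding F_def by blast
        then show ?thesis using f(2) by blast
      qed
      have "{a<..<a+\<epsilon>} \<subseteq> F"
      proof (rule side[of _ "a + d"])
        have "\<psi> g a < \<psi> g (a + d)" using mono d(1) by (simp add: strict_mono_less)
        moreover have "dist (\<psi> g (a + d)) a < \<epsilon>" by (rule \<delta>(2)) (use d in \<open>simp add: dist_real_def\<close>)
        ultimately show "\<psi> g (a + d) \<in> {a<..<a+\<epsilon>}" unfolding a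
          by (simp add: dist_real_def abs_less_iff)
      qed (use d in \<open>auto simp: dist_real_def\<close>)
      moreover have "{a-\<epsilon><..<a} \<subseteq> F"
      proof (rule side[of _ "a - d"])
        have "\<psi> g (a - d) < \<psi> g a" using mono d(1) by (simp add: strict_mono_less)
        moreover have "dist (\<psi> g (a - d)) a < \<epsilon>" by (rule \<delta>(2)) (use d in \<open>simp add: dist_real_def\<close>)
        ultimately show "\<psi> g (a - d) \<in> {a-\<epsilon><..<a}" unfolding a
          by (simp add: dist_real_def abs_less_iff)
      qed (use d in \<open>auto simp: dist_real_def\<close>)
      ultimately have "y \<in> F" if "dist y a < \<epsilon>" for y
        using that aF by (cases y a rule: linorder_cases) (auto simp: dist_real_def subset_iff)
      then show ?thesis using \<epsilon>(1) by blast
    qed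
  qed
  ultimately have "F = {} \<or> F = UNIV" using clopen by blast
  then show ?thesis using a unfolding F_def by blast
qed

definition "orientation_preserving = {g \<in> carrier G. strict_mono (\<psi> g)}"
definition "act_kernel = {g \<in> carrier G. \<forall>r. \<psi> g r = r}"

lemma orientation_preserving_subgroup: "subgroup orientation_preserving G"
proof (rule subgroupI)
  have "\<one> \<in> orientation_preserving"
    by (simp add: orientation_preserving_def strict_mono_def act_one)
  then show "orientation_preserving \<noteq> {}" by blast
  fix g assume g: "g \<in> orientation_preserving"
  then have gc: "g \<in> carrier G" and gm: "strict_mono (\<psi> g)"
    by (auto simp: orientation_preserving_def)
  have "\<psi> (inv g) x < \<psi> (inv g) y" if "x < y" for x y
  proof -
    have "\<psi> g (\<psi> (inv g) x) < \<psi> g (\<psi> (inv g) y)" using that act_inv(2)[OF gc] by simp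
    then show ?thesis using strict_mono_less[OF gm] by simp
  qed
  then show "inv g \<in> orientation_preserving"
    using gc by (simp add: orientation_preserving_def strict_mono_def)
next
  fix g h assume "g \<in> orientation_preserving" "h \<in> orientation_preserving"
  then show "g \<otimes> h \<in> orientation_preserving"
    by (simp add: orientation_preserving_def strict_mono_def act_mult)
qed (auto simp: orientation_preserving_def)

lemma act_kernel_subgroup: "subgroup act_kernel G"
proof (rule subgroupI)
  have "\<one> \<in> act_kernel" by (simp add: act_kernel_def act_one)
  then show "act_kernel \<noteq> {}" by blast
  fix g assume "g \<in> act_kernel"
  then show "inv g \<in> act_kernel" using act_inv(1)[of g] by (simp add: act_kernel_def)
next
  fix g h assume "g \<in> act_kernel" "h \<in> act_kernel"
  then show "g \<otimes> h \<in> act_kernel" by (simp add: act_kernel_def act_mult)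
qed (auto simp: act_kernel_def)

text \<open>The composition of two decreasing maps is increasing, so there are at most two cosets.\<close>
lemma orientation_preserving_finite_index: "finite_index G (carrier G) orientation_preserving"
proof (cases "carrier G \<subseteq> orientation_preserving")
  case True
  have "x \<in> orientation_preserving #> \<one>" if "x \<in> carrier G" for x
    using True that coset_mult_one[OF subgroup.subset[OF orientation_preserving_subgroup]] by blast
  then show ?thesis
    by (intro finite_indexI[OF orientation_preserving_subgroup, of "{\<one>}"]) auto
next
  case False
  then obtain h where h: "h \<in> carrier G" "h \<notin> orientation_preserving" by blast
  have anti: "\<psi> g y < \<psi> g x" if "g \<in> carrier G" "g \<notin> orientation_preserving" "x < y" for g x y
    using mono_or_antimono[OF that(1)] that by (auto simp: orientation_preserving_def)
  have hinv: "inv h \<notin> orientation_preserving"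
    using subgroup.m_inv_closed[OF orientation_preserving_subgroup, of "inv h"] h by auto
  show ?thesis
  proof (rule finite_indexI[OF orientation_preserving_subgroup, of "{\<one>, h}"])
    show "carrier G \<subseteq> (\<Union>c\<in>{\<one>, h}. orientation_preserving #> c)"
    proof
      fix g assume g: "g \<in> carrier G"
      show "g \<in> (\<Union>c\<in>{\<one>, h}. orientation_preserving #> c)"
      proof (cases "g \<in> orientation_preserving")
        case True
        then show ?thesis
          using coset_mult_one[OF subgroup.subset[OF orientation_preserving_subgroup]] by simp
      next
        case False
        have "\<psi> (g \<otimes> inv h) x < \<psi> (g \<otimes> inv h) y" if "x < y" for x y
          using anti[OF g False anti[OF _ hinv that]] g h(1) by (simp add: act_mult)
        then have "g \<otimes> inv h \<in> orientation_preserving"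
          using g h(1) by (simp add: orientation_preserving_def strict_mono_def)
        then have "g \<in> orientation_preserving #> h"
          using subgroup.rcos_module_rev[OF orientation_preserving_subgroup is_group h(1) g] by simp
        then show ?thesis by simp
      qed
    qed
  qed (use h in auto)
qed

lemma act_vertex:
  assumes "g \<in> carrier G" "v \<in> V"
  shows "\<psi> g v \<in> V"
proof -
  have "{\<psi> g v} \<in> cells" using perm[OF assms(1) vertex[OF assms(2)]] by simp
  then show ?thesis using cell[of "{\<psi> g v}"] not_open_singleton[of "\<psi> g v"] by auto
qed

lemma int_crossing:
  fixes x :: "int \<Rightarrow> real"
  assumes "x i \<le> y" "y < x j" "strict_mono x"
  obtains k where "x k \<le> y" "y < x (k + 1)"
proof (rule ccontr)
  assume "\<not> thesis"
  then have no: "x k \<le> y \<Longrightarrow> x (k + 1) \<le> y" for k using that[of k] by force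
  have "i \<le> j" using assms
    by (metis le_less_trans less_le_trans linorder_le_cases not_le strict_mono_less_eq)
  then have "x j \<le> y" by (induction rule: int_ge_induct) (use assms(1) no in auto)
  then show False using assms(2) by simp
qed

text \<open>The orbit of a vertex \<open>v\<close> is closed and discrete. If it is not just \<open>{v}\<close>, it has a least element
  \<open>t v\<close> above \<open>v\<close>, and the points \<open>t\<^sup>k v\<close> are unbounded in both directions. So for each \<open>b\<close> there is
  a \<open>k\<close> such that \<open>b v\<close> lies in the half-open interval from \<open>t\<^sup>k v\<close> to \<open>t\<^sup>k\<^sup>+\<^sup>1 v\<close>; moving back by
  \<open>t\<^sup>-\<^sup>k\<close>, minimality of \<open>t v\<close> leaves only \<open>v\<close>. Hence \<open>b\<close> agrees with \<open>t\<^sup>k\<close> up to an element that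
  fixes \<open>v\<close>, and such an element acts trivially.\<close>
lemma orientation_preserving_cyclic_over_kernel:
  "cyclic_over G act_kernel orientation_preserving"
proof -
  let ?M = orientation_preserving and ?K = act_kernel
  have Mc: "g \<in> carrier G" if "g \<in> ?M" for g using that by (simp add: orientation_preserving_def)
  have Mm: "\<psi> g x < \<psi> g y \<longleftrightarrow> x < y" if "g \<in> ?M" for g x y
    using that by (simp add: orientation_preserving_def strict_mono_less)
  have KM: "?K \<subseteq> ?M" by (auto simp: act_kernel_def orientation_preserving_def strict_mono_def)
  have nrm: "b \<otimes> a \<otimes> inv b \<in> ?K" if "b \<in> ?M" "a \<in> ?K" for a b
    using Mc[OF that(1)] that(2) act_inv(2)[of b] by (simp add: act_kernel_def act_mult)
  have fixK: "g \<in> ?K" if "g \<in> ?M" "\<psi> g x = x" for g x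
    using orientation_preserving_fixed_point[of g x] that
      by (simp add: act_kernel_def orientation_preserving_def)
  obtain v where v: "v \<in> V" using V_nonempty by blast
  have "\<exists>t\<in>?M. \<forall>b\<in>?M. \<exists>k::int. b \<in> ?K #> t [^] k"
  proof (cases "\<forall>g\<in>?M. \<psi> g v = v")
    case True
    have "b \<in> ?K #> \<one> [^] (0::int)" if "b \<in> ?M" for b
      using fixK[OF that, of v] True that coset_mult_one[OF subgroup.subset[OF act_kernel_subgroup]] by simp
    then show ?thesis using subgroup.one_closed[OF orientation_preserving_subgroup] by blast
  next
    case False
    then obtain g where g: "g \<in> ?M" "\<psi> g v \<noteq> v" by blast
    have ginv: "inv g \<in> ?M" by (rule subgroup.m_inv_closed[OF orientation_preserving_subgroup g(1)])
    \<comment> \<open>The orbit points above \<open>v\<close>; the least one exists because this set is closed.\<close>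
    define S where "S = {w. v < w \<and> (\<exists>h\<in>?M. w = \<psi> h v)}"
    have "S \<noteq> {}"
    proof (cases "v < \<psi> g v")
      case True
      then show ?thesis using g(1) unfolding S_def by blast
    next
      case False
      then have "\<psi> g v < v" using g(2) by simp
      then have "v < \<psi> (inv g) v" using Mm[OF g(1), of v "\<psi> (inv g) v"] act_inv(2)[OF Mc[OF g(1)]]
        by simp
      then show ?thesis using ginv unfolding S_def by blast
    qed
    have "S \<subseteq> V" using act_vertex[OF Mc v] unfolding S_def by blast
    then have "closed S" by (rule V_closed)
    moreover have bdd: "bdd_below S" unfolding S_def by (rule bdd_belowI[of _ v]) auto
    ultimately have "Inf S \<in> S" using closed_contains_Inf \<open>S \<noteq> {}\<close> by blast
    then obtain t where t: "t \<in> ?M" "Inf S = \<psi> t v" "v < \<psi> t v" unfolding S_def by auto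
    have tM: "t [^] k \<in> ?M" for k :: int
      by (rule subgroup_int_pow_closed[OF orientation_preserving_subgroup t(1)])
    have tc: "t \<in> carrier G" by (rule Mc[OF t(1)])
    define x where "x k = \<psi> (t [^] (k::int)) v" for k
    have x_step: "x (k + 1) = \<psi> (t [^] k) (\<psi> t v)" for k
      unfolding x_def using int_pow_mult[OF tc, of k 1] act_mult[OF int_pow_closed[OF tc] tc] tc
        by simp
    have x_less: "x k < x (k + 1)" for k unfolding x_step using Mm[OF tM] t(3) by (simp add: x_def)
    have x_mono: "strict_mono x"
    proof (rule strict_monoI)
      fix i j :: int assume "i < j"
      then have "i + 1 \<le> j" by simp
      then show "x i < x j"
        by (induction rule: int_ge_induct) (use x_less in \<open>auto intro: less_trans\<close>)
    qed
    have xV: "x k \<in> V" for k unfolding x_def by (rule act_vertex[OF Mc[OF tM] v])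
    have above: "\<exists>j. y < x j" for y
    proof (rule ccontr)
      assume "\<not> ?thesis"
      then have "bdd_above (range x)" by (auto intro!: bdd_aboveI[of _ y] simp: not_less)
      moreover have "closed (range x)" by (rule V_closed) (use xV in blast)
      ultimately have "Sup (range x) \<in> range x" using closed_contains_Sup by blast
      then obtain k where "Sup (range x) = x k" by blast
      moreover have "x (k + 1) \<le> Sup (range x)" using \<open>bdd_above (range x)\<close>
        by (intro cSup_upper) auto
      ultimately show False using x_less[of k] by simp
    qed
    have below: "\<exists>j. x j \<le> y" for y
    proof (rule ccontr)
      assume "\<not> ?thesis"
      then have "bdd_below (range x)" by (auto intro!: bdd_belowI[of _ y] simp: not_le less_imp_le)
      moreover have "closed (range x)" by (rule V_closed) (use xV in blast)
      ultimately have "Inf (range x) \<in> range x" using closed_contains_Inf by blast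
      then obtain k where "Inf (range x) = x k" by blast
      moreover have "Inf (range x) \<le> x (k - 1)" using \<open>bdd_below (range x)\<close>
        by (intro cInf_lower) auto
      ultimately show False using x_less[of "k - 1"] by simp
    qed
    have "\<exists>k::int. b \<in> ?K #> t [^] k" if b: "b \<in> ?M" for b
    proof -
      obtain i j where ij: "x i \<le> \<psi> b v" "\<psi> b v < x j" using above below by blast
      obtain k where k: "x k \<le> \<psi> b v" "\<psi> b v < x (k + 1)" by (rule int_crossing[OF ij x_mono])
      define c where "c = inv (t [^] k) \<otimes> b"
      have cM: "c \<in> ?M" unfolding c_def
        by (intro subgroup.m_closed[OF orientation_preserving_subgroup] subgroup.m_inv_closed[OF orientation_preserving_subgroup] tM b)
      have bc: "b = t [^] k \<otimes> c" unfolding c_def using tc Mc[OF b] by simp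
      have b_eq: "\<psi> b v = \<psi> (t [^] k) (\<psi> c v)" unfolding bc
        by (rule act_mult[OF int_pow_closed[OF tc] Mc[OF cM]])
      \<comment> \<open>The point \<open>c v\<close> lies between \<open>v\<close> and \<open>t v\<close>, and no orbit point lies strictly between them.\<close>
      have "\<not> \<psi> c v < v" using k(1) Mm[OF tM[of k], of "\<psi> c v" v] unfolding b_eq x_def by simp
      moreover have "\<psi> c v < \<psi> t v" using k(2) Mm[OF tM] unfolding b_eq x_step by simp
      then have "\<psi> c v \<notin> S" using cInf_lower[OF _ bdd, of "\<psi> c v"] t(2) by auto
      then have "\<not> v < \<psi> c v" using cM unfolding S_def by blast
      ultimately have "\<psi> c v = v" by simp
      then have "c \<in> ?K" using fixK[OF cM] by blast
      then have "t [^] k \<otimes> c \<otimes> inv (t [^] k) \<in> ?K" by (rule nrm[OF tM])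
      moreover have "b = (t [^] k \<otimes> c \<otimes> inv (t [^] k)) \<otimes> t [^] k"
        unfolding bc using tc Mc[OF cM] by (simp add: m_assoc)
      ultimately show ?thesis unfolding r_coset_def by blast
    qed
    then show ?thesis using t(1) by blast
  qed
  then show ?thesis unfolding cyclic_over_def using KM nrm by blast
qed

end

section \<open>CW-structures on the line\<close>

lemma open_disc_line: "topspace (open_disc 1) = (\<lambda>s i. if i = 0 then s else 0) ` {-1<..<1}"
proof -
  have "x \<in> (\<lambda>s i. if i = 0 then s else 0) ` {-1<..<1}" if x: "\<forall>i\<ge>1. x i = 0" "(x 0)\<^sup>2 < 1"
    for x :: "nat \<Rightarrow> real"
  proof
    show "x = (\<lambda>i. if i = 0 then x 0 else 0)" using x(1) by (auto simp: fun_eq_iff)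
    show "x 0 \<in> {-1<..<1}" using x(2) by (simp add: abs_square_less_1 abs_less_iff)
  qed
  then show ?thesis by (auto simp: topspace_open_disc abs_square_less_1 abs_less_iff)
qed

text \<open>In dimension one the image is open by invariance of domain; in higher dimensions the restriction
  to a planar disc would contradict invariance of dimension.\<close>
lemma cell_image_in_line:
  fixes f :: "(nat \<Rightarrow> real) \<Rightarrow> real"
  assumes cont: "continuous_on (topspace (open_disc n)) f" and inj:
    "inj_on f (topspace (open_disc n))"
  shows "n = 0 \<and> (\<exists>v. f ` topspace (open_disc n) = {v}) \<or> open (f ` topspace (open_disc n))"
proof -
  consider "n = 0" | "n = 1" | "n \<ge> 2" by linarith
  then show ?thesis
  proof cases
    case 1
    have "topspace (open_disc 0) = {\<lambda>_. 0}" by (auto simp: topspace_open_disc)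
    then show ?thesis using 1 by auto
  next
    case 2
    define k :: "real \<Rightarrow> nat \<Rightarrow> real" where "k = (\<lambda>s i. if i = 0 then s else 0)"
    have im: "topspace (open_disc n) = k ` {-1<..<1}" unfolding 2 k_def by (rule open_disc_line)
    have "continuous_on {-1<..<1} (\<lambda>s. k s i)" for i
      unfolding k_def by (cases "i = 0") (auto intro: continuous_intros)
    then have "continuous_on {-1<..<1} k" by (rule continuous_on_coordinatewise_then_product)
    then have "continuous_on {-1<..<1} (f \<circ> k)" using cont unfolding im
      by (rule continuous_on_compose)
    moreover have "inj_on k {-1<..<1}" unfolding k_def by (rule inj_onI) (metis)
    then have "inj_on (f \<circ> k) {-1<..<1}" using inj unfolding im by (rule comp_inj_on)
    ultimately have "open ((f \<circ> k) ` {-1<..<1})"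
      by (intro invariance_of_domain) simp_all
    then show ?thesis unfolding im image_comp by simp
  next
    case 3
    \<comment> \<open>The plane of the first two coordinates.\<close>
    define k :: "complex \<Rightarrow> nat \<Rightarrow> real" where
      "k = (\<lambda>z i. if i = 0 then Re z else if i = 1 then Im z else 0)"
    have kin: "k ` ball 0 1 \<subseteq> topspace (open_disc n)"
    proof
      fix x assume "x \<in> k ` ball 0 1"
      then obtain z where z: "norm z < 1" "x = k z" by auto
      have "(\<Sum>i<n. (k z i)\<^sup>2) = (\<Sum>i\<in>{0,1}. (k z i)\<^sup>2)"
        by (rule sum.mono_neutral_right) (use 3 in \<open>auto simp: k_def\<close>)
      also have "\<dots> = (norm z)\<^sup>2" by (simp add: k_def cmod_power2)
      also have "\<dots> < 1" using z(1) by (simp add: abs_square_less_1)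
      finally show "x \<in> topspace (open_disc n)" using z(2) 3 by (simp add: topspace_open_disc k_def)
    qed
    have "continuous_on (ball 0 1) (\<lambda>z. k z i)" for i
      unfolding k_def by (cases "i = 0"; cases "i = 1") (auto intro: continuous_intros)
    then have "continuous_on (ball 0 1) k" by (rule continuous_on_coordinatewise_then_product)
    then have "continuous_on (ball 0 1) (f \<circ> k)"
      using continuous_on_subset[OF cont kin] by (rule continuous_on_compose)
    moreover have "inj_on k (ball 0 1)"
    proof (rule inj_onI)
      fix z w assume "k z = k w"
      then have "k z 0 = k w 0" "k z 1 = k w 1" by simp_all
      then show "z = w" by (simp add: k_def complex_eq_iff)
    qed
    then have "inj_on (f \<circ> k) (ball 0 1)" using inj_on_subset[OF inj kin] by (rule comp_inj_on)
    ultimately have "DIM(complex) \<le> DIM(real)"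
      by (intro invariance_of_dimension[of "ball 0 1" "f \<circ> k"]) simp_all
    then show ?thesis by simp
  qed
qed

lemma line_complex_action:
  fixes G (structure)
  assumes CW: "CW_complex (X, E)" and act: "cellular_action G (X, E) \<phi>" and line:
    "X homeomorphic_space euclideanreal"
  shows "\<exists>K M. subgroup K G \<and> subgroup M G \<and> cyclic_over G K M \<and> finite_index G (carrier G) M \<and>
    (\<forall>x\<in>topspace X. K \<subseteq> stabilizer G \<phi> x)"
proof -
  interpret group G by (rule cellular_action_group[OF act])
  interpret A: group_action G "topspace X" \<phi> by (rule cellular_actionD(1)[OF act])
  obtain h k where hk: "homeomorphic_maps X euclideanreal h k"
    using line unfolding homeomorphic_space_def by blast
  have h: "continuous_map X euclideanreal h" and k: "continuous_map euclideanreal X k"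
    and kh: "\<And>x. x \<in> topspace X \<Longrightarrow> k (h x) = x" and hk': "\<And>r. h (k r) = r"
    using hk unfolding homeomorphic_maps_def by simp_all
  have kX: "k r \<in> topspace X" for r using continuous_map_image_subset_topspace[OF k] by auto
  have gX: "\<phi> g x \<in> topspace X" if "g \<in> carrier G" "x \<in> topspace X" for g x
    using A.element_image that by blast
  define \<psi> where "\<psi> g r = h (\<phi> g (k r))" for g r
  define cells where "cells = (\<lambda>e. h ` e) ` (\<Union>n. E n)"
  define V where "V = h ` \<Union>(E 0)"
  have eX: "e \<subseteq> topspace X" if "e \<in> (\<Union>n. E n)" for e using CW_cell_subset[OF CW] that by blast
  have kim: "k ` h ` A = A" if "A \<subseteq> topspace X" for A
    unfolding image_image using kh that by (simp add: subset_iff cong: image_cong_simp)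
  have \<psi>im: "\<psi> g ` h ` e = h ` \<phi> g ` e" if "e \<in> (\<Union>n. E n)" for g e
    unfolding image_image \<psi>_def using kh eX[OF that] by (intro image_cong) auto
  have celldim: "n = 0 \<and> (\<exists>v. h ` e = {v}) \<or> open (h ` e)" if e: "e \<in> E n" for n e
  proof -
    obtain \<Phi> where "characteristic_map X E n e \<Phi>" using CW_complexD(4)[OF CW e] by blast
    note D = characteristic_mapD[OF this CW_cell_subset[OF CW e]]
    have "continuous_map (open_disc n) X \<Phi>"
      using homeomorphic_imp_continuous_map[OF D(3)] continuous_map_in_subtopology by blast
    then have "continuous_map (open_disc n) euclideanreal (h \<circ> \<Phi>)" using h
      by (rule continuous_map_compose)
    then have c: "continuous_on (topspace (open_disc n)) (h \<circ> \<Phi>)" unfolding open_disc_eq by simp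
    have "inj_on h e"
      by (rule inj_on_inverseI[where g = k]) (use kh CW_cell_subset[OF CW e] in blast)
    then have i: "inj_on (h \<circ> \<Phi>) (topspace (open_disc n))"
      using homeomorphic_imp_injective_map[OF D(3)] D(2) by (intro comp_inj_on) auto
    have "(h \<circ> \<Phi>) ` topspace (open_disc n) = h ` e" unfolding image_comp[symmetric] D(2) ..
    then show ?thesis using cell_image_in_line[OF c i] by simp
  qed
  have zero_cell: "\<exists>v. e = {v}" if e: "e \<in> E 0" for e
  proof -
    obtain \<Phi> where "characteristic_map X E 0 e \<Phi>" using CW_complexD(4)[OF CW e] by blast
    note D = characteristic_mapD[OF this CW_cell_subset[OF CW e]]
    have "topspace (open_disc 0) = {\<lambda>_. 0}" by (auto simp: topspace_open_disc)
    then show ?thesis using D(2) by auto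
  qed
  interpret L: line_action G \<psi> cells V
  proof
    fix g h' r assume "g \<in> carrier G" "h' \<in> carrier G"
    then show "\<psi> (g \<otimes> h') r = \<psi> g (\<psi> h' r)"
      unfolding \<psi>_def using A.composition_rule[OF kX] kh gX kX by simp
  next
    fix r show "\<psi> \<one> r = r" unfolding \<psi>_def A.id_eq_one[symmetric] using kX hk' by simp
  next
    fix g assume "g \<in> carrier G"
    then have "continuous_map euclideanreal euclideanreal (h \<circ> (\<phi> g \<circ> k))"
      using cellular_actionD(2)[OF act] homeomorphic_imp_continuous_map continuous_map_compose h k
        by metis
    then show "continuous_on UNIV (\<psi> g)" unfolding \<psi>_def comp_def by simp
  next
    have "r \<in> \<Union>cells" for r
    proof -
      obtain n e where e: "e \<in> E n" "k r \<in> e" using kX[of r] CW_complexD(2)[OF CW] by blast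
      then have "h (k r) \<in> h ` e" by blast
      then show ?thesis using e(1) hk' unfolding cells_def by auto
    qed
    then show "\<Union>cells = UNIV" by blast
  next
    fix e f assume "e \<in> cells" "f \<in> cells" and ne: "e \<inter> f \<noteq> {}"
    then obtain e' f' m n where ef: "e' \<in> E m" "f' \<in> E n" "e = h ` e'" "f = h ` f'"
      unfolding cells_def by blast
    obtain x y where xy: "x \<in> e'" "y \<in> f'" "h x = h y" using ne ef(3,4) by auto
    then have "x = y" using kh CW_cell_subset[OF CW] ef(1,2) by (metis subsetD)
    then show "e = f" using CW_complexD(3)[OF CW ef(1,2)] xy ef(3,4) by blast
  next
    fix e assume "e \<in> cells"
    then obtain n e' where e: "e' \<in> E n" "e = h ` e'" unfolding cells_def by blast
    show "open e \<or> (\<exists>v\<in>V. e = {v})"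
    proof (cases "n = 0")
      case True
      then obtain x where "e' = {x}" using zero_cell e(1) by blast
      then show ?thesis using True e unfolding V_def by auto
    qed (use celldim[OF e(1)] e(2) in simp)
  next
    fix v assume "v \<in> V"
    then obtain e x where "e \<in> E 0" "x \<in> e" "v = h x" unfolding V_def by blast
    moreover from this zero_cell have "e = {x}" by blast
    ultimately show "{v} \<in> cells" unfolding cells_def by force
  next
    obtain e where "e \<in> E 0" using CW_vertex_exists[OF CW] kX by blast
    then show "V \<noteq> {}" using zero_cell unfolding V_def by blast
  next
    fix A assume A: "A \<subseteq> V"
    define B where "B = k ` A"
    have AB: "A = h ` B" unfolding B_def image_image using hk' by simp
    have BV: "B \<subseteq> \<Union>(E 0)"
    proof
      fix b assume "b \<in> B"
      then obtain e x where "e \<in> E 0" "x \<in> e" "b = k (h x)" using A unfolding B_def V_def by blast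
      then show "b \<in> \<Union>(E 0)" using kh CW_cell_subset[OF CW] by fastforce
    qed
    have "closedin X B"
    proof (rule CW_closed_of_finite_in_cells[OF CW])
      show "B \<subseteq> topspace X" unfolding B_def using kX by blast
      fix n e assume e: "e \<in> E n"
      show "finite (B \<inter> e)"
      proof (cases "e \<in> E 0")
        case True
        then obtain v where "e = {v}" using zero_cell by blast
        then show ?thesis by simp
      next
        case False
        then have "B \<inter> e = {}" using BV CW_complexD(3)[OF CW _ e] by blast
        then show ?thesis by simp
      qed
    qed
    then have "closedin euclideanreal (h ` B)"
      using homeomorphic_maps_map hk homeomorphic_imp_closed_map closed_map_def by metis
    then show "closed A" unfolding AB by simp
  next
    fix g e assume g: "g \<in> carrier G" and "e \<in> cells"
    then obtain e' where e: "e' \<in> (\<Union>n. E n)" "e = h ` e'" unfolding cells_def by blast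
    show "\<psi> g ` e \<in> cells" unfolding e(2) \<psi>im[OF e(1)] cells_def
      by (rule imageI[OF cellular_actionD(3)[OF act g e(1)]])
  next
    fix g e r assume g: "g \<in> carrier G" and "e \<in> cells" and eq: "\<psi> g ` e = e" and r: "r \<in> e"
    then obtain e' where e: "e' \<in> (\<Union>n. E n)" "e = h ` e'" unfolding cells_def by blast
    have "\<phi> g ` e' \<subseteq> topspace X" using gX[OF g] eX[OF e(1)] by blast
    then have "\<phi> g ` e' = e'" using eq kim[OF eX[OF e(1)]] kim[of "\<phi> g ` e'"]
      unfolding e(2) \<psi>im[OF e(1)] by metis
    moreover have "k r \<in> e'" using r kim[OF eX[OF e(1)]] unfolding e(2) by blast
    ultimately have "\<phi> g (k r) = k r" by (rule cellular_actionD(4)[OF act e(1) g])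
    then show "\<psi> g r = r" unfolding \<psi>_def using hk' by simp
  qed
  have "L.act_kernel \<subseteq> stabilizer G \<phi> x" if x: "x \<in> topspace X" for x
  proof
    fix g assume "g \<in> L.act_kernel"
    then have g: "g \<in> carrier G" "h (\<phi> g (k (h x))) = h x" by (auto simp: L.act_kernel_def \<psi>_def)
    then have "\<phi> g x = x" using kh[OF gX[OF g(1) x]] kh[OF x] by simp
    then show "g \<in> stabilizer G \<phi> x" using g(1) by (simp add: stabilizer_def)
  qed
  then show ?thesis
    using L.act_kernel_subgroup L.orientation_preserving_subgroup
      L.orientation_preserving_cyclic_over_kernel L.orientation_preserving_finite_index by blast
qed

text \<open>The isotropy group of any point is virtually polycyclic by induction. On a sphere it has finite
  index. On the line it contains the kernel of the action, over which a subgroup of finite index is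
  cyclic.\<close>
lemma N_cell_virtually_polycyclic:
  fixes G :: "('a, 'b) monoid_scheme"
  assumes "G \<in> N_cell P5"
  shows "virtually_polycyclic_group G"
  using assms
proof (induction rule: N_cell.induct)
  case (trivial G)
  then interpret group G by (simp add: trivial_group_def)
  have eq: "carrier G = {\<one>\<^bsub>G\<^esub>}" using trivial by (simp add: trivial_group_def)
  have "virtually_polycyclic_in G (carrier G)"
    unfolding virtually_polycyclic_in_def finite_index_def eq
      using polycyclic_in.one[of G] triv_subgroup by auto
  then show ?case using virtually_polycyclic_group_iff[OF subgroup_self] by simp
next
  case (action C G \<phi>)
  obtain X E where C: "C = (X, E)" by (cases C)
  have act: "cellular_action G (X, E) \<phi>" using action.hyps(2) C by simp
  have CW: "CW_complex (X, E)" using action.hyps(1) unfolding P5_def C by simp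
  interpret group G by (rule cellular_action_group[OF act])
  interpret A: group_action G "topspace X" \<phi> by (rule cellular_actionD(1)[OF act])
  have st: "subgroup (stabilizer G \<phi> x) G" if "x \<in> topspace X" for x
    by (rule A.stabilizer_subgroup[OF that])
  have vp: "virtually_polycyclic_in G (stabilizer G \<phi> x)" if "x \<in> topspace X" for x
    using action.IH that virtually_polycyclic_group_iff[OF st[OF that]] C by simp
  have "virtually_polycyclic_in G (carrier G)"
  proof (cases "X homeomorphic_space euclideanreal")
    case True
    obtain k where "continuous_map euclideanreal X k"
      using True unfolding homeomorphic_space_def homeomorphic_maps_def by blast
    then obtain x where x: "x \<in> topspace X" using continuous_map_image_subset_topspace by fastforce
    obtain K M where KM: "subgroup K G" "subgroup M G" "cyclic_over G K M"
      "finite_index G (carrier G) M"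
      "K \<subseteq> stabilizer G \<phi> x"
      using line_complex_action[OF CW act True] x by blast
    have "virtually_polycyclic_in G K"
      by (rule virtually_polycyclic_in_subgroup[OF vp[OF x] KM(1,5)])
    then have "virtually_polycyclic_in G M"
      by (rule virtually_polycyclic_in_cyclic_extension[OF _ KM(2,3)])
    then show ?thesis
      by (rule virtually_polycyclic_in_finite_index[OF _ subgroup_self subgroup.subset[OF KM(2)] KM(4)])
  next
    case False
    then obtain m where m: "X homeomorphic_space nsphere m"
      using action.hyps(1) unfolding P5_def C by auto
    then have "compact_space X" using homeomorphic_compact_space compact_space_nsphere by blast
    then have fin: "finite (\<Union>n. E n)" by (rule compact_CW_finite[OF CW])
    have "topspace X \<noteq> {}" using homeomorphic_empty_space[OF m] nonempty_nsphere[of m] by auto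
    then obtain x where x: "x \<in> topspace X" by blast
    show ?thesis
      by (rule virtually_polycyclic_in_finite_index[OF vp[OF x] subgroup_self subgroup.subset[OF st[OF x]]
            finite_complex_isotropy_finite_index[OF CW act fin x]])
  qed
  then show ?case using virtually_polycyclic_group_iff[OF subgroup_self] by simp
qed

section \<open>Radial homeomorphisms\<close>

abbreviation Euc :: "nat \<Rightarrow> (nat \<Rightarrow> real) set" where
  "Euc n \<equiv> {x. \<forall>i\<ge>n. x i = 0}"

text \<open>Gauges of star-shaped neighbourhoods of the origin; the last clause says that the unit ball is
  bounded.\<close>
definition norm_like :: "nat \<Rightarrow> ((nat \<Rightarrow> real) \<Rightarrow> real) \<Rightarrow> bool" where
  "norm_like n N \<longleftrightarrow> continuous_on (Euc n) N \<and>
     (\<forall>y\<in>Euc n. \<forall>t\<ge>0. N (\<lambda>i. t * y i) = t * N y) \<and>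
     (\<exists>C>0. \<forall>y\<in>Euc n. \<forall>i. \<bar>y i\<bar> \<le> C * N y)"

text \<open>The rescaling of each ray that turns the values of \<open>M\<close> into values of \<open>N\<close>. At the origin
  \<open>0 / 0 = 0\<close> yields the right value.\<close>
definition radial :: "((nat \<Rightarrow> real) \<Rightarrow> real) \<Rightarrow> ((nat \<Rightarrow> real) \<Rightarrow> real) \<Rightarrow> (nat \<Rightarrow> real) \<Rightarrow> nat \<Rightarrow> real"
  where
  "radial M N y = (\<lambda>i. M y / N y * y i)"

lemma norm_likeD:
  assumes "norm_like n N"
  shows "continuous_on (Euc n) N" "\<And>y t. y \<in> Euc n \<Longrightarrow> 0 \<le> t \<Longrightarrow> N (\<lambda>i. t * y i) = t * N y"
    "\<exists>C>0. \<forall>y\<in>Euc n. \<forall>i. \<bar>y i\<bar> \<le> C * N y"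
  using assms unfolding norm_like_def by blast+

lemma norm_like_nonneg:
  assumes "norm_like n N" "y \<in> Euc n"
  shows "0 \<le> N y"
proof -
  obtain C where C: "C > 0" "\<forall>y\<in>Euc n. \<forall>i. \<bar>y i\<bar> \<le> C * N y" using norm_likeD(3)[OF assms(1)]
    by blast
  have "0 \<le> \<bar>y 0\<bar>" by simp
  also have "\<dots> \<le> C * N y" using C(2) assms(2) by blast
  finally show ?thesis using C(1) by (simp add: zero_le_mult_iff)
qed

lemma norm_like_zero: "norm_like n N \<Longrightarrow> N (\<lambda>_. 0) = 0"
  using norm_likeD(2)[of n N "\<lambda>_. 0" 0] by simp

lemma norm_like_eq_0: "norm_like n N \<Longrightarrow> y \<in> Euc n \<Longrightarrow> N y = 0 \<longleftrightarrow> y = (\<lambda>_. 0)"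
proof
  assume N: "norm_like n N" and y: "y \<in> Euc n" "N y = 0"
  obtain C where "\<forall>y\<in>Euc n. \<forall>i. \<bar>y i\<bar> \<le> C * N y" using norm_likeD(3)[OF N] by blast
  then have "\<bar>y i\<bar> \<le> C * N y" for i using y(1) by blast
  then have "\<bar>y i\<bar> \<le> 0" for i unfolding y(2) by simp
  then show "y = (\<lambda>_. 0)" by auto
qed (simp add: norm_like_zero)

lemma radial_in_Euc: "y \<in> Euc n \<Longrightarrow> radial M N y \<in> Euc n"
  by (simp add: radial_def)

lemma norm_like_radial:
  assumes M: "norm_like n M" and N: "norm_like n N" and y: "y \<in> Euc n"
  shows "N (radial M N y) = M y"
proof -
  have "N (radial M N y) = M y / N y * N y"
    unfolding radial_def
      by (rule norm_likeD(2)[OF N y]) (simp add: norm_like_nonneg[OF M y] norm_like_nonneg[OF N y])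
  then show ?thesis using norm_like_eq_0[OF N y] norm_like_eq_0[OF M y] by (cases
    "N y = 0") simp_all
qed

lemma radial_radial:
  assumes M: "norm_like n M" and N: "norm_like n N" and y: "y \<in> Euc n"
  shows "radial N M (radial M N y) = y"
proof (cases "y = (\<lambda>_. 0)")
  case True
  then show ?thesis by (simp add: radial_def)
next
  case False
  then have "M y \<noteq> 0" "N y \<noteq> 0" using norm_like_eq_0[OF M y] norm_like_eq_0[OF N y] by simp_all
  moreover have "M (radial M N y) = M y / N y * M y"
    unfolding radial_def
      by (rule norm_likeD(2)[OF M y]) (simp add: norm_like_nonneg[OF M y] norm_like_nonneg[OF N y])
  ultimately show ?thesis
    unfolding radial_def[of N M] using norm_like_radial[OF M N y] by (simp add: radial_def)
qed

text \<open>Away from the origin this is a quotient of continuous functions. At the origin, the last clause in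
  \<^const>\<open>norm_like\<close> bounds each coordinate by a multiple of \<open>M\<close>, which tends to zero.\<close>
lemma continuous_on_radial:
  assumes M: "norm_like n M" and N: "norm_like n N"
  shows "continuous_on (Euc n) (radial M N)"
proof (rule continuous_on_coordinatewise_then_product)
  fix i
  obtain C where C: "C > 0" "\<And>y i. y \<in> Euc n \<Longrightarrow> \<bar>y i\<bar> \<le> C * N y" using N unfolding norm_like_def
    by blast
  have cM: "continuous_on (Euc n) M" and cN: "continuous_on (Euc n) N" using M N
    unfolding norm_like_def by blast+
  show "continuous_on (Euc n) (\<lambda>y. radial M N y i)"
    unfolding continuous_on_def
  proof
    fix y assume y: "y \<in> Euc n"
    show "((\<lambda>y. radial M N y i) \<longlongrightarrow> radial M N y i) (at y within Euc n)"
    proof (cases "y = (\<lambda>_. 0)")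
      case False
      then have "N y \<noteq> 0" using norm_like_eq_0[OF N y] by simp
      moreover have "((\<lambda>y. y i) \<longlongrightarrow> y i) (at y within Euc n)"
        using continuous_on_coordinate[of "Euc n" i] y unfolding continuous_on_def by blast
      ultimately show ?thesis
        using cM cN y unfolding continuous_on_def radial_def by (intro tendsto_intros) blast+
    next
      case True
      have "((\<lambda>z. C * M z) \<longlongrightarrow> C * M y) (at y within Euc n)"
        using cM y unfolding continuous_on_def by (intro tendsto_intros) blast
      then have lim: "((\<lambda>z. C * M z) \<longlongrightarrow> 0) (at y within Euc n)" using True norm_like_zero[OF M]
        by simp
      have bd: "\<bar>radial M N z i\<bar> \<le> C * M z" if z: "z \<in> Euc n" for z
      proof -
        have "\<bar>radial M N z i\<bar> = M z / N z * \<bar>z i\<bar>"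
          unfolding radial_def using norm_like_nonneg[OF M z] norm_like_nonneg[OF N z]
            by (simp add: abs_mult)
        also have "\<dots> \<le> M z / N z * (C * N z)"
          using C(2)[OF z] norm_like_nonneg[OF M z] norm_like_nonneg[OF N z]
            by (intro mult_left_mono) auto
        also have "\<dots> \<le> C * M z"
          using C(1) norm_like_nonneg[OF M z] by (cases "N z = 0") auto
        finally show ?thesis .
      qed
      have "((\<lambda>z. radial M N z i) \<longlongrightarrow> 0) (at y within Euc n)"
        by (rule Lim_null_comparison[OF _ lim]) (simp add: eventually_at_filter bd)
      then show ?thesis using True by (simp add: radial_def)
    qed
  qed
qed

definition eucl_norm :: "nat \<Rightarrow> (nat \<Rightarrow> real) \<Rightarrow> real" where
  "eucl_norm n y = sqrt (\<Sum>i<n. (y i)\<^sup>2)"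

lemma norm_like_eucl_norm: "norm_like n (eucl_norm n)"
  unfolding norm_like_def eucl_norm_def
proof (intro conjI ballI allI impI exI[of _ "1::real"])
  show "continuous_on (Euc n) (\<lambda>y. sqrt (\<Sum>i<n. (y i)\<^sup>2))"
    by (intro continuous_intros continuous_on_coordinate)
  show "sqrt (\<Sum>i<n. (t * y i)\<^sup>2) = t * sqrt (\<Sum>i<n. (y i)\<^sup>2)" if "0 \<le> t" for t and y :: "nat \<Rightarrow> real"
    using that by (simp add: power_mult_distrib real_sqrt_mult flip: sum_distrib_left)
  show "\<bar>y i\<bar> \<le> 1 * sqrt (\<Sum>i<n. (y i)\<^sup>2)" if y: "y \<in> Euc n" for y i
  proof (cases "i < n")
    case True
    then have "(y i)\<^sup>2 \<le> (\<Sum>i<n. (y i)\<^sup>2)" by (intro member_le_sum) auto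
    then show ?thesis using real_le_rsqrt[of "\<bar>y i\<bar>"] by simp
  qed (use y in \<open>simp add: sum_nonneg\<close>)
qed simp

lemma nsphere_eq: "nsphere n = top_of_set {y \<in> Euc (Suc n). eucl_norm (Suc n) y = 1}"
  unfolding nsphere_def Euclidean_space_eq subtopology_subtopology lessThan_Suc_atMost eucl_norm_def
  by (rule arg_cong[where f = top_of_set]) auto

lemma radial_homeomorphic_maps:
  assumes M: "norm_like n M" and N: "norm_like n N"
  shows "homeomorphic_maps (top_of_set {y \<in> Euc n. M y \<in> S}) (top_of_set {y \<in> Euc n. N y \<in> S})
    (radial M N) (radial N M)"
proof -
  have half: "continuous_map (top_of_set {y \<in> Euc n. M y \<in> S}) (top_of_set {y \<in> Euc n. N y \<in> S}) (radial M N)"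
    if M: "norm_like n M" and N: "norm_like n N" for M N
  proof -
    have "continuous_on {y \<in> Euc n. M y \<in> S} (radial M N)"
      by (rule continuous_on_subset[OF continuous_on_radial[OF M N]]) blast
    moreover have "radial M N y \<in> {y \<in> Euc n. N y \<in> S}" if "y \<in> {y \<in> Euc n. M y \<in> S}" for y
      using that norm_like_radial[OF M N, of y] radial_in_Euc[of y n M N] by simp
    ultimately show ?thesis by (simp add: continuous_map_in_subtopology image_subset_iff)
  qed
  show ?thesis
    unfolding homeomorphic_maps_def
    using half[OF M N] half[OF N M] radial_radial[OF M N] radial_radial[OF N M] by simp
qed

lemma norm_like_sphere_homeomorphic_nsphere:
  assumes "norm_like (Suc n) N"
  shows "top_of_set {y \<in> Euc (Suc n). N y = 1} homeomorphic_space nsphere n"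
  using radial_homeomorphic_maps[OF assms norm_like_eucl_norm, of "{1}"]
  unfolding homeomorphic_space_def nsphere_eq by auto

section \<open>Criteria for complexes and actions\<close>

text \<open>Actions are formalised by extensional bijections, so a family of maps that satisfies the action
  laws has to be restricted to the space.\<close>
lemma cellular_actionI:
  fixes G (structure)
  assumes "group G"
    and one: "\<And>x. x \<in> topspace X \<Longrightarrow> \<phi> \<one> x = x"
    and mult: "\<And>g h x. g \<in> carrier G \<Longrightarrow> h \<in> carrier G \<Longrightarrow> x \<in> topspace X \<Longrightarrow> \<phi> (g \<otimes> h) x = \<phi> g (\<phi> h x)"
    and cont: "\<And>g. g \<in> carrier G \<Longrightarrow> continuous_map X X (\<phi> g)"
    and cells: "\<And>e. e \<in> (\<Union>n. E n) \<Longrightarrow> e \<subseteq> topspace X"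
    and perm: "\<And>g e. g \<in> carrier G \<Longrightarrow> e \<in> (\<Union>n. E n) \<Longrightarrow> \<phi> g ` e \<in> (\<Union>n. E n)"
    and fixed: "\<And>g e x. g \<in> carrier G \<Longrightarrow> e \<in> (\<Union>n. E n) \<Longrightarrow> \<phi> g ` e = e \<Longrightarrow> x \<in> e \<Longrightarrow> \<phi> g x = x"
  shows "cellular_action G (X, E) (\<lambda>g. restrict (\<phi> g) (topspace X))"
proof -
  interpret group G by fact
  let ?r = "\<lambda>g. restrict (\<phi> g) (topspace X)"
  have into: "\<phi> g x \<in> topspace X" if "g \<in> carrier G" "x \<in> topspace X" for g x
    using continuous_map_image_subset_topspace[OF cont[OF that(1)]] that(2) by blast
  have inv1: "\<phi> (inv g) (\<phi> g x) = x" "\<phi> g (\<phi> (inv g) x) = x" if "g \<in> carrier G" "x \<in> topspace X"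
    for g x
    using mult[of "inv g" g x] mult[of g "inv g" x] one that by simp_all
  have bij: "?r g \<in> Bij (topspace X)" if g: "g \<in> carrier G" for g
  proof -
    have "bij_betw (\<phi> g) (topspace X) (topspace X)"
      by (rule bij_betw_byWitness[where f' = "\<phi> (inv g)"]) (use into inv1 g in auto)
    then have "bij_betw (?r g) (topspace X) (topspace X)"
      by (subst bij_betw_cong[of _ _ "\<phi> g"]) simp_all
    then show ?thesis by (simp add: Bij_def)
  qed
  have "?r \<in> hom G (BijGroup (topspace X))"
  proof (rule homI)
    fix g assume "g \<in> carrier G"
    then show "?r g \<in> carrier (BijGroup (topspace X))" using bij by (simp add: BijGroup_def)
  next
    fix g h assume gh: "g \<in> carrier G" "h \<in> carrier G"
    have "?r (g \<otimes> h) = compose (topspace X) (?r g) (?r h)"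
      using mult[OF gh] into[OF gh(2)] by (auto simp: compose_def fun_eq_iff restrict_def)
    then show "?r (g \<otimes> h) = ?r g \<otimes>\<^bsub>BijGroup (topspace X)\<^esub> ?r h"
      using bij gh by (simp add: BijGroup_def)
  qed
  then have "group_action G (topspace X) ?r"
    unfolding group_action_def group_hom_def group_hom_axioms_def
    using is_group group_BijGroup by blast
  moreover have "homeomorphic_map X X (?r g)" if g: "g \<in> carrier G" for g
  proof -
    have "homeomorphic_maps X X (\<phi> g) (\<phi> (inv g))"
      unfolding homeomorphic_maps_def using cont g inv1 by simp
    then have "homeomorphic_map X X (\<phi> g)" using homeomorphic_maps_map by blast
    then show ?thesis by (rule homeomorphic_map_eq) simp
  qed
  moreover have im: "?r g ` e = \<phi> g ` e" if "e \<in> (\<Union>n. E n)" for g e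
    using cells[OF that] by (intro image_cong) auto
  moreover have "?r g x = \<phi> g x" if "e \<in> (\<Union>n. E n)" "x \<in> e" for g e x
    using cells[OF that(1)] that(2) by auto
  ultimately show ?thesis
    unfolding cellular_action_def prod.case
    by (intro conjI ballI impI) (simp_all only: perm fixed)
qed

lemma stabilizer_restrict:
  "x \<in> S \<Longrightarrow> stabilizer G (\<lambda>g. restrict (\<phi> g) S) x = {g \<in> carrier G. \<phi> g x = x}"
  by (simp add: stabilizer_def)

lemma finite_CW_weak_topology:
  assumes "finite (\<Union>n. E n)" "(\<Union>n. \<Union>(E n)) = topspace X" "A \<subseteq> topspace X"
    and closed: "\<And>n e. e \<in> E n \<Longrightarrow> closedin X (A \<inter> X closure_of e)"
  shows "closedin X A"
proof -
  have sub: "e \<subseteq> X closure_of e" if "e \<in> E n" for n e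
    using assms(2) that by (intro closure_of_subset) blast
  have "A = \<Union>((\<lambda>e. A \<inter> X closure_of e) ` (\<Union>n. E n))"
  proof (intro equalityI subsetI)
    fix x assume x: "x \<in> A"
    then obtain n e where e: "e \<in> E n" "x \<in> e" using assms(2,3) by blast
    then have "x \<in> A \<inter> X closure_of e" using x sub by blast
    then show "x \<in> \<Union>((\<lambda>e. A \<inter> X closure_of e) ` (\<Union>n. E n))" using e(1) by blast
  qed auto
  moreover have "closedin X (\<Union>((\<lambda>e. A \<inter> X closure_of e) ` (\<Union>n. E n)))"
    by (rule closedin_Union) (use assms(1) closed in auto)
  ultimately show ?thesis by simp
qed

lemma closed_disc_eq_norm: "closed_disc n = top_of_set {y \<in> Euc n. eucl_norm n y \<in> {..1}}"
  unfolding closed_disc_eq unit_disc_def eucl_norm_def by simp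

lemma open_disc_eq_norm: "open_disc n = top_of_set {y \<in> Euc n. eucl_norm n y \<in> {..<1}}"
  unfolding open_disc_eq eucl_norm_def by simp

lemma disc_boundary_eq_norm: "disc_boundary n = {y \<in> Euc n. eucl_norm n y \<in> {1}}"
  unfolding disc_boundary_def topspace_closed_disc unit_disc_def eucl_norm_def by auto

text \<open>A cell may be parametrised by the unit ball of any gauge in place of the round disc.\<close>
lemma characteristic_mapI:
  assumes N: "norm_like n N"
    and cont: "continuous_map (top_of_set {y \<in> Euc n. N y \<in> {..1}}) X \<Psi>"
    and homeo: "homeomorphic_map (top_of_set {y \<in> Euc n. N y \<in> {..<1}}) (subtopology X e) \<Psi>"
    and bd: "finite F" "F \<subseteq> (\<Union>k<n. E k)" "\<Psi> ` {y \<in> Euc n. N y \<in> {1}} \<subseteq> \<Union>F"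
  shows "characteristic_map X E n e (\<Psi> \<circ> radial (eucl_norm n) N)"
proof -
  note R = radial_homeomorphic_maps[OF norm_like_eucl_norm N]
  have "continuous_map (closed_disc n) X (\<Psi> \<circ> radial (eucl_norm n) N)"
    using R[of "{..1}"] cont unfolding closed_disc_eq_norm homeomorphic_maps_def
    by (blast intro: continuous_map_compose)
  moreover have "homeomorphic_map (open_disc n) (subtopology X e) (\<Psi> \<circ> radial (eucl_norm n) N)"
    unfolding open_disc_eq_norm
    by (rule homeomorphic_map_compose[OF _ homeo]) (use R homeomorphic_maps_map in blast)
  moreover have "radial (eucl_norm n) N ` disc_boundary n \<subseteq> {y \<in> Euc n. N y \<in> {1}}"
    unfolding disc_boundary_eq_norm
    using norm_like_radial[OF norm_like_eucl_norm N] radial_in_Euc[of _ n "eucl_norm n" N] by auto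
  then have "(\<Psi> \<circ> radial (eucl_norm n) N) ` disc_boundary n \<subseteq> \<Union>F" using bd(3)
    by (auto simp: image_subset_iff)
  ultimately show ?thesis unfolding characteristic_map_def using bd(1,2) by blast
qed

lemma continuous_on_Min:
  fixes f :: "'i \<Rightarrow> 'b::topological_space \<Rightarrow> real"
  assumes "finite A" "A \<noteq> {}" "\<And>j. j \<in> A \<Longrightarrow> continuous_on S (f j)"
  shows "continuous_on S (\<lambda>y. Min ((\<lambda>j. f j y) ` A))"
  using assms
proof (induction rule: finite_ne_induct)
  case (insert a A)
  then have "continuous_on S (\<lambda>y. min (f a y) (Min ((\<lambda>j. f j y) ` A)))"
    by (intro continuous_on_min) simp_all
  then show ?case using insert.hyps by simp
qed simp

lemma continuous_on_Max:
  fixes f :: "'i \<Rightarrow> 'b::topological_space \<Rightarrow> real"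
  assumes "finite A" "A \<noteq> {}" "\<And>j. j \<in> A \<Longrightarrow> continuous_on S (f j)"
  shows "continuous_on S (\<lambda>y. Max ((\<lambda>j. f j y) ` A))"
  using assms
proof (induction rule: finite_ne_induct)
  case (insert a A)
  then have "continuous_on S (\<lambda>y. max (f a y) (Max ((\<lambda>j. f j y) ` A)))"
    by (intro continuous_on_max) simp_all
  then show ?case using insert.hyps by simp
qed simp

lemma Min_scale: "finite A \<Longrightarrow> A \<noteq> {} \<Longrightarrow> 0 \<le> t \<Longrightarrow> Min ((\<lambda>j. t * f j) ` A) = t * Min (f ` A)"
  for t :: real
  using mono_Min_commute[of "\<lambda>x. t * x" "f ` A"] by (simp add: mono_def mult_left_mono image_image)

lemma Max_scale: "finite A \<Longrightarrow> A \<noteq> {} \<Longrightarrow> 0 \<le> t \<Longrightarrow> Max ((\<lambda>j. t * f j) ` A) = t * Max (f ` A)"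
  for t :: real
  using mono_Max_commute[of "\<lambda>x. t * x" "f ` A"] by (simp add: mono_def mult_left_mono image_image)

section \<open>The simplex as a unit ball\<close>

text \<open>The simplex of all \<open>0 \<le> c\<^sub>1 \<le> \<dots> \<le> c\<^sub>m \<le> 1\<close> is moved so that its barycentre, given by
  \<open>c\<^sub>k = k / (m + 1)\<close>, becomes the origin. Then \<open>level m y k\<close> is the coordinate \<open>c\<^sub>k\<close> of the point \<open>y\<close>,
  completed by \<open>c\<^sub>0 = 0\<close> and \<open>c\<^sub>m\<^sub>+\<^sub>1 = 1\<close>, and \<open>simplex_norm m\<close> is the gauge whose unit ball is the
  simplex.\<close>
definition hat :: "(nat \<Rightarrow> real) \<Rightarrow> nat \<Rightarrow> real" where
  "hat y k = (case k of 0 \<Rightarrow> 0 | Suc j \<Rightarrow> y j)"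

definition level :: "nat \<Rightarrow> (nat \<Rightarrow> real) \<Rightarrow> nat \<Rightarrow> real" where
  "level m y k = hat y k + real k / real (Suc m)"

definition simplex_norm :: "nat \<Rightarrow> (nat \<Rightarrow> real) \<Rightarrow> real" where
  "simplex_norm m y = Max ((\<lambda>k. real (Suc m) * (hat y k - hat y (Suc k))) ` {..m})"

lemma continuous_on_hat: "continuous_on S (\<lambda>y. hat y k)"
  unfolding hat_def by (cases k) (auto intro: continuous_on_coordinate)

text \<open>The bound holds since each coordinate is reached from both ends, where the value is \<open>0\<close>, in at most
  \<open>m + 1\<close> steps, and a step can descend by no more than \<open>simplex_norm m y / (m + 1)\<close>.\<close>
lemma norm_like_simplex_norm: "norm_like m (simplex_norm m)"
  unfolding norm_like_def
proof (intro conjI ballI allI impI exI[of _ "1::real"])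
  show "continuous_on (Euc m) (simplex_norm m)"
    unfolding simplex_norm_def
    by (rule continuous_on_Max) (auto intro!: continuous_intros continuous_on_hat)
  show "simplex_norm m (\<lambda>i. t * y i) = t * simplex_norm m y" if "0 \<le> t" for t y
  proof -
    have "hat (\<lambda>i. t * y i) k = t * hat y k" for k by (cases k) (simp_all add: hat_def)
    then have "simplex_norm m (\<lambda>i. t * y i)
      = Max ((\<lambda>k. t * (real (Suc m) * (hat y k - hat y (Suc k)))) ` {..m})"
      unfolding simplex_norm_def by (simp add: algebra_simps)
    also have "\<dots> = t * simplex_norm m y" unfolding simplex_norm_def
      by (rule Max_scale) (use that in auto)
    finally show ?thesis .
  qed
  fix y i assume y: "y \<in> Euc m"
  define \<epsilon> where "\<epsilon> = simplex_norm m y / real (Suc m)"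
  have step: "hat y k - hat y (Suc k) \<le> \<epsilon>" if "k \<le> m" for k
  proof -
    have "real (Suc m) * (hat y k - hat y (Suc k)) \<le> simplex_norm m y"
      unfolding simplex_norm_def by (rule Max_ge) (use that in auto)
    then show ?thesis unfolding \<epsilon>_def by (simp add: pos_le_divide_eq mult.commute)
  qed
  have lower: "k \<le> Suc m \<Longrightarrow> - (real k * \<epsilon>) \<le> hat y k" for k
  proof (induction k)
    case (Suc k)
    then show ?case using step[of k] by (simp add: algebra_simps)
  qed (simp add: hat_def)
  have top: "hat y (Suc m) = 0" using y by (simp add: hat_def)
  have upper: "j \<le> Suc m \<Longrightarrow> hat y (Suc m - j) \<le> real j * \<epsilon>" for j
  proof (induction j)
    case (Suc j)
    then have "Suc (Suc m - Suc j) = Suc m - j" by simp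
    then show ?case using step[of "Suc m - Suc j"] Suc by (simp add: algebra_simps)
  qed (simp add: top)
  have "- (real (Suc m) * \<epsilon>) \<le> 0" using lower[of "Suc m"] top by simp
  then have pos: "0 \<le> \<epsilon>" by (simp add: zero_le_mult_iff)
  have eps: "simplex_norm m y = real (Suc m) * \<epsilon>" unfolding \<epsilon>_def by simp
  have bound: "\<bar>hat y k\<bar> \<le> real (Suc m) * \<epsilon>" if "k \<le> Suc m" for k
  proof -
    have "real k * \<epsilon> \<le> real (Suc m) * \<epsilon>" "real (Suc m - k) * \<epsilon> \<le> real (Suc m) * \<epsilon>"
      using that pos by (auto intro!: mult_right_mono)
    then show ?thesis using lower[OF that] upper[of "Suc m - k"] that by (simp add: abs_le_iff)
  qed
  show "\<bar>y i\<bar> \<le> 1 * simplex_norm m y"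
  proof (cases "i < m")
    case True
    then show ?thesis using bound[of "Suc i"] eps by (simp add: hat_def)
  next
    case False
    then show ?thesis using y bound[of 0] eps by (simp add: hat_def)
  qed
qed simp

lemma level_diff: "real (Suc m) * (hat y k - hat y (Suc k))
  = 1 - real (Suc m) * (level m y (Suc k) - level m y k)"
proof -
  have "level m y (Suc k) - level m y k = hat y (Suc k) - hat y k + 1 / real (Suc m)"
    unfolding level_def by (simp add: add_divide_distrib)
  then show ?thesis by (simp add: right_diff_distrib distrib_left del: of_nat_Suc)
qed

lemma simplex_norm_le_iff: "simplex_norm m y \<le> 1 \<longleftrightarrow> (\<forall>k\<le>m. level m y k \<le> level m y (Suc k))"
  unfolding simplex_norm_def level_diff by (subst Max_le_iff) (auto simp: zero_le_mult_iff)

lemma simplex_norm_less_iff: "simplex_norm m y < 1 \<longleftrightarrow> (\<forall>k\<le>m. level m y k < level m y (Suc k))"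
  unfolding simplex_norm_def level_diff by (subst Max_less_iff) (auto simp: zero_less_mult_iff)

lemma level_0: "level m y 0 = 0"
  by (simp add: level_def hat_def)

lemma level_top: "y \<in> Euc m \<Longrightarrow> level m y (Suc m) = 1"
  by (simp add: level_def hat_def)

lemma level_mono:
  assumes "simplex_norm m y \<le> 1" "k \<le> l" "l \<le> Suc m"
  shows "level m y k \<le> level m y l"
  using assms(2,3)
proof (induction rule: dec_induct)
  case (step j)
  then show ?case using assms(1) unfolding simplex_norm_le_iff
    by (meson Suc_leD Suc_le_mono order_trans)
qed simp

lemma level_less_iff:
  assumes "simplex_norm m y < 1" "k \<le> Suc m" "l \<le> Suc m"
  shows "level m y k \<le> level m y l \<longleftrightarrow> k \<le> l"
proof -
  have le: "simplex_norm m y \<le> 1" using assms(1) by simp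
  have less: "level m y k < level m y l" if "k < l" "l \<le> Suc m" for k l
  proof -
    have "level m y k < level m y (Suc k)" using assms(1) that unfolding simplex_norm_less_iff
      by simp
    also have "\<dots> \<le> level m y l" by (rule level_mono[OF le]) (use that in auto)
    finally show ?thesis .
  qed
  show ?thesis using less[of l k] level_mono[OF le, of k l] assms(2,3) by (meson linorder_not_le)
qed

section \<open>A sphere on which permutations act\<close>

text \<open>The even and the odd indices below \<open>2 * n\<close> carry one real function on \<open>n\<close> points each, modulo
  constants. Each function is represented by its translate with minimum \<open>0\<close>, and each ray of pairs
  of functions by the pair with maximum \<open>1\<close>. This makes the sphere invariant under permutations of
  the \<open>n\<close> points without any choice of coordinates.\<close>
definition order_sphere :: "nat \<Rightarrow> (nat \<Rightarrow> real) set" where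
  "order_sphere n = {F. (\<forall>i\<ge>2*n. F i = 0) \<and> (\<forall>i. 0 \<le> F i \<and> F i \<le> 1) \<and>
     (\<exists>i<n. F (2*i) = 0) \<and> (\<exists>i<n. F (2*i+1) = 0) \<and> (\<exists>i<2*n. F i = 1)}"

text \<open>For \<open>n = p + 1\<close> points, the indices \<open>2 * p\<close> and \<open>2 * p + 1\<close> serve as base points of the two
  parity classes: a pair of functions modulo constants is determined by the \<open>2 * p\<close> differences from
  the values at the base points (\<open>unshift\<close>). In these coordinates, \<open>shift\<close> is the translate with
  minimum \<open>0\<close> in each class, and \<open>spread\<close> is the gauge whose unit sphere it maps to
  \<open>order_sphere n\<close>.\<close>
definition class_min :: "nat \<Rightarrow> nat \<Rightarrow> (nat \<Rightarrow> real) \<Rightarrow> real" where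
  "class_min p c y = Min ((\<lambda>j. y (2*j+c)) ` {..p})"

definition shift :: "nat \<Rightarrow> (nat \<Rightarrow> real) \<Rightarrow> nat \<Rightarrow> real" where
  "shift p y i = (if i < 2*p+2 then y i - class_min p (i mod 2) y else 0)"

definition unshift :: "nat \<Rightarrow> (nat \<Rightarrow> real) \<Rightarrow> nat \<Rightarrow> real" where
  "unshift p F i = (if i < 2*p then F i - F (2*p + i mod 2) else 0)"

definition spread :: "nat \<Rightarrow> (nat \<Rightarrow> real) \<Rightarrow> real" where
  "spread p y = Max ((\<lambda>i. shift p y i) ` {..<2*p+2})"

lemma class_min_le:
  assumes "i < 2*p+2"
  shows "class_min p (i mod 2) y \<le> y i"
proof -
  have "i = 2*(i div 2) + i mod 2" "i div 2 \<le> p" using assms by auto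
  then show ?thesis unfolding class_min_def by (intro Min_le) (auto intro!: image_eqI[of _ _
    "i div 2"])
qed

lemma class_min_attained:
  assumes "c < 2"
  obtains j where "j \<le> p" "class_min p c y = y (2*j+c)"
proof -
  have "class_min p c y \<in> (\<lambda>j. y (2*j+c)) ` {..p}" unfolding class_min_def by (rule Min_in) auto
  then show ?thesis using that by auto
qed

lemma shift_nonneg: "0 \<le> shift p y i"
  using class_min_le[of i p y] by (simp add: shift_def)

lemma shift_le_spread: "i < 2*p+2 \<Longrightarrow> shift p y i \<le> spread p y"
  unfolding spread_def by (rule Max_ge) auto

lemma spread_attained: obtains i where "i < 2*p+2" "spread p y = shift p y i"
proof -
  have "spread p y \<in> (\<lambda>i. shift p y i) ` {..<2*p+2}" unfolding spread_def by (rule Max_in) auto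
  then show ?thesis using that by auto
qed

lemma continuous_on_class_min: "continuous_on S (class_min p c)"
  unfolding class_min_def by (rule continuous_on_Min) (auto intro: continuous_on_coordinate)

lemma continuous_on_shift: "continuous_on S (\<lambda>y. shift p y i)"
  unfolding shift_def by (cases
    "i < 2*p+2") (auto intro!: continuous_intros continuous_on_class_min continuous_on_coordinate)

lemma norm_like_spread: "norm_like (2*p) (spread p)"
  unfolding norm_like_def
proof (intro conjI ballI allI impI exI[of _ "1::real"])
  show "continuous_on (Euc (2*p)) (spread p)"
    unfolding spread_def
      by (rule continuous_on_Max) (auto intro: continuous_on_shift simp: lessThan_empty_iff)
  show "spread p (\<lambda>i. t * y i) = t * spread p y" if "0 \<le> t" for t y
  proof -
    have "class_min p c (\<lambda>i. t * y i) = t * class_min p c y" for c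
      unfolding class_min_def by (rule Min_scale) (use that in auto)
    then have "shift p (\<lambda>i. t * y i) i = t * shift p y i" for i
      by (simp add: shift_def right_diff_distrib)
    then show ?thesis unfolding spread_def using that by (simp add: Max_scale lessThan_empty_iff)
  qed
  fix y i assume y: "y \<in> Euc (2*p)"
  show "\<bar>y i\<bar> \<le> 1 * spread p y"
  proof (cases "i < 2*p")
    case True
    have b: "y (2*p + i mod 2) = 0" using y by simp
    have "class_min p (i mod 2) y \<le> 0"
      using class_min_le[of "2*p + i mod 2" p y] b by (simp add: mod_add_left_eq[symmetric])
    moreover have "class_min p (i mod 2) y \<le> y i" using class_min_le[of i p y] True by simp
    moreover have "y i - class_min p (i mod 2) y \<le> spread p y"
      using shift_le_spread[of i p y] True by (simp add: shift_def)
    moreover have "- class_min p (i mod 2) y \<le> spread p y"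
      using shift_le_spread[of "2*p + i mod 2" p y] b by (simp add: shift_def)
    ultimately show ?thesis by (simp add: abs_le_iff)
  next
    case False
    then show ?thesis using y shift_nonneg[of p y 0] shift_le_spread[of 0 p y] by simp
  qed
qed simp

lemma order_sphere_homeomorphic_nsphere:
  assumes n: "n = Suc (Suc q)"
  shows "top_of_set (order_sphere n) homeomorphic_space nsphere (2*q+1)"
proof -
  define p where "p = Suc q"
  have np: "n = p + 1" and d: "2*p = Suc (2*q+1)" by (simp_all add: n p_def)
  let ?S = "{y \<in> Euc (2*p). spread p y = 1}"
  have 1: "shift p y \<in> order_sphere n" if y: "y \<in> ?S" for y
  proof -
    have "\<exists>i<n. shift p y (2*i) = 0"
    proof -
      obtain j where "j \<le> p" "class_min p 0 y = y (2*j+0)" by (rule class_min_attained[OF pos2])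
      then show ?thesis by (intro exI[of _ j]) (simp add: shift_def np)
    qed
    moreover have "\<exists>i<n. shift p y (2*i+1) = 0"
    proof -
      have "(1::nat) < 2" by simp
      then obtain j where "j \<le> p" "class_min p 1 y = y (2*j+1)" by (rule class_min_attained)
      then show ?thesis by (intro exI[of _ j]) (simp add: shift_def np mod_Suc)
    qed
    moreover have "\<exists>i<2*n. shift p y i = 1"
    proof -
      obtain i where "i < 2*p+2" "spread p y = shift p y i" by (rule spread_attained)
      then show ?thesis using y np by auto
    qed
    moreover have "shift p y i \<le> 1" for i
      using shift_le_spread[of i p y] y by (cases "i < 2*p+2") (auto simp: shift_def)
    ultimately show ?thesis unfolding order_sphere_def using shift_nonneg[of p y] np
      by (auto simp: shift_def)
  qed
  have diff: "unshift p F i = F i - F (2*p + i mod 2)" if "i < 2*p+2" for F i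
  proof (cases "i < 2*p")
    case False
    then have "i = 2*p \<or> i = 2*p+1" using that by auto
    then show ?thesis by (auto simp: unshift_def)
  qed (simp add: unshift_def)
  have cm: "class_min p c (unshift p F) = - F (2*p+c)" if F: "F \<in> order_sphere n" and c: "c < 2"
    for F c
  proof -
    have im: "unshift p F (2*j+c) = F (2*j+c) - F (2*p+c)" if "j \<le> p" for j
    proof -
      have "2*j+c < 2*p+2" "(2*j+c) mod 2 = c" using that c by auto
      then show ?thesis using diff[of "2*j+c" F] by simp
    qed
    obtain j where j: "j \<le> p" "F (2*j+c) = 0"
    proof -
      have "c = 0 \<or> c = 1" using c by auto
      then have "\<exists>j<n. F (2*j+c) = 0" using F unfolding order_sphere_def by auto
      then obtain j where "j < n" "F (2*j+c) = 0" by blast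
      then show ?thesis using that[of j] np by simp
    qed
    show ?thesis unfolding class_min_def
    proof (rule Min_eqI)
      show "- F (2*p+c) \<in> (\<lambda>j. unshift p F (2*j+c)) ` {..p}"
        using im[OF j(1)] j by (intro image_eqI[of _ _ j]) auto
      fix x assume "x \<in> (\<lambda>j. unshift p F (2*j+c)) ` {..p}"
      then show "- F (2*p+c) \<le> x" using im F unfolding order_sphere_def by auto
    qed simp
  qed
  have su: "shift p (unshift p F) = F" if F: "F \<in> order_sphere n" for F
  proof
    fix i
    show "shift p (unshift p F) i = F i"
    proof (cases "i < 2*p+2")
      case True
      then show ?thesis using cm[OF F, of "i mod 2"] diff[of i F] by (simp add: shift_def)
    next
      case False
      then show ?thesis using F np unfolding order_sphere_def by (simp add: shift_def)
    qed
  qed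
  have 2: "unshift p F \<in> ?S" if F: "F \<in> order_sphere n" for F
  proof -
    have "spread p (unshift p F) = Max (F ` {..<2*p+2})" unfolding spread_def su[OF F] ..
    also have "\<dots> = 1"
    proof (rule Max_eqI)
      show "1 \<in> F ` {..<2*p+2}" using F np unfolding order_sphere_def by force
    qed (use F in \<open>auto simp: order_sphere_def\<close>)
    finally show ?thesis by (simp add: unshift_def)
  qed
  have us: "unshift p (shift p y) = y" if y: "y \<in> ?S" for y
  proof
    fix i
    show "unshift p (shift p y) i = y i" using y by (simp add: unshift_def shift_def)
  qed
  have "continuous_on ?S (shift p)"
    by (intro continuous_on_coordinatewise_then_product continuous_on_shift)
  moreover have "continuous_on (order_sphere n) (\<lambda>F. unshift p F i)" for i
    unfolding unshift_def by (cases
      "i < 2*p") (auto intro!: continuous_intros continuous_on_coordinate)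
  then have "continuous_on (order_sphere n) (unshift p)"
    by (rule continuous_on_coordinatewise_then_product)
  ultimately have
    "homeomorphic_maps (top_of_set (order_sphere n)) (top_of_set ?S) (unshift p) (shift p)"
    unfolding homeomorphic_maps_def using 1 2 su us
      by (simp add: continuous_map_in_subtopology image_subset_iff)
  then have "top_of_set (order_sphere n) homeomorphic_space top_of_set ?S"
    unfolding homeomorphic_space_def by blast
  moreover have "top_of_set ?S homeomorphic_space nsphere (2*q+1)"
    using norm_like_sphere_homeomorphic_nsphere[of "2*q+1" "spread p"] norm_like_spread[of p]
      unfolding d .
  ultimately show ?thesis by (rule homeomorphic_space_trans)
qed

section \<open>Cells given by the order of the coordinates\<close>

text \<open>Points of the sphere have minimum \<open>0\<close> and maximum \<open>1\<close>, so the order also determines at which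
  indices these two values are taken.\<close>
definition same_order :: "nat \<Rightarrow> (nat \<Rightarrow> real) \<Rightarrow> (nat \<Rightarrow> real) \<Rightarrow> bool" where
  "same_order n F F' \<longleftrightarrow> (\<forall>i<2*n. \<forall>j<2*n. F i \<le> F j \<longleftrightarrow> F' i \<le> F' j)"

definition cell_of :: "nat \<Rightarrow> (nat \<Rightarrow> real) \<Rightarrow> (nat \<Rightarrow> real) set" where
  "cell_of n F = {F' \<in> order_sphere n. same_order n F F'}"

text \<open>Besides \<open>0\<close> and \<open>1\<close>, a function in a \<open>k\<close>-cell takes \<open>k\<close> further values, and these are the
  coordinates of the cell.\<close>
definition order_cells :: "nat \<Rightarrow> nat \<Rightarrow> (nat \<Rightarrow> real) set set" where
  "order_cells n k = cell_of n ` {F \<in> order_sphere n. card (F ` {..<2*n}) = k + 2}"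

lemma same_order_eq:
  assumes "same_order n F F'" "i < 2*n" "j < 2*n"
  shows "F i = F j \<longleftrightarrow> F' i = F' j"
  using assms unfolding same_order_def by (metis order_antisym order_refl)

lemma same_order_card:
  assumes "same_order n F F'"
  shows "card (F ` {..<2*n}) = card (F' ` {..<2*n})"
proof -
  let ?g = "\<lambda>v. F' (SOME i. i < 2*n \<and> F i = v)"
  have g: "?g (F i) = F' i" if "i < 2*n" for i
  proof -
    have "(SOME j. j < 2*n \<and> F j = F i) < 2*n \<and> F (SOME j. j < 2*n \<and> F j = F i) = F i"
      by (rule someI[of "\<lambda>j. j < 2*n \<and> F j = F i" i]) (simp add: that)
    then show ?thesis using same_order_eq[OF assms _ that] by blast
  qed
  have "?g ` F ` {..<2*n} = F' ` {..<2*n}" unfolding image_image using g by (intro image_cong) auto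
  moreover have "inj_on ?g (F ` {..<2*n})"
    using g same_order_eq[OF assms] by (auto intro!: inj_onI)
  ultimately show ?thesis using card_image[of ?g "F ` {..<2*n}"] by simp
qed

lemma same_order_refl: "same_order n F F"
  by (simp add: same_order_def)

lemma cell_of_eq: "F' \<in> cell_of n F \<Longrightarrow> cell_of n F' = cell_of n F"
  unfolding cell_of_def same_order_def by auto

lemma cell_of_self: "F \<in> order_sphere n \<Longrightarrow> F \<in> cell_of n F"
  by (simp add: cell_of_def same_order_refl)

lemma order_sphere_card_ge_2:
  assumes "F \<in> order_sphere n"
  shows "2 \<le> card (F ` {..<2*n})"
proof -
  obtain i j where "i < n" "F (2*i) = 0" "j < 2*n" "F j = 1" using assms
    unfolding order_sphere_def by blast
  then have "0 \<in> F ` {..<2*n}" "1 \<in> F ` {..<2*n}"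
    using image_eqI[of 0 F "2*i" "{..<2*n}"] image_eqI[of 1 F j "{..<2*n}"] by simp_all
  then have "{0, 1} \<subseteq> F ` {..<2*n}" by simp
  then have "card {0, 1::real} \<le> card (F ` {..<2*n})" by (intro card_mono) auto
  then show ?thesis by simp
qed

lemma order_cells_Union: "(\<Union>k. order_cells n k) = cell_of n ` order_sphere n"
proof -
  have "cell_of n F \<in> order_cells n (card (F ` {..<2*n}) - 2)" if "F \<in> order_sphere n" for F
    unfolding order_cells_def using that order_sphere_card_ge_2[OF that] by (intro imageI) simp
  then have "cell_of n ` order_sphere n \<subseteq> (\<Union>k. order_cells n k)" by (intro image_subsetI) blast
  moreover have "order_cells n k \<subseteq> cell_of n ` order_sphere n" for k unfolding order_cells_def
    by (rule image_mono) simp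
  ultimately show ?thesis by (intro equalityI UN_least)
qed

lemma finite_order_cells: "finite (\<Union>k. order_cells n k)"
proof -
  let ?L = "{..<2*n}"
  let ?c = "\<lambda>R. {F' \<in> order_sphere n. \<forall>i<2*n. \<forall>j<2*n. (i,j) \<in> R \<longleftrightarrow> F' i \<le> F' j}"
  have "cell_of n F = ?c {(i,j) \<in> ?L \<times> ?L. F i \<le> F j}" for F
    unfolding cell_of_def same_order_def by auto
  then have "cell_of n ` order_sphere n \<subseteq> ?c ` Pow (?L \<times> ?L)" by (intro image_subsetI) blast
  then show ?thesis unfolding order_cells_Union by (rule finite_subset) simp
qed

lemma card_below_less_iff:
  fixes A :: "real set"
  assumes "finite A" "v \<in> A" "w \<in> A"
  shows "card {x \<in> A. x < v} \<le> card {x \<in> A. x < w} \<longleftrightarrow> v \<le> w"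
proof -
  have less: "card {x \<in> A. x < v} < card {x \<in> A. x < w}" if "v < w" "v \<in> A" for v w
    by (rule psubset_card_mono) (use assms(1) that in auto)
  show ?thesis
    using less[of v w] less[of w v] assms(2,3) by (cases v w rule: linorder_cases) auto
qed

text \<open>A function with the order type of \<open>F\<close> is a strictly increasing sequence \<open>0 = c\<^sub>0 < \<dots> < c\<^sub>m\<^sub>+\<^sub>1 = 1\<close>
  precomposed with the rank of the values of \<open>F\<close>, so the cell is an open simplex. On the boundary of
  the simplex two neighbouring values coincide, which leads to a cell of lower dimension.\<close>
lemma order_cell_characteristic_map:
  assumes F: "F \<in> order_sphere n" and m: "card (F ` {..<2*n}) = m + 2"
  shows "\<exists>\<Phi>. characteristic_map (top_of_set (order_sphere n)) (order_cells n) m (cell_of n F) \<Phi>"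
proof -
  let ?L = "{..<2*n}"
  define A where "A = F ` ?L"
  have A: "finite A" "card A = m + 2" by (simp_all add: A_def m)
  have F01: "0 \<le> F i" "F i \<le> 1" for i using F by (simp_all add: order_sphere_def)
  \<comment> \<open>The rank of the value at \<open>i\<close>, and for each rank an index with a value of this rank.\<close>
  define r where "r i = card {x \<in> A. x < F i}" for i
  have r_le: "r i \<le> r j \<longleftrightarrow> F i \<le> F j" if "i < 2*n" "j < 2*n" for i j
    unfolding r_def by (rule card_below_less_iff) (use A that in \<open>auto simp: A_def\<close>)
  have r_eq: "r i = r j \<longleftrightarrow> F i = F j" if "i < 2*n" "j < 2*n" for i j
    using r_le[of i j] r_le[of j i] that by auto
  have r_bound: "r i < m + 2" if "i < 2*n" for i
    unfolding r_def A(2)[symmetric]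
      by (rule psubset_card_mono[OF A(1)]) (use that in \<open>auto simp: A_def\<close>)
  have r_zero: "r i = 0" if "F i = 0" for i
    unfolding r_def using that F01 by (auto simp: A_def card_eq_0_iff not_less)
  have r_one: "r i = Suc m" if "i < 2*n" "F i = 1" for i
  proof -
    have "{x \<in> A. x < F i} = A - {1}" using F01 that(2) by (auto simp: A_def less_le)
    moreover have "1 \<in> A" using that unfolding A_def by force
    ultimately show ?thesis using A by (simp add: r_def)
  qed
  have r_surj: "\<exists>i<2*n. r i = k" if "k \<le> Suc m" for k
  proof -
    have "inj_on (\<lambda>v. card {x \<in> A. x < v}) A"
    proof (rule inj_onI)
      fix v w assume "v \<in> A" "w \<in> A" "card {x \<in> A. x < v} = card {x \<in> A. x < w}"
      then show "v
        = w" using card_below_less_iff[OF A(1), of v w] card_below_less_iff[OF A(1), of w v] by simp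
    qed
    then have "card ((\<lambda>v. card {x \<in> A. x < v}) ` A) = m + 2" using A(2) by (simp add: card_image)
    moreover have "(\<lambda>v. card {x \<in> A. x < v}) ` A = r ` ?L" unfolding A_def r_def image_image ..
    ultimately have "card (r ` ?L) = card {..<m+2}" by simp
    moreover have "r ` ?L \<subseteq> {..<m+2}" using r_bound by auto
    ultimately have "r ` ?L = {..<m+2}" by (intro card_subset_eq) auto
    then have "k \<in> r ` ?L" using that by simp
    then show ?thesis by auto
  qed
  define rep where "rep k = (SOME i. i < 2*n \<and> r i = k)" for k
  have rep: "rep k < 2*n" "r (rep k) = k" if "k \<le> Suc m" for k
    using someI_ex[OF r_surj[OF that, unfolded Bex_def]] unfolding rep_def by auto
  \<comment> \<open>The parametrisation of the closed cell by the simplex, and its inverse on the open cell.\<close>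
  define \<Psi> where "\<Psi> y = (\<lambda>i. if i < 2*n then level m y (r i) else 0)" for y
  define \<Omega> where "\<Omega> F'
    = (\<lambda>k. if k < m then F' (rep (Suc k)) - real (Suc k) / real (Suc m) else 0)" for F'
  obtain a where a: "a < n" "F (2*a) = 0" using F unfolding order_sphere_def by blast
  obtain b where b: "b < n" "F (2*b+1) = 0" using F unfolding order_sphere_def by blast
  obtain t where t: "t < 2*n" "F t = 1" using F unfolding order_sphere_def by blast
  have \<Psi>order_sphere: "\<Psi> y \<in> order_sphere n" if y: "y \<in> Euc m" "simplex_norm m y \<le> 1" for y
  proof -
    have rng: "0 \<le> level m y k" "level m y k \<le> 1" if "k \<le> Suc m" for k
      using level_mono[OF y(2), of 0 k] level_mono[OF y(2), of k
        "Suc m"] level_0[of m y] level_top[OF y(1)] that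
      by simp_all
    have "0 \<le> \<Psi> y i \<and> \<Psi> y i \<le> 1" for i
      unfolding \<Psi>_def using rng[of "r i"] r_bound[of i] by auto
    moreover have "\<exists>i<n. \<Psi> y (2*i) = 0"
      using a r_zero[OF a(2)] by (intro exI[of _ a]) (simp add: \<Psi>_def level_0)
    moreover have "\<exists>i<n. \<Psi> y (2*i+1) = 0"
      using b r_zero[OF b(2)] by (intro exI[of _ b]) (simp add: \<Psi>_def level_0)
    moreover have "\<exists>i<2*n. \<Psi> y i = 1"
      using t r_one[OF t] level_top[OF y(1)] by (intro exI[of _ t]) (simp add: \<Psi>_def)
    ultimately show ?thesis unfolding order_sphere_def by (auto simp: \<Psi>_def)
  qed
  have cont\<Psi>: "continuous_on S \<Psi>" for S
  proof (rule continuous_on_coordinatewise_then_product)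
    fix i
    show "continuous_on S (\<lambda>y. \<Psi> y i)"
      unfolding \<Psi>_def level_def by (cases
        "i < 2*n") (auto intro!: continuous_intros continuous_on_hat)
  qed
  have cont\<Omega>: "continuous_on S \<Omega>" for S
  proof (rule continuous_on_coordinatewise_then_product)
    fix k
    show "continuous_on S (\<lambda>F'. \<Omega> F' k)"
      unfolding \<Omega>_def by (cases "k < m") (auto intro!: continuous_intros continuous_on_coordinate)
  qed
  have \<Psi>cell: "\<Psi> y \<in> cell_of n F" if y: "y \<in> Euc m" "simplex_norm m y < 1" for y
  proof -
    have "F i \<le> F j \<longleftrightarrow> \<Psi> y i \<le> \<Psi> y j" if "i < 2*n" "j < 2*n" for i j
      using level_less_iff[OF y(2), of "r i"
        "r j"] r_bound[OF that(1)] r_bound[OF that(2)] r_le[OF that] that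
      by (simp add: \<Psi>_def)
    then show ?thesis using \<Psi>order_sphere[OF y(1)] y(2) unfolding cell_of_def same_order_def by simp
  qed
  have lev: "level m (\<Omega> F') k = F' (rep k)" if F': "F' \<in> cell_of n F" and k: "k \<le> Suc m" for F' k
  proof -
    have F's: "F' \<in> order_sphere n" and ord: "same_order n F F'" using F'
      by (auto simp: cell_of_def)
    have F'01: "0 \<le> F' i" "F' i \<le> 1" for i using F's by (simp_all add: order_sphere_def)
    consider "k = 0" | j where "k = Suc j" "j < m" | "k = Suc m" using k
      by (cases k) (auto simp: le_less)
    then show ?thesis
    proof cases
      case 1
      obtain i where i: "i < n" "F' (2*i) = 0" using F's unfolding order_sphere_def by blast
      have "r (rep 0) \<le> r (2*i)" using rep[of 0] by simp
      then have "F (rep 0) \<le> F (2*i)" using r_le[of "rep 0" "2*i"] rep(1)[of 0] i(1) by simp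
      then have "F' (rep 0) \<le> F' (2*i)" using ord rep(1)[of 0] i(1) unfolding same_order_def by simp
      then show ?thesis using 1 i(2) F'01(1)[of "rep 0"] by (simp add: level_0)
    next
      case 2
      then show ?thesis by (simp add: level_def hat_def \<Omega>_def)
    next
      case 3
      obtain i where i: "i < 2*n" "F' i = 1" using F's unfolding order_sphere_def by blast
      have "r i \<le> r (rep k)" using rep[OF k] r_bound[OF i(1)] 3 by simp
      then have "F i \<le> F (rep k)" using r_le[OF i(1) rep(1)[OF k]] by simp
      then have "F' i \<le> F' (rep k)" using ord rep(1)[OF k] i(1) unfolding same_order_def by simp
      then have "F' (rep k) = 1" using i(2) F'01(2)[of "rep k"] by simp
      then show ?thesis using level_top[of "\<Omega> F'" m] 3 by (simp add: \<Omega>_def)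
    qed
  qed
  have \<Omega>Euc: "\<Omega> F' \<in> Euc m" for F' by (simp add: \<Omega>_def)
  have \<Omega>int: "simplex_norm m (\<Omega> F') < 1" if F': "F' \<in> cell_of n F" for F'
    unfolding simplex_norm_less_iff
  proof (intro allI impI)
    fix k assume k: "k \<le> m"
    have ord: "same_order n F F'" using F' by (simp add: cell_of_def)
    have "\<not> F (rep (Suc k)) \<le> F (rep k)" using r_le[of "rep (Suc k)" "rep k"] rep[of k] rep[of
      "Suc k"] k by simp
    then have "\<not> F' (rep (Suc k)) \<le> F' (rep k)" using ord rep(1)[of k] rep(1)[of "Suc k"] k
      unfolding same_order_def by simp
    then show "level m (\<Omega> F') k < level m (\<Omega> F') (Suc k)" using lev[OF F'] k by simp
  qed
  have \<Psi>\<Omega>: "\<Psi> (\<Omega> F') = F'" if F': "F' \<in> cell_of n F" for F'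
  proof
    fix i
    show "\<Psi> (\<Omega> F') i = F' i"
    proof (cases "i < 2*n")
      case True
      have ri: "r i \<le> Suc m" using r_bound[OF True] by simp
      have "F (rep (r i)) = F i" using r_eq[OF rep(1)[OF ri] True] rep(2)[OF ri] by simp
      then have "F' (rep (r i)) = F' i" using same_order_eq[of n F F'] F' rep(1)[OF ri] True
        by (simp add: cell_of_def)
      then show ?thesis using lev[OF F' ri] True by (simp add: \<Psi>_def)
    next
      case False
      then show ?thesis using F' by (simp add: \<Psi>_def cell_of_def order_sphere_def)
    qed
  qed
  have \<Omega>\<Psi>: "\<Omega> (\<Psi> y) = y" if y: "y \<in> Euc m" for y
  proof
    fix k
    show "\<Omega> (\<Psi> y) k = y k"
    proof (cases "k < m")
      case True
      then have "\<Psi> y (rep (Suc k)) = level m y (Suc k)" using rep[of "Suc k"] by (simp add: \<Psi>_def)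
      then show ?thesis using True by (simp add: \<Omega>_def level_def hat_def)
    next
      case False
      then show ?thesis using y by (simp add: \<Omega>_def)
    qed
  qed
  have "characteristic_map (top_of_set (order_sphere n)) (order_cells n) m (cell_of n F) (\<Psi> \<circ> radial (eucl_norm m) (simplex_norm m))"
  proof (rule characteristic_mapI[OF norm_like_simplex_norm])
    show "continuous_map (top_of_set {y \<in> Euc m. simplex_norm m y \<in> {..1}}) (top_of_set (order_sphere n)) \<Psi>"
      using cont\<Psi> \<Psi>order_sphere by (simp add: continuous_map_in_subtopology image_subset_iff)
    have sub: "subtopology (top_of_set (order_sphere n)) (cell_of n F) = top_of_set (cell_of n F)"
      unfolding subtopology_subtopology
        by (rule arg_cong[where f = top_of_set]) (auto simp: cell_of_def)
    have "homeomorphic_maps (top_of_set {y \<in> Euc m. simplex_norm m y \<in> {..<1}}) (top_of_set (cell_of n F)) \<Psi> \<Omega>"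
      unfolding homeomorphic_maps_def
      using cont\<Psi> cont\<Omega> \<Psi>cell \<Omega>Euc \<Omega>int \<Psi>\<Omega> \<Omega>\<Psi>
        by (simp add: continuous_map_in_subtopology image_subset_iff)
    then show "homeomorphic_map (top_of_set {y \<in> Euc m. simplex_norm m y \<in> {..<1}})
        (subtopology (top_of_set (order_sphere n)) (cell_of n F)) \<Psi>"
      unfolding sub homeomorphic_maps_map by blast
    show "finite (\<Union>k<m. order_cells n k)" by (rule finite_subset[OF _ finite_order_cells]) blast
    show "\<Psi> ` {y \<in> Euc m. simplex_norm m y \<in> {1}} \<subseteq> \<Union>(\<Union>k<m. order_cells n k)"
    proof (rule image_subsetI)
      fix y assume "y \<in> {y \<in> Euc m. simplex_norm m y \<in> {1}}"
      then have y: "y \<in> Euc m" "simplex_norm m y = 1" by auto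
      have in_sphere: "\<Psi> y \<in> order_sphere n" using \<Psi>order_sphere y by simp
      have "\<not> simplex_norm m y < 1" using y(2) by simp
      then obtain k where k: "k \<le> m" "\<not> level m y k < level m y (Suc k)"
        unfolding simplex_norm_less_iff by blast
      moreover have "level m y k \<le> level m y (Suc k)" using y(2) k(1) simplex_norm_le_iff[of m y]
        by simp
      ultimately have eq: "level m y k = level m y (Suc k)" by simp
      have "level m y ` {..Suc m} \<subseteq> level m y ` ({..Suc m} - {Suc k})"
      proof (intro image_subsetI)
        fix l assume l: "l \<in> {..Suc m}"
        show "level m y l \<in> level m y ` ({..Suc m} - {Suc k})"
        proof (cases "l = Suc k")
          case True
          have "level m y k \<in> level m y ` ({..Suc m} - {Suc k})" using k(1) by (intro imageI) simp
          then show ?thesis using True eq by simp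
        qed (use l in blast)
      qed
      moreover have "\<Psi> y ` {..<2*n} \<subseteq> level m y ` {..Suc m}" 
        using r_bound by (auto simp: \<Psi>_def less_Suc_eq_le intro!: imageI)
      ultimately have "\<Psi> y ` {..<2*n} \<subseteq> level m y ` ({..Suc m} - {Suc k})"
        by (rule subset_trans[rotated])
      then have "card (\<Psi> y ` {..<2*n}) \<le> card ({..Suc m} - {Suc k})"
        by (rule surj_card_le[rotated]) simp
      also have "\<dots> = Suc m" using k(1) by simp
      finally have c: "card (\<Psi> y ` {..<2*n}) < m + 2" by simp
      then have "cell_of n (\<Psi> y) \<in> order_cells n (card (\<Psi> y ` {..<2*n}) - 2)"
        unfolding order_cells_def using in_sphere order_sphere_card_ge_2[OF in_sphere]
          by (intro imageI) simp
      moreover have "card (\<Psi> y ` {..<2*n}) - 2 < m" using c order_sphere_card_ge_2[OF in_sphere]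
        by linarith
      ultimately show "\<Psi> y \<in> \<Union>(\<Union>k<m. order_cells n k)" using cell_of_self[OF in_sphere] by blast
    qed
  qed blast
  then show ?thesis by blast
qed

lemma order_sphere_CW_complex: "CW_complex (top_of_set (order_sphere n), order_cells n)"
  unfolding CW_complex_def prod.case
proof (intro conjI allI impI ballI)
  show "Hausdorff_space (top_of_set (order_sphere n))"
    by (intro Hausdorff_space_subtopology Hausdorff_space_euclidean)
  have "(\<Union>k. \<Union>(order_cells n k)) = \<Union>(\<Union>k. order_cells n k)" by blast
  also have "\<dots> = order_sphere n" unfolding order_cells_Union using cell_of_self
    by (auto simp: cell_of_def)
  finally show U: "(\<Union>k. \<Union>(order_cells n k)) = topspace (top_of_set (order_sphere n))" by simp
  {
    fix k l e f assume ef: "e \<in> order_cells n k \<and> f \<in> order_cells n l \<and> (k, e) \<noteq> (l, f)"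
    then obtain F F' where F: "e = cell_of n F" "card (F ` {..<2*n}) = k + 2"
      "f = cell_of n F'" "card (F' ` {..<2*n}) = l + 2" unfolding order_cells_def by blast
    show "e \<inter> f = {}"
    proof (rule ccontr)
      assume "e \<inter> f \<noteq> {}"
      then obtain H where H: "H \<in> cell_of n F" "H \<in> cell_of n F'" using F by blast
      then have "e = f" using cell_of_eq F(1,3) by metis
      moreover have "k = l" using same_order_card[of n F H] same_order_card[of n F' H] H F(2,4)
        by (simp add: cell_of_def)
      ultimately show False using ef by simp
    qed
  next
    fix m e assume "e \<in> order_cells n m"
    then show "\<exists>\<Phi>. characteristic_map (top_of_set (order_sphere n)) (order_cells n) m e \<Phi>"
      unfolding order_cells_def using order_cell_characteristic_map[unfolded order_cells_def]
        by blast
  next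
    fix A assume A: "A \<subseteq> topspace (top_of_set (order_sphere n))"
      "\<forall>m. \<forall>e\<in>order_cells n m. closedin (top_of_set (order_sphere n)) (A \<inter> top_of_set (order_sphere n) closure_of e)"
    show "closedin (top_of_set (order_sphere n)) A"
      by (rule finite_CW_weak_topology[OF finite_order_cells U A(1)]) (use A(2) in blast)
  }
qed

lemma order_sphere_in_P5: "2 \<le> n \<Longrightarrow> (top_of_set (order_sphere n), order_cells n) \<in> P5"
  using order_sphere_CW_complex[of n] order_sphere_homeomorphic_nsphere[of n "n - 2"]
    unfolding P5_def by fastforce

section \<open>The permutation action\<close>

text \<open>The indices \<open>i\<close> and \<open>\<sigma> i\<close> have the same number of indices with smaller value, and this number
  determines the value.\<close>
lemma order_preserving_permutation_fixes:
  fixes F :: "nat \<Rightarrow> real"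
  assumes bij: "bij_betw \<sigma> L L" and "finite L"
    and ord: "\<And>i j. i \<in> L \<Longrightarrow> j \<in> L \<Longrightarrow> F i \<le> F j \<longleftrightarrow> F (\<sigma> i) \<le> F (\<sigma> j)" and i: "i \<in> L"
  shows "F (\<sigma> i) = F i"
proof -
  have into: "\<sigma> j \<in> L" if "j \<in> L" for j using bij that bij_betwE by blast
  define c where "c i = card {j \<in> L. F j < F i}" for i
  have mono: "c i < c j" if "F i < F j" "i \<in> L" for i j
    unfolding c_def by (rule psubset_card_mono) (use assms(2) that in auto)
  have "{j \<in> L. F j < F (\<sigma> i)} = \<sigma> ` {j \<in> L. F j < F i}"
  proof
    show "\<sigma> ` {j \<in> L. F j < F i} \<subseteq> {j \<in> L. F j < F (\<sigma> i)}"
      using ord[OF i] into by (auto simp: not_le[symmetric])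
    show "{j \<in> L. F j < F (\<sigma> i)} \<subseteq> \<sigma> ` {j \<in> L. F j < F i}"
    proof
      fix j assume j: "j \<in> {j \<in> L. F j < F (\<sigma> i)}"
      then obtain l where l: "l \<in> L" "j = \<sigma> l" using bij unfolding bij_betw_def by blast
      then have "F l < F i" using j ord[OF i l(1)] by (auto simp: not_le[symmetric])
      then show "j \<in> \<sigma> ` {j \<in> L. F j < F i}" using l by blast
    qed
  qed
  moreover have "inj_on \<sigma> {j \<in> L. F j < F i}" using bij unfolding bij_betw_def
    by (auto intro: inj_on_subset)
  ultimately have "c (\<sigma> i) = c i" unfolding c_def by (simp add: card_image)
  then show ?thesis using mono[of "\<sigma> i" i] mono[of i "\<sigma> i"] into[OF i] i by (cases "F (\<sigma> i)"
    "F i" rule: linorder_cases) auto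
qed

definition relabel :: "nat \<Rightarrow> (nat \<Rightarrow> nat) \<Rightarrow> (nat \<Rightarrow> real) \<Rightarrow> nat \<Rightarrow> real" where
  "relabel n \<pi> F = (\<lambda>i. if i < 2*n then F (2 * \<pi> (i div 2) + i mod 2) else 0)"

text \<open>The action is \<open>(g F) i = F (i g)\<close> for a right action of the group on \<open>n\<close> points, the same on both
  parity classes. A point of the sphere is nonconstant on one of the classes and yields the function
  \<open>f\<close> there; so no isotropy group is transitive on the \<open>n\<close> points.\<close>
lemma sphere_action:
  fixes G (structure)
  assumes "group G" and n: "2 \<le> n"
    and into: "\<And>g j. g \<in> carrier G \<Longrightarrow> j < n \<Longrightarrow> \<rho> g j < n"
    and one: "\<And>j. j < n \<Longrightarrow> \<rho> \<one> j = j"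
    and mult: "\<And>g h j. g \<in> carrier G \<Longrightarrow> h \<in> carrier G \<Longrightarrow> j < n \<Longrightarrow> \<rho> (g \<otimes> h) j = \<rho> h (\<rho> g j)"
  shows "\<exists>C\<in>P5. \<exists>\<phi>. cellular_action G C \<phi> \<and> (\<forall>x\<in>topspace (fst C). \<exists>f::nat \<Rightarrow> real.
    (\<forall>g\<in>stabilizer G \<phi> x. \<forall>j<n. f (\<rho> g j) = f j) \<and> (\<exists>i<n. \<exists>j<n. f i \<noteq> f j))"
proof -
  interpret group G by fact
  let ?X = "top_of_set (order_sphere n)"
  let ?\<phi>0 = "\<lambda>g. relabel n (\<rho> g)"
  define \<sigma> where "\<sigma> g i = 2 * \<rho> g (i div 2) + i mod 2" for g i
  have rel: "?\<phi>0 g F i = F (\<sigma> g i)" if "i < 2*n" for g F i using that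
    by (simp add: relabel_def \<sigma>_def)
  have \<sigma>_into: "\<sigma> g i < 2*n" if "g \<in> carrier G" "i < 2*n" for g i
    using into[OF that(1), of "i div 2"] that(2) unfolding \<sigma>_def by linarith
  have \<sigma>_one: "\<sigma> \<one> i = i" if "i < 2*n" for i using one[of "i div 2"] that by (simp add: \<sigma>_def)
  have \<sigma>_mult: "\<sigma> (g \<otimes> h) i = \<sigma> h (\<sigma> g i)" if "g \<in> carrier G" "h \<in> carrier G" "i < 2*n" for g h i
    using mult[OF that(1,2), of "i div 2"] that(3) by (simp add: \<sigma>_def)
  have \<sigma>_inv: "\<sigma> g (\<sigma> (inv g) i) = i" "\<sigma> (inv g) (\<sigma> g i) = i" if "g \<in> carrier G" "i < 2*n" for g i
    using \<sigma>_mult[of g "inv g" i] \<sigma>_mult[of "inv g" g i] \<sigma>_one that by simp_all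
  have \<rho>_inv: "\<rho> g (\<rho> (inv g) j) = j" if "g \<in> carrier G" "j < n" for g j
    using mult[of "inv g" g j] one that by simp
  have \<sigma>_bij: "bij_betw (\<sigma> g) {..<2*n} {..<2*n}" if g: "g \<in> carrier G" for g
    by (rule bij_betw_byWitness[where f' = "\<sigma> (inv g)"]) (use \<sigma>_inv \<sigma>_into g in auto)
  have sph_into: "?\<phi>0 g F \<in> order_sphere n" if g: "g \<in> carrier G" and F: "F \<in> order_sphere n"
    for g F
  proof -
    obtain a where a: "a < n" "F (2*a) = 0" using F unfolding order_sphere_def by blast
    obtain b where b: "b < n" "F (2*b+1) = 0" using F unfolding order_sphere_def by blast
    obtain t where t: "t < 2*n" "F t = 1" using F unfolding order_sphere_def by blast
    have "\<exists>i<n. ?\<phi>0 g F (2*i) = 0"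
      using a into[of "inv g" a] \<rho>_inv[OF g a(1)] g
      by (intro exI[of _ "\<rho> (inv g) a"]) (simp add: relabel_def)
    moreover have "\<exists>i<n. ?\<phi>0 g F (2*i+1) = 0"
      using b into[of "inv g" b] \<rho>_inv[OF g b(1)] g
      by (intro exI[of _ "\<rho> (inv g) b"]) (simp add: relabel_def)
    moreover have "\<exists>i<2*n. ?\<phi>0 g F i = 1"
      using t \<sigma>_into[of "inv g" t] \<sigma>_inv(1)[OF g t(1)] g rel by (intro exI[of _ "\<sigma> (inv g) t"]) simp
    moreover have "0 \<le> ?\<phi>0 g F i \<and> ?\<phi>0 g F i \<le> 1" for i using F
      by (simp add: order_sphere_def relabel_def)
    ultimately show ?thesis unfolding order_sphere_def by (auto simp: relabel_def)
  qed
  have law1: "?\<phi>0 \<one> F = F" if F: "F \<in> order_sphere n" for F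
  proof
    fix i show "?\<phi>0 \<one> F i = F i" using F rel[of i \<one> F] \<sigma>_one[of i] by (cases
      "i < 2*n") (simp_all add: order_sphere_def relabel_def)
  qed
  have law2: "?\<phi>0 (g \<otimes> h) F = ?\<phi>0 g (?\<phi>0 h F)" if gh: "g \<in> carrier G" "h \<in> carrier G" for g h F
  proof
    fix i show "?\<phi>0 (g \<otimes> h) F i = ?\<phi>0 g (?\<phi>0 h F) i"
    proof (cases "i < 2*n")
      case True
      then show ?thesis using rel \<sigma>_mult[OF gh True] \<sigma>_into[OF gh(1) True] by simp
    qed (simp add: relabel_def)
  qed
  have order: "same_order n (?\<phi>0 g F) (?\<phi>0 g F')" if g: "g \<in> carrier G" and "same_order n F F'"
    for g F F'
    using that(2) \<sigma>_into[OF g] rel unfolding same_order_def by simp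
  have cell_image: "?\<phi>0 g ` cell_of n F = cell_of n (?\<phi>0 g F)" if g: "g \<in> carrier G" and F:
    "F \<in> order_sphere n" for g F
  proof
    show "?\<phi>0 g ` cell_of n F \<subseteq> cell_of n (?\<phi>0 g F)"
      using order[OF g] sph_into[OF g] unfolding cell_of_def by blast
    show "cell_of n (?\<phi>0 g F) \<subseteq> ?\<phi>0 g ` cell_of n F"
    proof
      fix H assume H: "H \<in> cell_of n (?\<phi>0 g F)"
      then have Hs: "H \<in> order_sphere n" and Ho: "same_order n (?\<phi>0 g F) H"
        by (auto simp: cell_of_def)
      have ig: "inv g \<in> carrier G" using g by simp
      have "same_order n (?\<phi>0 (inv g) (?\<phi>0 g F)) (?\<phi>0 (inv g) H)" by (rule order[OF ig Ho])
      then have "?\<phi>0 (inv g) H \<in> cell_of n F"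
        using law2[OF ig g, of F] law1[OF F] g sph_into[OF ig Hs] by (simp add: cell_of_def)
      moreover have "H = ?\<phi>0 g (?\<phi>0 (inv g) H)" using law2[OF g ig, of H] law1[OF Hs] g by simp
      ultimately show "H \<in> ?\<phi>0 g ` cell_of n F" by (metis imageI)
    qed
  qed
  have act: "cellular_action G (?X, order_cells n) (\<lambda>g. restrict (?\<phi>0 g) (topspace ?X))"
  proof (rule cellular_actionI)
    fix x assume "x \<in> topspace ?X" then show "?\<phi>0 \<one> x = x" using law1 by simp
  next
    fix g h x assume "g \<in> carrier G" "h \<in> carrier G" then show "?\<phi>0 (g \<otimes> h) x = ?\<phi>0 g (?\<phi>0 h x)"
      by (rule law2)
  next
    fix g assume g: "g \<in> carrier G"
    have "continuous_on (order_sphere n) (\<lambda>F. ?\<phi>0 g F i)" for i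
      unfolding relabel_def by (cases "i < 2*n") (auto intro: continuous_on_coordinate)
    then have "continuous_on (order_sphere n) (?\<phi>0 g)"
      by (rule continuous_on_coordinatewise_then_product)
    then show "continuous_map ?X ?X (?\<phi>0 g)"
      using sph_into[OF g] by (simp add: continuous_map_in_subtopology image_subset_iff)
  next
    fix e assume "e \<in> (\<Union>k. order_cells n k)"
    then show "e \<subseteq> topspace ?X" unfolding order_cells_Union by (auto simp: cell_of_def)
  next
    fix g e assume g: "g \<in> carrier G" and "e \<in> (\<Union>k. order_cells n k)"
    then obtain F where F: "F \<in> order_sphere n" "e = cell_of n F" unfolding order_cells_Union
      by blast
    show "?\<phi>0 g ` e \<in> (\<Union>k. order_cells n k)"
      unfolding order_cells_Union F(2) cell_image[OF g F(1)] using sph_into[OF g F(1)]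
        by (rule imageI)
  next
    fix g e x assume g: "g \<in> carrier G" and "e \<in> (\<Union>k. order_cells n k)" and eq: "?\<phi>0 g ` e = e"
      and x: "x \<in> e"
    then obtain F where F: "F \<in> order_sphere n" "e = cell_of n F" unfolding order_cells_Union
      by blast
    have xs: "x \<in> order_sphere n" and ex: "e = cell_of n x" using x F(2) cell_of_eq[of x n F]
      by (auto simp: cell_of_def)
    have "?\<phi>0 g x \<in> cell_of n x" using eq x ex by blast
    then have so: "same_order n x (?\<phi>0 g x)" by (simp add: cell_of_def)
    have fixed: "x (\<sigma> g i) = x i" if i: "i < 2*n" for i
    proof (rule order_preserving_permutation_fixes[OF \<sigma>_bij[OF g]])
      fix i j assume "i \<in> {..<2*n}" "j \<in> {..<2*n}"
      then show "x i \<le> x j \<longleftrightarrow> x (\<sigma> g i) \<le> x (\<sigma> g j)" using so rel unfolding same_order_def by simp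
    qed (use i in auto)
    show "?\<phi>0 g x = x"
    proof
      fix i show "?\<phi>0 g x i = x i"
      proof (cases "i < 2*n")
        case True
        then show ?thesis using fixed rel by simp
      next
        case False
        then show ?thesis using xs by (simp add: relabel_def order_sphere_def)
      qed
    qed
  qed fact
  have nonconst:
    "\<exists>f::nat \<Rightarrow> real. (\<forall>g\<in>stabilizer G (\<lambda>g. restrict (?\<phi>0 g) (topspace ?X)) x. \<forall>j<n. f (\<rho> g j)
    = f j) \<and>
      (\<exists>i<n. \<exists>j<n. f i \<noteq> f j)" if x: "x \<in> topspace ?X" for x
  proof -
    have xs: "x \<in> order_sphere n" using x by simp
    obtain t where t: "t < 2*n" "x t = 1" using xs unfolding order_sphere_def by blast
    define c where "c = t mod 2"
    define f where "f j = x (2*j+c)" for j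
    have c: "c = 0 \<or> c = 1" unfolding c_def by auto
    have "\<exists>j<n. x (2*j+c) = 0" using c xs unfolding order_sphere_def by auto
    then obtain j where j: "j < n" "f j = 0" unfolding f_def by blast
    have t2: "t div 2 < n" "f (t div 2) = 1" using t unfolding f_def c_def by auto
    have "f (\<rho> g j) = f j" if g: "g \<in> stabilizer G (\<lambda>g. restrict (?\<phi>0 g) (topspace ?X)) x" and j:
      "j < n" for g j
    proof -
      have "?\<phi>0 g x = x" using g x by (simp add: stabilizer_restrict)
      then have "x (2*j+c) = ?\<phi>0 g x (2*j+c)" by simp
      also have "\<dots> = x (2 * \<rho> g ((2*j+c) div 2) + (2*j+c) mod 2)" using j c
        by (auto simp: relabel_def)
      also have "\<dots> = x (2 * \<rho> g j + c)" using c by auto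
      finally show ?thesis by (simp add: f_def)
    qed
    moreover have "f (t div 2) \<noteq> f j" using t2 j by simp
    ultimately show ?thesis using t2(1) j(1) by blast
  qed
  have *: "\<forall>x\<in>topspace (fst (?X, order_cells n)). \<exists>f::nat \<Rightarrow> real.
      (\<forall>g\<in>stabilizer G (\<lambda>g. restrict (?\<phi>0 g) (topspace ?X)) x. \<forall>j<n. f (\<rho> g j) = f j) \<and>
      (\<exists>i<n. \<exists>j<n. f i \<noteq> f j)"
    unfolding fst_conv by (rule ballI) (rule nonconst)
  show ?thesis
    by (rule bexI[OF _ order_sphere_in_P5[OF n]], rule exI, rule conjI[OF act *])
qed

section \<open>The line subdivided at the integers\<close>

definition axis_point :: "real \<Rightarrow> nat \<Rightarrow> real" where
  "axis_point r = (\<lambda>i. if i = 0 then r else 0)"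

definition line_cells :: "nat \<Rightarrow> (nat \<Rightarrow> real) set set" where
  "line_cells n = (if n = 0 then range (\<lambda>k::int. {axis_point (of_int k)})
     else if n = 1 then range (\<lambda>k::int. axis_point ` {of_int k<..<of_int k + 1}) else {})"

lemma axis_point_0 [simp]: "axis_point r 0 = r"
  by (simp add: axis_point_def)

lemma axis_point_Euc [simp]: "axis_point r \<in> Euc 1"
  by (simp add: axis_point_def)

lemma axis_point_eq: "x \<in> Euc 1 \<Longrightarrow> axis_point (x 0) = x"
  by (auto simp: axis_point_def fun_eq_iff)

lemma axis_point_inject [simp]: "axis_point r = axis_point s \<longleftrightarrow> r = s"
  by (metis axis_point_0)

lemma continuous_on_axis_point: "continuous_on S f \<Longrightarrow> continuous_on S (\<lambda>x. axis_point (f x))"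
proof (rule continuous_on_coordinatewise_then_product)
  fix i assume "continuous_on S f"
  then show "continuous_on S (\<lambda>x. axis_point (f x) i)" unfolding axis_point_def by (cases
    "i = 0") auto
qed

lemma line_cells_cases:
  assumes "e \<in> line_cells n"
  obtains k :: int where "n = 0" "e = {axis_point (of_int k)}" | k :: int where "n = 1"
    "e = axis_point ` {of_int k<..<of_int k + 1}"
  using assms unfolding line_cells_def by (auto split: if_splits)

lemma line_homeomorphic: "top_of_set (Euc 1) homeomorphic_space euclideanreal"
proof -
  have "homeomorphic_maps (top_of_set (Euc 1)) euclideanreal (\<lambda>x. x 0) axis_point"
    unfolding homeomorphic_maps_def
    using continuous_on_axis_point[OF continuous_on_id, of UNIV] axis_point_eq continuous_on_coordinate[of "Euc 1" 0]
    by (simp add: continuous_map_in_subtopology image_subset_iff axis_point_def)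
  then show ?thesis unfolding homeomorphic_space_def by blast
qed

lemma closed_if_closed_on_unit_intervals:
  fixes A :: "real set"
  assumes "\<And>k::int. closed (A \<inter> {of_int k..of_int k + 1})"
  shows "closed A"
proof -
  have "open (- A)"
  proof (subst open_subopen, intro ballI)
    fix r assume r: "r \<in> - A"
    define k where "k = \<lfloor>r\<rfloor>"
    define B where "B = (A \<inter> {of_int (k-1)..of_int (k-1) + 1}) \<union> (A \<inter> {of_int k..of_int k + 1})
      \<union> (A \<inter> {of_int (k+1)..of_int (k+1) + 1})"
    have "closed B" unfolding B_def by (intro closed_Un assms)
    then have "open ({of_int k - 1<..<of_int k + 2} - B)" by (intro open_Diff) auto
    moreover have "of_int k \<le> r" "r < of_int k + 1" unfolding k_def by linarith+
    then have "r \<in> {of_int k - 1<..<of_int k + 2} - B" using r unfolding B_def by auto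
    moreover have "{of_int k - 1<..<of_int k + 2} - B \<subseteq> - A" unfolding B_def by auto
    ultimately show "\<exists>T. open T \<and> r \<in> T \<and> T \<subseteq> - A" by blast
  qed
  then show ?thesis by (simp add: closed_def)
qed

text \<open>For the weak topology: the closure of a one-cell contains its two end points, so a set that is
  closed in the closures of all cells is closed in each interval between consecutive integers.\<close>
lemma line_CW_complex: "CW_complex (top_of_set (Euc 1), line_cells)"
  unfolding CW_complex_def prod.case
proof (intro conjI allI impI ballI)
  let ?X = "top_of_set (Euc 1)"
  show "Hausdorff_space ?X" by (intro Hausdorff_space_subtopology Hausdorff_space_euclidean)
  show "(\<Union>n. \<Union>(line_cells n)) = topspace ?X"
  proof (intro equalityI subsetI)
    fix x assume "x \<in> (\<Union>n. \<Union>(line_cells n))"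
    then obtain n e where "e \<in> line_cells n" "x \<in> e" by blast
    then show "x \<in> topspace ?X" by (cases rule: line_cells_cases) (auto simp: axis_point_def)
  next
    fix x assume "x \<in> topspace ?X"
    then have x: "x = axis_point (x 0)" using axis_point_eq by simp
    show "x \<in> (\<Union>n. \<Union>(line_cells n))"
    proof (cases "x 0 = of_int \<lfloor>x 0\<rfloor>")
      case True
      then have "x \<in> {axis_point (of_int \<lfloor>x 0\<rfloor>)}" using x by simp
      moreover have "{axis_point (of_int \<lfloor>x 0\<rfloor>)} \<in> line_cells 0" by (simp add: line_cells_def)
      ultimately show ?thesis by blast
    next
      case False
      then have "of_int \<lfloor>x 0\<rfloor> < x 0" "x 0 < of_int \<lfloor>x 0\<rfloor> + 1" by linarith+
      then have "x 0 \<in> {of_int \<lfloor>x 0\<rfloor><..<of_int \<lfloor>x 0\<rfloor> + 1}"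
        by (simp only: greaterThanLessThan_iff simp_thms)
      then have "x \<in> axis_point ` {of_int \<lfloor>x 0\<rfloor><..<of_int \<lfloor>x 0\<rfloor> + 1}" using x by (metis imageI)
      moreover have "axis_point ` {of_int \<lfloor>x 0\<rfloor><..<of_int \<lfloor>x 0\<rfloor> + 1} \<in> line_cells 1"
        by (simp add: line_cells_def)
      ultimately show ?thesis by blast
    qed
  qed
  {
    fix m n e f assume ef: "e \<in> line_cells m \<and> f \<in> line_cells n \<and> (m, e) \<noteq> (n, f)"
    have succ: "of_int l < (of_int k + 1 :: real) \<longleftrightarrow> l \<le> k" for k l :: int
      using of_int_less_iff[of l "k + 1", where ?'a = real] by simp
    then have int: "\<not> (of_int k < (of_int l :: real) \<and> of_int l < (of_int k + 1 :: real))"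
      for k l :: int
      by simp
    have int2: "k = l" if r: "of_int k < r" "r < of_int k + 1" "of_int l < r" "r < of_int l + 1"
      for k l :: int and r :: real
      using less_trans[OF r(1,4)] less_trans[OF r(3,2)] unfolding succ by simp
    from ef have e: "e \<in> line_cells m" and f: "f \<in> line_cells n" and ne: "(m, e) \<noteq> (n, f)" by auto
    show "e \<inter> f = {}"
      using e
    proof (cases rule: line_cells_cases)
      case (1 k)
      note e = this
      from f show ?thesis by (cases rule: line_cells_cases) (use e ne int in auto)
    next
      case (2 k)
      note e = this
      from f show ?thesis
      proof (cases rule: line_cells_cases)
        case (1 l)
        then show ?thesis using e int by auto
      next
        case (2 l)
        then have "k \<noteq> l" using e ne by auto
        then show ?thesis using e 2 int2 by auto
      qed
    qed
  next
    fix n e assume "e \<in> line_cells n"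
    then show "\<exists>\<Phi>. characteristic_map ?X line_cells n e \<Phi>"
    proof (cases rule: line_cells_cases)
      case (1 k)
      have d: "unit_disc 0 = {\<lambda>_. 0}" "topspace (open_disc 0) = {\<lambda>_. 0}"
        by (auto simp: unit_disc_def topspace_open_disc)
      have b: "disc_boundary 0 = {}" by (simp add: disc_boundary_def)
      have "homeomorphic_maps (open_disc 0) (subtopology ?X {axis_point (of_int k)}) (\<lambda>_. axis_point (of_int k)) (\<lambda>_ _. 0)"
        unfolding homeomorphic_maps_def using d axis_point_Euc[of "of_int k"]
        by (simp add: continuous_map_const image_subset_iff)
      then have "characteristic_map ?X line_cells 0 {axis_point (of_int k)} (\<lambda>_. axis_point (of_int k))"
        unfolding characteristic_map_def homeomorphic_maps_map b
        using axis_point_Euc[of "of_int k"] by (auto simp: continuous_map_const intro!: exI[of _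
          "{}"])
      then show ?thesis using 1 by blast
    next
      case (2 k)
      define \<Phi> where "\<Phi> y = axis_point (of_int k + (y 0 + 1) / 2)" for y :: "nat \<Rightarrow> real"
      define \<Omega> where "\<Omega> x = axis_point (2 * (x 0 - of_int k) - 1)" for x :: "nat \<Rightarrow> real"
      have cont: "continuous_on S \<Phi>" "continuous_on S \<Omega>" for S
        unfolding \<Phi>_def \<Omega>_def
          by (intro continuous_on_axis_point continuous_intros continuous_on_coordinate; simp)+
      have eE: "e \<subseteq> Euc 1" using 2 by (auto simp: axis_point_def)
      have sub: "subtopology ?X e = top_of_set e"
        unfolding subtopology_subtopology using eE by (simp add: Int_absorb1)
      have od: "y \<in> Euc 1 \<and> - 1 < y 0 \<and> y 0 < 1" if
        "y \<in> {x. (\<forall>i\<ge>1. x i = 0) \<and> (\<Sum>i<1. (x i)\<^sup>2) < 1}" for y :: "nat \<Rightarrow> real"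
        using that by (simp add: abs_square_less_1 abs_less_iff)
      have do: "axis_point r \<in> {x. (\<forall>i\<ge>1. x i = 0) \<and> (\<Sum>i<1. (x i)\<^sup>2) < 1}" if "- 1 < r" "r < 1"
        for r
        using that by (simp add: axis_point_def abs_square_less_1 abs_less_iff)
      have "homeomorphic_maps (open_disc 1) (subtopology ?X e) \<Phi> \<Omega>"
      proof -
        have "\<Phi> y \<in> e" if "y \<in> topspace (open_disc 1)" for y
          using od[of y] that unfolding topspace_open_disc 2 \<Phi>_def by (intro imageI) auto
        moreover have "\<Omega> x \<in> topspace (open_disc 1)" if "x \<in> e" for x
          using that unfolding topspace_open_disc 2 \<Omega>_def by (intro do) auto
        moreover have "\<Omega> (\<Phi> y) = y" if "y \<in> topspace (open_disc 1)" for y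
          using od[of y] that axis_point_eq[of y] unfolding topspace_open_disc \<Omega>_def \<Phi>_def
            by (simp add: field_simps)
        moreover have "\<Phi> (\<Omega> x) = x" if "x \<in> e" for x
        proof -
          have "of_int k + (2 * (x 0 - of_int k) - 1 + 1) / 2 = x 0" by (simp add: field_simps)
          then show ?thesis using axis_point_eq[of x] eE that unfolding \<Omega>_def \<Phi>_def axis_point_0
            by auto
        qed
        ultimately show ?thesis
          unfolding homeomorphic_maps_def sub using cont eE
          by (simp add: open_disc_eq continuous_map_in_subtopology image_subset_iff)
      qed
      then have h: "homeomorphic_map (open_disc 1) (subtopology ?X e) \<Phi>"
        using homeomorphic_maps_map by blast
      have c: "continuous_map (closed_disc 1) ?X \<Phi>"
        using cont by (simp add: closed_disc_eq continuous_map_in_subtopology image_subset_iff \<Phi>_def axis_point_def)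
      let ?F = "{{axis_point (of_int k)}, {axis_point (of_int (k + 1))}}"
      have "\<Phi> ` disc_boundary 1 \<subseteq> \<Union>?F"
      proof (rule image_subsetI)
        fix y assume "y \<in> disc_boundary 1"
        then have "y 0 = 1 \<or> y 0 = -1" by (simp add: disc_boundary_def power2_eq_1_iff)
        then show "\<Phi> y \<in> \<Union>?F" by (auto simp: \<Phi>_def)
      qed
      moreover have "{axis_point (of_int l)} \<in> line_cells 0" for l :: int
        by (simp add: line_cells_def)
      then have "?F \<subseteq> (\<Union>n<1. line_cells n)" by blast
      ultimately have "characteristic_map ?X line_cells 1 e \<Phi>"
        unfolding characteristic_map_def using c h by (intro conjI exI[of _ ?F]) simp_all
      then show ?thesis using 2 by blast
    qed
  next
    fix A assume A: "A \<subseteq> topspace ?X" and closed: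
      "\<forall>n. \<forall>e\<in>line_cells n. closedin ?X (A \<inter> ?X closure_of e)"
    have ptc: "continuous_map euclideanreal ?X axis_point"
      using continuous_on_axis_point[OF continuous_on_id, of UNIV]
        by (simp add: continuous_map_in_subtopology image_subset_iff axis_point_def)
    have "closed {r. axis_point r \<in> A}"
    proof (rule closed_if_closed_on_unit_intervals)
      fix k :: int
      let ?e = "axis_point ` {of_int k<..<of_int k + 1}"
      have "?e \<in> line_cells 1" by (simp add: line_cells_def)
      then have "closedin ?X (A \<inter> ?X closure_of ?e)" using closed by blast
      then have "closedin euclideanreal {r \<in> topspace euclideanreal. axis_point r \<in> A \<inter> ?X closure_of ?e}"
        by (rule closedin_continuous_map_preimage[OF ptc])
      then have "closed {r. axis_point r \<in> A \<inter> ?X closure_of ?e}" by simp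
      then have "closed ({r. axis_point r \<in> A \<inter> ?X closure_of ?e} \<inter> {of_int k..of_int k + 1})"
        by (rule closed_Int) simp
      moreover have
        "axis_point ` (euclideanreal closure_of {of_int k<..<of_int k + 1}) \<subseteq> ?X closure_of ?e"
        by (rule continuous_map_image_closure_subset[OF ptc])
      then have "axis_point r \<in> ?X closure_of ?e" if "r \<in> {of_int k..of_int k + 1}" for r
        using that by (auto simp: image_subset_iff)
      then have "{r. axis_point r \<in> A} \<inter> {of_int k..of_int k + 1}
        = {r. axis_point r \<in> A \<inter> ?X closure_of ?e} \<inter> {of_int k..of_int k + 1}"
        by blast
      ultimately show "closed ({r. axis_point r \<in> A} \<inter> {of_int k..of_int k + 1})" by simp
    qed
    then have "closedin ?X {x \<in> topspace ?X. x 0 \<in> {r. axis_point r \<in> A}}"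
      by (intro closedin_continuous_map_preimage[of _ euclideanreal]) (simp_all add: continuous_on_coordinate)
    moreover have "{x \<in> topspace ?X. x 0 \<in> {r. axis_point r \<in> A}} = A" using A axis_point_eq by auto
    ultimately show "closedin ?X A" by simp
  }
qed

lemma line_in_P5: "(top_of_set (Euc 1), line_cells) \<in> P5"
  unfolding P5_def using line_CW_complex line_homeomorphic by blast

lemma translation_action:
  fixes G (structure) and \<kappa> :: "'a \<Rightarrow> int"
  assumes "group G" and mult: "\<And>g h. g \<in> carrier G \<Longrightarrow> h \<in> carrier G \<Longrightarrow> \<kappa> (g \<otimes> h) = \<kappa> g + \<kappa> h"
  shows "\<exists>C\<in>P5. \<exists>\<phi>. cellular_action G C \<phi> \<and>
    (\<forall>x\<in>topspace (fst C). stabilizer G \<phi> x = {g \<in> carrier G. \<kappa> g = 0})"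
proof -
  interpret group G by fact
  let ?X = "top_of_set (Euc 1)"
  define \<tau> where "\<tau> g x = axis_point (x 0 + of_int (\<kappa> g))" for g and x :: "nat \<Rightarrow> real"
  have one: "\<kappa> \<one> = 0" using mult[of \<one> \<one>] by simp
  have pcell: "\<tau> g ` {axis_point (of_int k)} = {axis_point (of_int (k + \<kappa> g))}" for g k
    by (simp add: \<tau>_def)
  have ecell: "\<tau> g ` axis_point ` {of_int k<..<of_int k + 1}
    = axis_point ` {of_int (k + \<kappa> g)<..<of_int (k + \<kappa> g) + 1}" for g k
  proof -
    have "\<tau> g ` axis_point ` {of_int k<..<of_int k + 1}
      = axis_point ` (\<lambda>r. of_int (\<kappa> g) + r) ` {of_int k<..<of_int k + 1}"
      unfolding image_image \<tau>_def by (simp add: add.commute)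
    also have "(\<lambda>r. of_int (\<kappa> g) + r) ` {of_int k<..<of_int k + 1}
      = {of_int (k + \<kappa> g)<..<of_int (k + \<kappa> g) + (1::real)}"
    proof (intro equalityI subsetI)
      fix r :: real assume "r \<in> {of_int (k + \<kappa> g)<..<of_int (k + \<kappa> g) + 1}"
      then show "r \<in> (\<lambda>r. of_int (\<kappa> g) + r) ` {of_int k<..<of_int k + 1}"
        by (intro image_eqI[of _ _ "r - of_int (\<kappa> g)"]) auto
    qed auto
    finally show ?thesis .
  qed
  have act: "cellular_action G (?X, line_cells) (\<lambda>g. restrict (\<tau> g) (topspace ?X))"
  proof (rule cellular_actionI)
    fix x assume "x \<in> topspace ?X" then show "\<tau> \<one> x = x" using axis_point_eq
      by (simp add: \<tau>_def one)
  next
    fix g h x assume "g \<in> carrier G" "h \<in> carrier G"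
    then show "\<tau> (g \<otimes> h) x = \<tau> g (\<tau> h x)" by (simp add: \<tau>_def mult)
  next
    fix g
    have "continuous_on (Euc 1) (\<tau> g)"
      unfolding \<tau>_def by (intro continuous_on_axis_point continuous_intros continuous_on_coordinate)
    then show "continuous_map ?X ?X (\<tau> g)"
      by (simp add: continuous_map_in_subtopology image_subset_iff \<tau>_def axis_point_def)
  next
    fix e assume "e \<in> (\<Union>n. line_cells n)"
    then obtain n where "e \<in> line_cells n" by blast
    then show "e \<subseteq> topspace ?X" by (cases rule: line_cells_cases) (auto simp: axis_point_def)
  next
    fix g e assume "e \<in> (\<Union>n. line_cells n)"
    then obtain n where "e \<in> line_cells n" by blast
    then have "\<tau> g ` e \<in> line_cells n"
    proof (cases rule: line_cells_cases)
      case (1 k)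
      show ?thesis unfolding 1 pcell by (simp add: line_cells_def del: of_int_add)
    next
      case (2 k)
      show ?thesis unfolding 2 ecell by (simp add: line_cells_def del: of_int_add)
    qed
    then show "\<tau> g ` e \<in> (\<Union>n. line_cells n)" by blast
  next
    fix g e x assume "e \<in> (\<Union>n. line_cells n)" and eq: "\<tau> g ` e = e" and x: "x \<in> e"
    then obtain n where "e \<in> line_cells n" by blast
    then have "\<kappa> g = 0 \<and> x \<in> Euc 1"
    proof (cases rule: line_cells_cases)
      case (1 k)
      then have "axis_point (of_int (k + \<kappa> g)) = axis_point (of_int k)" using eq pcell[of g k]
        by (metis singleton_inject)
      then show ?thesis using x 1 axis_point_Euc[of "of_int k"] by simp
    next
      case (2 k)
      have "axis_point (of_int k + 1/2) \<in> e" unfolding 2 by (rule imageI) simp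
      then have "\<tau> g (axis_point (of_int k + 1/2)) \<in> e" using eq by blast
      then have "of_int k < of_int k + 1/2 + (of_int (\<kappa> g) :: real)"
        "of_int k + 1/2 + (of_int (\<kappa> g) :: real) < of_int k + 1"
        unfolding 2 \<tau>_def by auto
      then have "\<kappa> g = 0" by linarith
      then show ?thesis using x 2 by (auto simp: axis_point_def)
    qed
    then show "\<tau> g x = x" using axis_point_eq by (simp add: \<tau>_def)
  qed fact
  have "stabilizer G (\<lambda>g. restrict (\<tau> g) (topspace ?X)) x = {g \<in> carrier G. \<kappa> g = 0}" if x:
    "x \<in> topspace ?X" for x
  proof -
    have "\<tau> g x = x \<longleftrightarrow> \<kappa> g = 0" for g
      using axis_point_eq[of x] x axis_point_inject[of "x 0 + of_int (\<kappa> g)" "x 0"]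
        by (simp add: \<tau>_def)
    then show ?thesis using x by (simp add: stabilizer_restrict)
  qed
  then have *: "\<forall>x\<in>topspace (fst (?X, line_cells)).
      stabilizer G (\<lambda>g. restrict (\<tau> g) (topspace ?X)) x = {g \<in> carrier G. \<kappa> g = 0}"
    unfolding fst_conv by (intro ballI)
  show ?thesis
    by (rule bexI[OF _ line_in_P5], rule exI, rule conjI[OF act *])
qed

section \<open>Virtually polycyclic groups belong to the class\<close>

context group
begin

lemma N_cell_actionI:
  assumes "C \<in> P" "cellular_action (G\<lparr>carrier := L\<rparr>) C \<phi>"
    and "\<And>x. x \<in> topspace (fst C) \<Longrightarrow> G\<lparr>carrier := stabilizer (G\<lparr>carrier := L\<rparr>) \<phi> x\<rparr> \<in> N_cell P"
  shows "G\<lparr>carrier := L\<rparr> \<in> N_cell P"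
  using N_cell.action[OF assms(1,2)] assms(3) by simp

lemma cellular_stabilizer_subgroup:
  assumes L: "subgroup L G" and act: "cellular_action (G\<lparr>carrier := L\<rparr>) C \<phi>" and x:
    "x \<in> topspace (fst C)"
  shows "subgroup (stabilizer (G\<lparr>carrier := L\<rparr>) \<phi> x) G" "stabilizer (G\<lparr>carrier := L\<rparr>) \<phi> x \<subseteq> L"
proof -
  obtain X E where C: "C = (X, E)" by (cases C)
  interpret A: group_action "G\<lparr>carrier := L\<rparr>" "topspace X" \<phi>
    using cellular_actionD(1) act C by blast
  show "subgroup (stabilizer (G\<lparr>carrier := L\<rparr>) \<phi> x) G"
    using incl_subgroup[OF L A.stabilizer_subgroup] x C by simp
  show "stabilizer (G\<lparr>carrier := L\<rparr>) \<phi> x \<subseteq> L" by (auto simp: stabilizer_def)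
qed

text \<open>Induction on the number \<open>n\<close> of cosets of \<open>H\<close> that meet \<open>L\<close>. If \<open>n = 1\<close>, then \<open>L\<close> is a subgroup of
  \<open>H\<close>. Otherwise \<open>L\<close> acts on a sphere such that no isotropy group is transitive on these cosets, so
  each isotropy group meets fewer of them.\<close>
lemma N_cell_finite_index:
  assumes H: "subgroup H G" and sub: "\<And>L. subgroup L G \<Longrightarrow> L \<subseteq> H \<Longrightarrow> G\<lparr>carrier := L\<rparr> \<in> N_cell P5"
    and L: "subgroup L G" "finite_index G L H"
  shows "G\<lparr>carrier := L\<rparr> \<in> N_cell P5"
  using L
proof (induction "card ((\<lambda>x. H #> x) ` L)" arbitrary: L rule: less_induct)
  case less
  note L = less.prems(1)
  define \<Omega> where "\<Omega> = (\<lambda>x. H #> x) ` L"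
  have fin: "finite \<Omega>" using less.prems(2) unfolding finite_index_def \<Omega>_def .
  have Lc: "x \<in> carrier G" if "x \<in> L" for x by (rule subgroup.mem_carrier[OF L that])
  have Hc: "H \<subseteq> carrier G" by (rule subgroup.subset[OF H])
  have H\<Omega>: "H \<in> \<Omega>"
    unfolding \<Omega>_def using coset_mult_one[OF Hc] subgroup.one_closed[OF L] by (metis imageI)
  define n where "n = card \<Omega>"
  show ?case
  proof (cases "n \<le> 1")
    case True
    have "L \<subseteq> H"
    proof
      fix x assume x: "x \<in> L"
      then have "H #> x \<in> \<Omega>" unfolding \<Omega>_def by (rule imageI)
      moreover have "card \<Omega> \<le> Suc 0" using True by (simp add: n_def)
      ultimately have "H #> x = H" using H\<Omega> fin card_le_Suc0_iff_eq by blast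
      then show "x \<in> H" by (rule coset_join1[OF _ Lc[OF x] H])
    qed
    then show ?thesis by (rule sub[OF L])
  next
    case False
    then have n: "2 \<le> n" by simp
    obtain \<beta> where \<beta>: "bij_betw \<beta> {..<n} \<Omega>"
      using ex_bij_betw_nat_finite[OF fin] unfolding n_def atLeast0LessThan by blast
    define \<gamma> where "\<gamma> = the_inv_into {..<n} \<beta>"
    have \<beta>\<gamma>: "\<beta> (\<gamma> w) = w" "\<gamma> w < n" if "w \<in> \<Omega>" for w
      using f_the_inv_into_f_bij_betw[OF \<beta>] bij_betwE[OF bij_betw_the_inv_into[OF \<beta>]] that
      unfolding \<gamma>_def by auto
    have \<gamma>\<beta>: "\<gamma> (\<beta> j) = j" "\<beta> j \<in> \<Omega>" if "j < n" for j
      using the_inv_into_f_f[of \<beta> "{..<n}" j] \<beta> that unfolding \<gamma>_def bij_betw_def by auto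
    define \<rho> where "\<rho> g j = \<gamma> (\<beta> j #> g)" for g j
    have \<Omega>_mult: "w #> g \<in> \<Omega>" if "w \<in> \<Omega>" "g \<in> L" for w g
    proof -
      obtain x where x: "x \<in> L" "w = H #> x" using \<open>w \<in> \<Omega>\<close> unfolding \<Omega>_def by (rule imageE)
      have "w #> g = H #> (x \<otimes> g)" unfolding x(2)
        by (rule coset_mult_assoc[OF Hc Lc[OF x(1)] Lc[OF that(2)]])
      then show ?thesis unfolding \<Omega>_def using subgroup.m_closed[OF L x(1) that(2)] by (metis imageI)
    qed
    have \<Omega>c: "w \<subseteq> carrier G" if "w \<in> \<Omega>" for w
    proof -
      obtain x where x: "x \<in> L" "w = H #> x" using \<open>w \<in> \<Omega>\<close> unfolding \<Omega>_def by (rule imageE)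
      then show ?thesis using r_coset_subset_G[OF Hc Lc] by simp
    qed
    let ?L = "G\<lparr>carrier := L\<rparr>"
    have "\<exists>C\<in>P5. \<exists>\<phi>. cellular_action ?L C \<phi> \<and> (\<forall>x\<in>topspace (fst C). \<exists>f::nat \<Rightarrow> real.
        (\<forall>g\<in>stabilizer ?L \<phi> x. \<forall>j<n. f (\<rho> g j) = f j) \<and> (\<exists>i<n. \<exists>j<n. f i \<noteq> f j))"
    proof (rule sphere_action[OF subgroup_imp_group[OF L] n])
      fix g j assume "g \<in> carrier ?L" "j < n"
      then show "\<rho> g j < n" unfolding \<rho>_def using \<beta>\<gamma>(2) \<Omega>_mult \<gamma>\<beta>(2) by simp
    next
      fix j assume "j < n"
      then show "\<rho> \<one>\<^bsub>?L\<^esub> j = j"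
        unfolding \<rho>_def using \<gamma>\<beta>[of j] \<Omega>c by simp
    next
      fix g h j assume g: "g \<in> carrier ?L" and h: "h \<in> carrier ?L" and j: "j < n"
      have "\<beta> j #> (g \<otimes> h) = \<beta> j #> g #> h"
        using coset_mult_assoc[OF \<Omega>c[OF \<gamma>\<beta>(2)[OF j]] Lc Lc] g h by simp
      then show "\<rho> (g \<otimes>\<^bsub>?L\<^esub> h) j = \<rho> h (\<rho> g j)"
        unfolding \<rho>_def using \<beta>\<gamma>(1)[OF \<Omega>_mult[OF \<gamma>\<beta>(2)[OF j]]] g by simp
    qed
    then obtain C \<phi> where C: "C \<in> P5" "cellular_action ?L C \<phi>"
      "\<And>x. x \<in> topspace (fst C) \<Longrightarrow> \<exists>f::nat \<Rightarrow> real.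
        (\<forall>g\<in>stabilizer ?L \<phi> x. \<forall>j<n. f (\<rho> g j) = f j) \<and> (\<exists>i<n. \<exists>j<n. f i \<noteq> f j)" by blast
    show ?thesis
    proof (rule N_cell_actionI[OF C(1,2)])
      fix x assume x: "x \<in> topspace (fst C)"
      define S where "S = stabilizer ?L \<phi> x"
      have S: "subgroup S G" "S \<subseteq> L" unfolding S_def
        by (rule cellular_stabilizer_subgroup[OF L C(2) x])+
      obtain f :: "nat \<Rightarrow> real" where f: "\<And>g j. g \<in> S \<Longrightarrow> j < n \<Longrightarrow> f (\<rho> g j) = f j"
        "\<exists>i<n. \<exists>j<n. f i \<noteq> f j"
        using C(3)[OF x] unfolding S_def by blast
      have subset: "(\<lambda>x. H #> x) ` S \<subseteq> \<Omega>" unfolding \<Omega>_def by (rule image_mono[OF S(2)])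
      have "(\<lambda>x. H #> x) ` S \<noteq> \<Omega>"
      proof
        assume eq: "(\<lambda>x. H #> x) ` S = \<Omega>"
        have "f i = f (\<gamma> H)" if i: "i < n" for i
        proof -
          have "\<beta> i \<in> (\<lambda>x. H #> x) ` S" using \<gamma>\<beta>(2)[OF i] eq by simp
          then obtain g where g: "\<beta> i = H #> g" "g \<in> S" by (rule imageE)
          have "\<rho> g (\<gamma> H) = i" unfolding \<rho>_def \<beta>\<gamma>(1)[OF H\<Omega>] g(1)[symmetric] by (rule \<gamma>\<beta>(1)[OF i])
          then show ?thesis using f(1)[OF g(2) \<beta>\<gamma>(2)[OF H\<Omega>]] by simp
        qed
        then show False using f(2) by metis
      qed
      then have "card ((\<lambda>x. H #> x) ` S) < card \<Omega>" using subset
        by (intro psubset_card_mono[OF fin]) blast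
      moreover have "finite_index G S H" unfolding finite_index_def
        by (rule finite_subset[OF subset fin])
      ultimately show "G\<lparr>carrier := stabilizer ?L \<phi> x\<rparr> \<in> N_cell P5"
        using less.hyps[of S] S(1) unfolding \<Omega>_def S_def by blast
    qed
  qed
qed

lemma r_coset_pow_mult:
  assumes A: "subgroup A G" and B: "subgroup B G"
    and nrm: "\<forall>b\<in>B. \<forall>a\<in>A. b \<otimes> a \<otimes> inv b \<in> A"
    and t: "t \<in> B" and x: "x \<in> A #> (t [^] (k::int))" and y: "y \<in> A #> (t [^] (l::int))"
  shows "x \<otimes> y \<in> A #> (t [^] (k + l))"
proof -
  have tc: "t \<in> carrier G" by (rule subgroup.mem_carrier[OF B t])
  note diff = r_coset_pow_diff[OF A B nrm t]
  have "\<one> \<in> A #> (t [^] (0::int))"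
    using subgroup.one_closed[OF A] coset_mult_one[OF subgroup.subset[OF A]] by simp
  then have "\<one> \<otimes> inv y \<in> A #> (t [^] (0 - l))" by (rule diff[OF _ y])
  then have "x \<otimes> inv (\<one> \<otimes> inv y) \<in> A #> (t [^] (k - (0 - l)))" by (rule diff[OF x])
  moreover have "y \<in> carrier G"
    using r_coset_subset_G[OF subgroup.subset[OF A] int_pow_closed[OF tc]] y by blast
  ultimately show ?thesis by simp
qed

text \<open>If \<open>A\<close> does not have finite index, then no nontrivial power of \<open>t\<close> lies in \<open>A\<close>. So the exponent
  of \<open>t\<close> is a homomorphism from \<open>L\<close> to the integers with kernel \<open>L \<inter> A\<close>, and \<open>L\<close> acts by translations
  with this kernel as isotropy group.\<close>
lemma N_cell_cyclic_extension:
  assumes A: "subgroup A G" and B: "subgroup B G" and AB: "cyclic_over G A B"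
    and fin: "\<And>L. subgroup L G \<Longrightarrow> finite_index G L A \<Longrightarrow> G\<lparr>carrier := L\<rparr> \<in> N_cell P5"
    and L: "subgroup L G" "L \<subseteq> B"
  shows "G\<lparr>carrier := L\<rparr> \<in> N_cell P5"
proof (cases "finite_index G L A")
  case True
  then show ?thesis by (rule fin[OF L(1)])
next
  case False
  obtain t where t: "t \<in> B" "\<And>b. b \<in> B \<Longrightarrow> \<exists>k::int. b \<in> A #> (t [^] k)"
    using AB unfolding cyclic_over_def by blast
  have nrm: "\<forall>b\<in>B. \<forall>a\<in>A. b \<otimes> a \<otimes> inv b \<in> A"
    using AB unfolding cyclic_over_def by blast
  have tc: "t \<in> carrier G" by (rule subgroup.mem_carrier[OF B t(1)])
  have Bc: "b \<in> carrier G" if "b \<in> B" for b by (rule subgroup.mem_carrier[OF B that])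
  note mult = r_coset_pow_mult[OF A B nrm t(1)]
  have coset: "A #> (t [^] k) = A #> b" if "b \<in> A #> (t [^] k)" for b and k :: int
    by (rule repr_independence[OF that int_pow_closed[OF tc] A])
  have torsion_free: "m = 0" if tm: "t [^] m \<in> A" for m :: int
  proof (rule ccontr)
    assume "m \<noteq> 0"
    \<comment> \<open>If \<open>t\<^sup>m\<close> lies in \<open>A\<close>, then the coset of \<open>t\<^sup>k\<close> depends only on \<open>k\<close> modulo \<open>m\<close>.\<close>
    define d where "d = \<bar>m\<bar>"
    have d: "d > 0" using \<open>m \<noteq> 0\<close> by (simp add: d_def)
    have td: "t [^] (d * q) \<in> A" for q
    proof -
      have "t [^] (m * (sgn m * q)) \<in> A"
        unfolding int_pow_pow[OF tc, symmetric] by (rule subgroup_int_pow_closed[OF A tm])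
      then show ?thesis unfolding d_def by (simp add: abs_sgn mult.assoc)
    qed
    have "(\<lambda>x. A #> x) ` L \<subseteq> (\<lambda>r. A #> (t [^] r)) ` {0..<d}"
    proof (rule image_subsetI)
      fix x assume "x \<in> L"
      then obtain k :: int where k: "x \<in> A #> (t [^] k)" using t(2) L(2) by blast
      have "t [^] k = t [^] (d * (k div d)) \<otimes> t [^] (k mod d)"
        using int_pow_mult[OF tc, of "d * (k div d)" "k mod d"] by simp
      then have "t [^] k \<in> A #> (t [^] (k mod d))" using td[of "k div d"] unfolding r_coset_def
        by blast
      then have "A #> x = A #> (t [^] (k mod d))" using coset[of "t [^] k" "k mod d"] coset[OF k]
        by simp
      then show "A #> x \<in> (\<lambda>r. A #> (t [^] r)) ` {0..<d}" using d by (intro image_eqI[of _ _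
        "k mod d"]) auto
    qed
    then have "finite ((\<lambda>x. A #> x) ` L)" by (rule finite_subset) simp
    then show False using False by (simp add: finite_index_def)
  qed
  have unique: "k = l" if "b \<in> A #> (t [^] k)" "b \<in> A #> (t [^] l)" for b and k l :: int
  proof -
    have "t [^] k \<in> A #> (t [^] l)" using coset that rcos_self[OF int_pow_closed[OF tc] A, of k]
      by metis
    then have "t [^] k \<otimes> inv (t [^] l) \<in> A"
      using subgroup.rcos_module_imp[OF A is_group int_pow_closed[OF tc]] by blast
    then have "t [^] (k - l) \<in> A" using int_pow_diff[OF tc] by simp
    then show ?thesis using torsion_free[of "k - l"] by simp
  qed
  define \<kappa> where "\<kappa> b = (SOME k::int. b \<in> A #> (t [^] k))" for b
  have \<kappa>: "b \<in> A #> (t [^] \<kappa> b)" if "b \<in> B" for b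
    unfolding \<kappa>_def by (rule someI_ex[OF t(2)[OF that]])
  let ?L = "G\<lparr>carrier := L\<rparr>"
  have "\<exists>C\<in>P5. \<exists>\<phi>. cellular_action ?L C \<phi> \<and>
      (\<forall>x\<in>topspace (fst C). stabilizer ?L \<phi> x = {g \<in> carrier ?L. \<kappa> g = 0})"
  proof (rule translation_action[OF subgroup_imp_group[OF L(1)]])
    fix g h assume "g \<in> carrier ?L" "h \<in> carrier ?L"
    then have gh: "g \<in> B" "h \<in> B" using L(2) by auto
    have "g \<otimes> h \<in> B" by (rule subgroup.m_closed[OF B gh])
    then have "\<kappa> (g \<otimes> h) = \<kappa> g + \<kappa> h" using unique[OF \<kappa> mult[OF \<kappa> \<kappa>]] gh by blast
    then show "\<kappa> (g \<otimes>\<^bsub>?L\<^esub> h) = \<kappa> g + \<kappa> h" by simp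
  qed
  then obtain C \<phi> where C: "C \<in> P5" "cellular_action ?L C \<phi>"
    "\<And>x. x \<in> topspace (fst C) \<Longrightarrow> stabilizer ?L \<phi> x = {g \<in> L. \<kappa> g = 0}" by auto
  show ?thesis
  proof (rule N_cell_actionI[OF C(1,2)])
    fix x assume x: "x \<in> topspace (fst C)"
    let ?S = "stabilizer ?L \<phi> x"
    have S: "subgroup ?S G" by (rule cellular_stabilizer_subgroup(1)[OF L(1) C(2) x])
    have SA: "?S \<subseteq> A"
    proof
      fix g assume "g \<in> ?S"
      then have "g \<in> B" "\<kappa> g = 0" using C(3)[OF x] L(2) by auto
      then show "g \<in> A" using \<kappa>[of g] coset_mult_one[OF subgroup.subset[OF A]] by simp
    qed
    have "A #> g = A" if "g \<in> ?S" for g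
      using coset_join2[OF _ A, of g] that SA subgroup.mem_carrier[OF S] by blast
    then have "(\<lambda>x. A #> x) ` ?S \<subseteq> {A}" by auto
    then have "finite_index G ?S A" unfolding finite_index_def by (rule finite_subset) simp
    then show "G\<lparr>carrier := ?S\<rparr> \<in> N_cell P5" by (rule fin[OF S])
  qed
qed

text \<open>Stating this for all subgroups of \<open>H\<close> makes the induction work: the isotropy groups that occur
  for a subgroup of \<open>B\<close> can meet \<open>A\<close> in a proper subgroup.\<close>
lemma N_cell_subgroups_of_polycyclic:
  assumes "polycyclic_in G H" "subgroup L G" "L \<subseteq> H"
  shows "G\<lparr>carrier := L\<rparr> \<in> N_cell P5"
  using assms
proof (induction arbitrary: L rule: polycyclic_in.induct)
  case one
  then have "carrier (G\<lparr>carrier := L\<rparr>) = {\<one>\<^bsub>G\<lparr>carrier := L\<rparr>\<^esub>}"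
    using subgroup.one_closed[OF one(1)] by auto
  then have "trivial_group (G\<lparr>carrier := L\<rparr>)"
    unfolding trivial_group_def using subgroup_imp_group[OF one(1)] by blast
  then show ?case by (rule N_cell.trivial)
next
  case (step A B)
  have A: "subgroup A G" by (rule polycyclic_in_subgroup[OF step.hyps(1)])
  show ?case
    by (rule N_cell_cyclic_extension[OF A step.hyps(2,3) N_cell_finite_index[OF A step.IH] step.prems])
qed

end

lemma virtually_polycyclic_in_N_cell:
  fixes G :: "('a, 'b) monoid_scheme"
  assumes "virtually_polycyclic_group G"
  shows "G \<in> N_cell P5"
proof -
  interpret group G using assms by (simp add: virtually_polycyclic_group_def)
  have "virtually_polycyclic_in G (carrier G)"
    using virtually_polycyclic_group_iff[OF subgroup_self] assms by simp
  then obtain H where H: "polycyclic_in G H" "finite_index G (carrier G) H"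
    unfolding virtually_polycyclic_in_def by blast
  have "G\<lparr>carrier := carrier G\<rparr> \<in> N_cell P5"
    by (rule N_cell_finite_index[OF polycyclic_in_subgroup[OF H(1)] N_cell_subgroups_of_polycyclic[OF H(1)] subgroup_self H(2)])
  then show ?thesis by simp
qed

theorem theorem3p8:
  shows "N_cell P5 = {G :: ('a, 'b) monoid_scheme. virtually_polycyclic_group G}"
  using N_cell_virtually_polycyclic virtually_polycyclic_in_N_cell by blast

end
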